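(* Let $k$ be a commutative ring with $\frac12\in k$, and let $\mathcal{C}$ be a $k$-linear rigid braided monoidal category with finite direct sums whose isomorphism classes of objects form a set. If the braiding $c$ on $\mathcal{C}$ is symmetric, then the Witt group $W(\mathcal{C})$ has a unital commutative ring structure, with multiplication induced by $$(M,b)\otimes(M',b')=(M\otimes M',\,b\,\square\, b'),\qquad b\,\square\, b'=(b\otimes b')\circ(1_M\otimes c_{M',M}\otimes 1_{M'}),$$ and with unit the class of $(I,b_I)$, where $b_I:I\otimes I\to I$ is the canonical isomorphism.
   Context: $\mathcal{C}$ is taken strict monoidal, with unit $I$ and braiding $c$. $k$-linear means Hom sets are $k$-modules and composition is $k$-bilinear. Rigid: each object $M$ has a dual $M^*$ with $\mathrm{ev}_M:M^*\otimes M\to I$ and $\mathrm{coev}_M:I\to M\otimes M^*$ satisfying the duality (triangle) identities. A bilinear form $b:M\otimes M\to I$ is symmetric if $b\circ c_{M,M}=b$, and non-singular if $h_M(b):=(b\otimes 1_{M^*})\circ(1_M\otimes \mathrm{coev}_M):M\to M^*$ is an isomorphism. A non-singular quadratic object is a pair $(M,b)$ with $b$ symmetric and non-singular; an isometry $(M,b)\to(M',b')$ is an isomorphism $f:M\to M'$ with $b'\circ(f\otimes f)=b$. The orthogonal sum is $(M,b)\perp(M',b')=(M\oplus M',b\oplus b')$ (zero on the cross terms). $\mathcal{Q}$ is the category of non-singular quadratic objects with isometries as morphisms. An object $M$ is weakly symmetric if $\mathrm{ev}_M=\mathrm{ev}_M\circ c_{M,M^*}\circ c_{M^*,M}$ (automatic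 if $c$ is symmetric); $\mathcal{D}$ is the category of weakly symmetric objects with isomorphisms as morphisms. For $M\in\mathcal{D}$ the hyperbolic object is $\mathcal{H}(M)=(M\oplus M^*,b_M)$, where $b_M$ vanishes on $M\otimes M$ and on $M^*\otimes M^*$, equals $\mathrm{ev}_M$ on $M^*\otimes M$, and equals $\mathrm{ev}_M\circ c_{M,M^*}$ on $M\otimes M^*$. The Witt group is $W(\mathcal{C})=K_0(\mathcal{Q})/\mathrm{Im}(K_0(\mathcal{H}):K_0(\mathcal{D})\to K_0(\mathcal{Q}))$, where $K_0$ denotes the Grothendieck group of the commutative monoid of isomorphism classes under $\perp$ (resp. $\oplus$). *)

theory Defs
  imports "HOL-Algebra.Module" "HOL-Algebra.QuotRing"
begin

section \<open>Linear rigid braided strict monoidal categories with direct sums\<close>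

text \<open>
  The Hom-sets are modules over the base ring in the sense of HOL-Algebra (the ring fields
  \<^const>\<open>monoid.mult\<close> and \<^const>\<open>one\<close> of these records are irrelevant).  Composition and tensor
  product of morphisms carry no source and target arguments; they are only constrained on
  composable (resp. arbitrary) pairs of morphisms between objects.  Disjointness of distinct
  Hom-sets is not needed and not required.  Duals and direct sums are part of the data, so that
  all results are quantified over every choice of them.
\<close>

record ('k, 'o, 'm) rb_cat =
  obj :: "'o set"
  Hom :: "'o \<Rightarrow> 'o \<Rightarrow> ('k, 'm) module"
  ide :: "'o \<Rightarrow> 'm"
  cmp :: "'m \<Rightarrow> 'm \<Rightarrow> 'm" (infixr \<open>\<cdot>\<index>\<close> 65)
  otimes :: "'o \<Rightarrow> 'o \<Rightarrow> 'o" (infixr \<open>\<boxtimes>\<index>\<close> 75)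
  mtimes :: "'m \<Rightarrow> 'm \<Rightarrow> 'm" (infixr \<open>\<star>\<index>\<close> 75)
  unit_obj :: "'o"
  braid :: "'o \<Rightarrow> 'o \<Rightarrow> 'm"
  dual_obj :: "'o \<Rightarrow> 'o"
  ev :: "'o \<Rightarrow> 'm"
  coev :: "'o \<Rightarrow> 'm"
  zero_obj :: "'o"
  dsum :: "'o \<Rightarrow> 'o \<Rightarrow> 'o" (infixr \<open>\<boxplus>\<index>\<close> 70)
  inj1 :: "'o \<Rightarrow> 'o \<Rightarrow> 'm"
  inj2 :: "'o \<Rightarrow> 'o \<Rightarrow> 'm"
  prj1 :: "'o \<Rightarrow> 'o \<Rightarrow> 'm"
  prj2 :: "'o \<Rightarrow> 'o \<Rightarrow> 'm"

context
  fixes C :: "('k, 'o, 'm) rb_cat" (structure)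
begin

definition mor :: "'o \<Rightarrow> 'o \<Rightarrow> 'm set"
  where "mor M N = carrier (Hom C M N)"

definition iso_mor :: "'o \<Rightarrow> 'o \<Rightarrow> 'm \<Rightarrow> bool"
  where "iso_mor M N f \<longleftrightarrow>
    f \<in> mor M N \<and> (\<exists>g\<in>mor N M. g \<cdot> f = ide C M \<and> f \<cdot> g = ide C N)"

end

locale klinear_category = R?: cring k
  for k :: "('k, 'r) ring_scheme" +
  fixes C :: "('k, 'o, 'm) rb_cat" (structure)
  assumes Hom_module: "\<lbrakk>M \<in> obj C; N \<in> obj C\<rbrakk> \<Longrightarrow> module k (Hom C M N)"
    and ide_mor: "M \<in> obj C \<Longrightarrow> ide C M \<in> mor C M M"
    and cmp_mor: "\<lbrakk>L \<in> obj C; M \<in> obj C; N \<in> obj C; f \<in> mor C L M; g \<in> mor C M N\<rbrakk>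
      \<Longrightarrow> g \<cdot> f \<in> mor C L N"
    and cmp_assoc: "\<lbrakk>K \<in> obj C; L \<in> obj C; M \<in> obj C; N \<in> obj C;
        f \<in> mor C K L; g \<in> mor C L M; h \<in> mor C M N\<rbrakk> \<Longrightarrow> (h \<cdot> g) \<cdot> f = h \<cdot> (g \<cdot> f)"
    and cmp_ide_left: "\<lbrakk>M \<in> obj C; N \<in> obj C; f \<in> mor C M N\<rbrakk> \<Longrightarrow> ide C N \<cdot> f = f"
    and cmp_ide_right: "\<lbrakk>M \<in> obj C; N \<in> obj C; f \<in> mor C M N\<rbrakk> \<Longrightarrow> f \<cdot> ide C M = f"
    and cmp_add_left: "\<lbrakk>L \<in> obj C; M \<in> obj C; N \<in> obj C;
        f \<in> mor C L M; g \<in> mor C M N; g' \<in> mor C M N\<rbrakk>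
      \<Longrightarrow> (g \<oplus>\<^bsub>Hom C M N\<^esub> g') \<cdot> f = (g \<cdot> f) \<oplus>\<^bsub>Hom C L N\<^esub> (g' \<cdot> f)"
    and cmp_add_right: "\<lbrakk>L \<in> obj C; M \<in> obj C; N \<in> obj C;
        f \<in> mor C L M; f' \<in> mor C L M; g \<in> mor C M N\<rbrakk>
      \<Longrightarrow> g \<cdot> (f \<oplus>\<^bsub>Hom C L M\<^esub> f') = (g \<cdot> f) \<oplus>\<^bsub>Hom C L N\<^esub> (g \<cdot> f')"
    and cmp_smult_left: "\<lbrakk>L \<in> obj C; M \<in> obj C; N \<in> obj C; a \<in> carrier k;
        f \<in> mor C L M; g \<in> mor C M N\<rbrakk>
      \<Longrightarrow> (a \<odot>\<^bsub>Hom C M N\<^esub> g) \<cdot> f = a \<odot>\<^bsub>Hom C L N\<^esub> (g \<cdot> f)"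
    and cmp_smult_right: "\<lbrakk>L \<in> obj C; M \<in> obj C; N \<in> obj C; a \<in> carrier k;
        f \<in> mor C L M; g \<in> mor C M N\<rbrakk>
      \<Longrightarrow> g \<cdot> (a \<odot>\<^bsub>Hom C L M\<^esub> f) = a \<odot>\<^bsub>Hom C L N\<^esub> (g \<cdot> f)"

text \<open>
  Only the \<open>k\<close>-bilinearity of composition is assumed, not that of \<open>\<star>\<close> (whose
  biadditivity follows from rigidity, the braiding and the direct sums).
\<close>

locale klinear_monoidal_category = klinear_category k C
  for k :: "('k, 'r) ring_scheme" and C :: "('k, 'o, 'm) rb_cat" (structure) +
  assumes otimes_obj: "\<lbrakk>M \<in> obj C; N \<in> obj C\<rbrakk> \<Longrightarrow> M \<boxtimes> N \<in> obj C"
    and unit_obj: "unit_obj C \<in> obj C"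
    and mtimes_mor: "\<lbrakk>M \<in> obj C; N \<in> obj C; M' \<in> obj C; N' \<in> obj C;
        f \<in> mor C M N; f' \<in> mor C M' N'\<rbrakk> \<Longrightarrow> f \<star> f' \<in> mor C (M \<boxtimes> M') (N \<boxtimes> N')"
    and mtimes_ide: "\<lbrakk>M \<in> obj C; N \<in> obj C\<rbrakk> \<Longrightarrow> ide C M \<star> ide C N = ide C (M \<boxtimes> N)"
    and mtimes_cmp: "\<lbrakk>L \<in> obj C; M \<in> obj C; N \<in> obj C; L' \<in> obj C; M' \<in> obj C; N' \<in> obj C;
        f \<in> mor C L M; g \<in> mor C M N; f' \<in> mor C L' M'; g' \<in> mor C M' N'\<rbrakk>
      \<Longrightarrow> (g \<cdot> f) \<star> (g' \<cdot> f') = (g \<star> g') \<cdot> (f \<star> f')"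
    and otimes_assoc: "\<lbrakk>L \<in> obj C; M \<in> obj C; N \<in> obj C\<rbrakk>
      \<Longrightarrow> (L \<boxtimes> M) \<boxtimes> N = L \<boxtimes> (M \<boxtimes> N)"
    and otimes_unit_left: "M \<in> obj C \<Longrightarrow> unit_obj C \<boxtimes> M = M"
    and otimes_unit_right: "M \<in> obj C \<Longrightarrow> M \<boxtimes> unit_obj C = M"
    and mtimes_assoc: "\<lbrakk>L \<in> obj C; M \<in> obj C; N \<in> obj C; L' \<in> obj C; M' \<in> obj C; N' \<in> obj C;
        f \<in> mor C L L'; g \<in> mor C M M'; h \<in> mor C N N'\<rbrakk>
      \<Longrightarrow> (f \<star> g) \<star> h = f \<star> (g \<star> h)"
    and mtimes_unit_left: "\<lbrakk>M \<in> obj C; N \<in> obj C; f \<in> mor C M N\<rbrakk>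
      \<Longrightarrow> ide C (unit_obj C) \<star> f = f"
    and mtimes_unit_right: "\<lbrakk>M \<in> obj C; N \<in> obj C; f \<in> mor C M N\<rbrakk>
      \<Longrightarrow> f \<star> ide C (unit_obj C) = f"

locale klinear_braided_category = klinear_monoidal_category k C
  for k :: "('k, 'r) ring_scheme" and C :: "('k, 'o, 'm) rb_cat" (structure) +
  assumes braid_iso: "\<lbrakk>M \<in> obj C; N \<in> obj C\<rbrakk> \<Longrightarrow> iso_mor C (M \<boxtimes> N) (N \<boxtimes> M) (braid C M N)"
    and braid_natural: "\<lbrakk>M \<in> obj C; N \<in> obj C; M' \<in> obj C; N' \<in> obj C;
        f \<in> mor C M M'; g \<in> mor C N N'\<rbrakk>
      \<Longrightarrow> braid C M' N' \<cdot> (f \<star> g) = (g \<star> f) \<cdot> braid C M N"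
    and hexagon1: "\<lbrakk>L \<in> obj C; M \<in> obj C; N \<in> obj C\<rbrakk>
      \<Longrightarrow> braid C L (M \<boxtimes> N) = (ide C M \<star> braid C L N) \<cdot> (braid C L M \<star> ide C N)"
    and hexagon2: "\<lbrakk>L \<in> obj C; M \<in> obj C; N \<in> obj C\<rbrakk>
      \<Longrightarrow> braid C (L \<boxtimes> M) N = (braid C L N \<star> ide C M) \<cdot> (ide C L \<star> braid C M N)"

text \<open>
  Finite direct sums are biproducts; the condition on the zero object is the case of the empty
  family of the condition \<open>dsum_decomp\<close>.
\<close>

locale klinear_rigid_braided_category = klinear_braided_category k C
  for k :: "('k, 'r) ring_scheme" and C :: "('k, 'o, 'm) rb_cat" (structure) +
  assumes dual_obj: "M \<in> obj C \<Longrightarrow> dual_obj C M \<in> obj C"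
    and ev_mor: "M \<in> obj C \<Longrightarrow> ev C M \<in> mor C (dual_obj C M \<boxtimes> M) (unit_obj C)"
    and coev_mor: "M \<in> obj C \<Longrightarrow> coev C M \<in> mor C (unit_obj C) (M \<boxtimes> dual_obj C M)"
    and triangle1: "M \<in> obj C
      \<Longrightarrow> (ide C M \<star> ev C M) \<cdot> (coev C M \<star> ide C M) = ide C M"
    and triangle2: "M \<in> obj C
      \<Longrightarrow> (ev C M \<star> ide C (dual_obj C M)) \<cdot> (ide C (dual_obj C M) \<star> coev C M)
        = ide C (dual_obj C M)"
    and zero_obj: "zero_obj C \<in> obj C"
    and zero_obj_ide: "ide C (zero_obj C) = \<zero>\<^bsub>Hom C (zero_obj C) (zero_obj C)\<^esub>"
    and dsum_obj: "\<lbrakk>M \<in> obj C; N \<in> obj C\<rbrakk> \<Longrightarrow> M \<boxplus> N \<in> obj C"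
    and inj1_mor: "\<lbrakk>M \<in> obj C; N \<in> obj C\<rbrakk> \<Longrightarrow> inj1 C M N \<in> mor C M (M \<boxplus> N)"
    and inj2_mor: "\<lbrakk>M \<in> obj C; N \<in> obj C\<rbrakk> \<Longrightarrow> inj2 C M N \<in> mor C N (M \<boxplus> N)"
    and prj1_mor: "\<lbrakk>M \<in> obj C; N \<in> obj C\<rbrakk> \<Longrightarrow> prj1 C M N \<in> mor C (M \<boxplus> N) M"
    and prj2_mor: "\<lbrakk>M \<in> obj C; N \<in> obj C\<rbrakk> \<Longrightarrow> prj2 C M N \<in> mor C (M \<boxplus> N) N"
    and prj1_inj1: "\<lbrakk>M \<in> obj C; N \<in> obj C\<rbrakk> \<Longrightarrow> prj1 C M N \<cdot> inj1 C M N = ide C M"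
    and prj2_inj2: "\<lbrakk>M \<in> obj C; N \<in> obj C\<rbrakk> \<Longrightarrow> prj2 C M N \<cdot> inj2 C M N = ide C N"
    and prj1_inj2: "\<lbrakk>M \<in> obj C; N \<in> obj C\<rbrakk> \<Longrightarrow> prj1 C M N \<cdot> inj2 C M N = \<zero>\<^bsub>Hom C N M\<^esub>"
    and prj2_inj1: "\<lbrakk>M \<in> obj C; N \<in> obj C\<rbrakk> \<Longrightarrow> prj2 C M N \<cdot> inj1 C M N = \<zero>\<^bsub>Hom C M N\<^esub>"
    and dsum_decomp: "\<lbrakk>M \<in> obj C; N \<in> obj C\<rbrakk>
      \<Longrightarrow> (inj1 C M N \<cdot> prj1 C M N) \<oplus>\<^bsub>Hom C (M \<boxplus> N) (M \<boxplus> N)\<^esub> (inj2 C M N \<cdot> prj2 C M N)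
        = ide C (M \<boxplus> N)"

definition symmetric_braiding :: "('k, 'o, 'm) rb_cat \<Rightarrow> bool"
  where "symmetric_braiding C \<longleftrightarrow>
    (\<forall>M\<in>obj C. \<forall>N\<in>obj C. braid C N M \<cdot>\<^bsub>C\<^esub> braid C M N = ide C (M \<boxtimes>\<^bsub>C\<^esub> N))"


section \<open>Grothendieck groups\<close>

text \<open>
  \<open>quotient_monoid A r f e\<close> is the set of classes of \<open>A\<close> under an equivalence relation \<open>r\<close> on
  \<open>A\<close>, with the operation induced by \<open>f\<close> on representatives and the class of \<open>e\<close> as unit.
\<close>

definition quotient_monoid :: "'a set \<Rightarrow> ('a \<times> 'a) set \<Rightarrow> ('a \<Rightarrow> 'a \<Rightarrow> 'a) \<Rightarrow> 'a \<Rightarrow> 'a set monoid"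
  where "quotient_monoid A r f e =
    \<lparr>carrier = A // r, monoid.mult = (\<lambda>S T. \<Union>x\<in>S. \<Union>y\<in>T. r `` {f x y}), one = r `` {e}\<rparr>"

context
  fixes G :: "'a monoid" (structure)
begin

text \<open>A pair \<open>(a, b)\<close> represents the formal difference of \<open>a\<close> and \<open>b\<close>.\<close>

definition groth_rel :: "(('a \<times> 'a) \<times> ('a \<times> 'a)) set"
  where "groth_rel = {((a, b), (c, d)). a \<in> carrier G \<and> b \<in> carrier G \<and> c \<in> carrier G \<and> d \<in> carrier G
    \<and> (\<exists>e\<in>carrier G. a \<otimes> d \<otimes> e = c \<otimes> b \<otimes> e)}"

definition groth_group :: "('a \<times> 'a) set monoid"
  where "groth_group = quotient_monoid (carrier G \<times> carrier G) groth_rel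
    (\<lambda>(a, b) (c, d). (a \<otimes> c, b \<otimes> d)) (\<one>, \<one>)"

definition groth_class :: "'a \<Rightarrow> ('a \<times> 'a) set"
  where "groth_class a = groth_rel `` {(a, \<one>)}"

end

text \<open>The map on Grothendieck groups induced by a monoid homomorphism \<open>f\<close> into \<open>H\<close>.\<close>

definition groth_map :: "'b monoid \<Rightarrow> ('a \<Rightarrow> 'b) \<Rightarrow> ('a \<times> 'a) set \<Rightarrow> ('b \<times> 'b) set"
  where "groth_map H f S = (\<Union>(a, b)\<in>S. groth_rel H `` {(f a, f b)})"


section \<open>Quadratic objects and the Witt group\<close>

context
  fixes C :: "('k, 'o, 'm) rb_cat" (structure)
begin

definition bilinear_forms :: "'o \<Rightarrow> 'm set"
  where "bilinear_forms M = mor C (M \<boxtimes> M) (unit_obj C)"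

definition symmetric_form :: "'o \<Rightarrow> 'm \<Rightarrow> bool"
  where "symmetric_form M b \<longleftrightarrow> b \<cdot> braid C M M = b"

text \<open>By strictness the source of \<open>ide M \<star> coev M\<close> is \<open>M\<close> itself and the target of
  \<open>b \<star> ide M\<^sup>*\<close> is \<open>M\<^sup>*\<close>.\<close>

definition adjoint_map :: "'o \<Rightarrow> 'm \<Rightarrow> 'm"
  where "adjoint_map M b = (b \<star> ide C (dual_obj C M)) \<cdot> (ide C M \<star> coev C M)"

definition nonsingular_form :: "'o \<Rightarrow> 'm \<Rightarrow> bool"
  where "nonsingular_form M b \<longleftrightarrow> iso_mor C M (dual_obj C M) (adjoint_map M b)"

definition quad_obj :: "('o \<times> 'm) set"
  where "quad_obj = {(M, b). M \<in> obj C \<and> b \<in> bilinear_forms M \<and> symmetric_form M b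
    \<and> nonsingular_form M b}"

definition isometry :: "'o \<times> 'm \<Rightarrow> 'o \<times> 'm \<Rightarrow> 'm \<Rightarrow> bool"
  where "isometry = (\<lambda>(M, b) (M', b') f. iso_mor C M M' f \<and> b' \<cdot> (f \<star> f) = b)"

definition isometric :: "(('o \<times> 'm) \<times> ('o \<times> 'm)) set"
  where "isometric = {(x, y). x \<in> quad_obj \<and> y \<in> quad_obj \<and> (\<exists>f. isometry x y f)}"

definition sum_form :: "'o \<Rightarrow> 'm \<Rightarrow> 'o \<Rightarrow> 'm \<Rightarrow> 'm"
  where "sum_form M b M' b' =
    (b \<cdot> (prj1 C M M' \<star> prj1 C M M'))
    \<oplus>\<^bsub>Hom C ((M \<boxplus> M') \<boxtimes> (M \<boxplus> M')) (unit_obj C)\<^esub>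
    (b' \<cdot> (prj2 C M M' \<star> prj2 C M M'))"

definition orth_sum :: "'o \<times> 'm \<Rightarrow> 'o \<times> 'm \<Rightarrow> 'o \<times> 'm"
  where "orth_sum = (\<lambda>(M, b) (M', b'). (M \<boxplus> M', sum_form M b M' b'))"

definition zero_quad :: "'o \<times> 'm"
  where "zero_quad = (zero_obj C, \<zero>\<^bsub>Hom C (zero_obj C \<boxtimes> zero_obj C) (unit_obj C)\<^esub>)"

definition weakly_symmetric :: "'o set"
  where "weakly_symmetric = {M \<in> obj C.
    ev C M = ev C M \<cdot> braid C M (dual_obj C M) \<cdot> braid C (dual_obj C M) M}"

definition isomorphic_wsym :: "('o \<times> 'o) set"
  where "isomorphic_wsym = {(M, N). M \<in> weakly_symmetric \<and> N \<in> weakly_symmetric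
    \<and> (\<exists>f. iso_mor C M N f)}"

definition hyperbolic_form :: "'o \<Rightarrow> 'm"
  where "hyperbolic_form M =
    (let D = dual_obj C M in
      (ev C M \<cdot> (prj2 C M D \<star> prj1 C M D))
      \<oplus>\<^bsub>Hom C ((M \<boxplus> D) \<boxtimes> (M \<boxplus> D)) (unit_obj C)\<^esub>
      (ev C M \<cdot> braid C M D \<cdot> (prj1 C M D \<star> prj2 C M D)))"

definition hyperbolic :: "'o \<Rightarrow> 'o \<times> 'm"
  where "hyperbolic M = (M \<boxplus> dual_obj C M, hyperbolic_form M)"

definition quad_monoid :: "('o \<times> 'm) set monoid"
  where "quad_monoid = quotient_monoid quad_obj isometric orth_sum zero_quad"

definition wsym_monoid :: "'o set monoid"
  where "wsym_monoid = quotient_monoid weakly_symmetric isomorphic_wsym (\<boxplus>) (zero_obj C)"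

definition hyperbolic_class :: "'o set \<Rightarrow> ('o \<times> 'm) set"
  where "hyperbolic_class S = (\<Union>M\<in>S. isometric `` {hyperbolic M})"

definition hyperbolic_image :: "(('o \<times> 'm) set \<times> ('o \<times> 'm) set) set set"
  where "hyperbolic_image =
    groth_map quad_monoid hyperbolic_class ` carrier (groth_group wsym_monoid)"

text \<open>The Witt group, written multiplicatively as all groups in HOL-Algebra.\<close>

definition witt_group :: "(('o \<times> 'm) set \<times> ('o \<times> 'm) set) set set monoid"
  where "witt_group = groth_group quad_monoid Mod hyperbolic_image"

definition witt_class :: "'o \<times> 'm \<Rightarrow> (('o \<times> 'm) set \<times> ('o \<times> 'm) set) set set"
  where "witt_class x =
    hyperbolic_image #>\<^bsub>groth_group quad_monoid\<^esub> groth_class quad_monoid (isometric `` {x})"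

definition tensor_form :: "'o \<Rightarrow> 'm \<Rightarrow> 'o \<Rightarrow> 'm \<Rightarrow> 'm"
  where "tensor_form M b M' b' = (b \<star> b') \<cdot> (ide C M \<star> braid C M' M \<star> ide C M')"

definition quad_tensor :: "'o \<times> 'm \<Rightarrow> 'o \<times> 'm \<Rightarrow> 'o \<times> 'm"
  where "quad_tensor = (\<lambda>(M, b) (M', b'). (M \<boxtimes> M', tensor_form M b M' b'))"

text \<open>By strictness \<open>I \<boxtimes> I = I\<close>, and the canonical isomorphism between them is the identity.\<close>

definition quad_unit :: "'o \<times> 'm"
  where "quad_unit = (unit_obj C, ide C (unit_obj C))"

end

end

theory Submission
  imports Defs
begin

text \<open>
  A form is non-singular iff it is one half of a duality, that is, iff some copairing satisfies the
  triangle identities with it. In this shape non-singularity is visibly inherited by tensor products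
  (nest the copairings), by direct sums (add them) and by composition with the symmetry. The tensor
  product of morphisms is additive because each functor \<open>_ \<otimes> N\<close> has a right adjoint.

  If an object \<open>X\<close> is a direct sum of \<open>A\<close> and \<open>B\<close> and a symmetric form on it vanishes on
  \<open>A \<otimes> A\<close> and on \<open>B \<otimes> B\<close> and restricts to a duality on \<open>B \<otimes> A\<close>, then \<open>B\<close> is identified with
  \<open>A\<^sup>*\<close> and \<open>X\<close> with the hyperbolic object of \<open>A\<close>. This gives \<open>H(M) \<otimes> (K, d) \<cong> H(M \<otimes> K)\<close> and
  \<open>H(M) \<bottom> H(N) \<cong> H(M \<oplus> N)\<close>, so the isometry classes form a commutative semiring in which the
  hyperbolic classes are closed under addition and under multiplication by arbitrary classes; their
  differences form an ideal of the Grothendieck ring, and the Witt group is the quotient ring.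
\<close>

section \<open>Quotients of commutative semirings up to an equivalence relation\<close>

text \<open>Treating non-singularity through the chosen duals would require explicit, coherent
  comparisons of the dual of a tensor product or of a direct sum with the product or sum of the
  duals. Copairings avoid this. For forms, a chosen dual matters only in the original definition of
  non-singularity and inside the hyperbolic object, and there uniqueness of duals supplies the
  identification. Biadditivity of the tensor product cannot be bypassed: when a form on a direct sum
  is tested against a copairing, or multiplied by another form, the cross terms have to vanish and
  the remaining ones have to add up. That the hyperbolic classes absorb products also depends on the
  symmetry of the braiding in a second way: it makes every object weakly symmetric, so
  \<open>M \<boxtimes> K\<close> is again an admissible argument of the hyperbolic construction.
  Most semiring laws hold only up to isometry, and formal differences are again classes of pairs.
  One quotient construction, with laws stated modulo an equivalence, serves both levels.\<close>

lemma quotient_monoid_mult: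
  assumes r: "equiv A r" and f: "\<And>a a' b b'. \<lbrakk>(a, a') \<in> r; (b, b') \<in> r\<rbrakk> \<Longrightarrow> (f a b, f a' b') \<in> r"
    and "a \<in> A" "b \<in> A"
  shows "monoid.mult (quotient_monoid A r f e) (r `` {a}) (r `` {b}) = r `` {f a b}"
proof -
  have "congruent2 r r (\<lambda>x y. r `` {f x y})"
    by (rule congruent2I') (rule equiv_class_eq[OF r], rule f)
  from UN_equiv_class2[OF r r this] assms(3,4) show ?thesis
    by (simp add: quotient_monoid_def)
qed

text \<open>The laws are stated modulo \<open>r\<close> because sums and products of quadratic
  objects obey most of them only up to isometry. Commutativity supplies the mirror images of the
  one-sided laws. The two instances are pairs under the relation of formal differences, and
  quadratic objects under isometry.\<close>

locale semiring_congruence =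
  fixes A :: "'a set" and r :: "('a \<times> 'a) set"
    and pl :: "'a \<Rightarrow> 'a \<Rightarrow> 'a" and ze :: 'a and ti :: "'a \<Rightarrow> 'a \<Rightarrow> 'a" and un :: 'a
  assumes equiv: "equiv A r"
    and pl_closed: "\<lbrakk>a \<in> A; b \<in> A\<rbrakk> \<Longrightarrow> pl a b \<in> A"
    and ti_closed: "\<lbrakk>a \<in> A; b \<in> A\<rbrakk> \<Longrightarrow> ti a b \<in> A"
    and ze_closed: "ze \<in> A"
    and un_closed: "un \<in> A"
    and pl_cong: "\<lbrakk>(a, a') \<in> r; (b, b') \<in> r\<rbrakk> \<Longrightarrow> (pl a b, pl a' b') \<in> r"
    and ti_cong: "\<lbrakk>(a, a') \<in> r; (b, b') \<in> r\<rbrakk> \<Longrightarrow> (ti a b, ti a' b') \<in> r"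
    and pl_assoc: "\<lbrakk>a \<in> A; b \<in> A; c \<in> A\<rbrakk> \<Longrightarrow> (pl (pl a b) c, pl a (pl b c)) \<in> r"
    and pl_comm: "\<lbrakk>a \<in> A; b \<in> A\<rbrakk> \<Longrightarrow> (pl a b, pl b a) \<in> r"
    and pl_ze: "a \<in> A \<Longrightarrow> (pl ze a, a) \<in> r"
    and ti_assoc: "\<lbrakk>a \<in> A; b \<in> A; c \<in> A\<rbrakk> \<Longrightarrow> (ti (ti a b) c, ti a (ti b c)) \<in> r"
    and ti_comm: "\<lbrakk>a \<in> A; b \<in> A\<rbrakk> \<Longrightarrow> (ti a b, ti b a) \<in> r"
    and ti_un: "a \<in> A \<Longrightarrow> (ti un a, a) \<in> r"
    and ti_ze: "a \<in> A \<Longrightarrow> (ti ze a, ze) \<in> r"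
    and ti_pl: "\<lbrakk>a \<in> A; b \<in> A; c \<in> A\<rbrakk> \<Longrightarrow> (ti (pl a b) c, pl (ti a c) (ti b c)) \<in> r"
begin

text \<open>The sum is the operation of \<open>quotient_monoid\<close> itself, so the additive
  reduct is by unfolding the monoid, respectively the Grothendieck group, from which the Witt group
  is formed.\<close>

definition quotient_ring :: "'a set ring"
  where "quotient_ring = \<lparr>carrier = A // r, monoid.mult = monoid.mult (quotient_monoid A r ti un),
    one = r `` {un}, zero = r `` {ze}, add = monoid.mult (quotient_monoid A r pl ze)\<rparr>"

lemma class_eqI: "(a, b) \<in> r \<Longrightarrow> r `` {a} = r `` {b}"
  using equiv by (rule equiv_class_eq)

lemma carrier_quotient_ring: "carrier quotient_ring = A // r"
  and zero_quotient_ring: "zero quotient_ring = r `` {ze}"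
  and one_quotient_ring: "one quotient_ring = r `` {un}"
  by (simp_all add: quotient_ring_def)

lemma add_class:
  "\<lbrakk>a \<in> A; b \<in> A\<rbrakk> \<Longrightarrow> r `` {a} \<oplus>\<^bsub>quotient_ring\<^esub> r `` {b} = r `` {pl a b}"
  by (simp add: quotient_ring_def quotient_monoid_mult[OF equiv] pl_cong)

lemma mult_class:
  "\<lbrakk>a \<in> A; b \<in> A\<rbrakk> \<Longrightarrow> r `` {a} \<otimes>\<^bsub>quotient_ring\<^esub> r `` {b} = r `` {ti a b}"
  by (simp add: quotient_ring_def quotient_monoid_mult[OF equiv] ti_cong)

lemma class_closed: "a \<in> A \<Longrightarrow> r `` {a} \<in> A // r"
  by (rule quotientI)

lemma classE:
  assumes "S \<in> A // r"
  obtains a where "a \<in> A" "S = r `` {a}"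
  using assms by (rule quotientE)

lemma quotient_abelian_monoid: "abelian_monoid quotient_ring"
proof (rule abelian_monoidI, unfold carrier_quotient_ring zero_quotient_ring)
  show "r `` {ze} \<in> A // r"
    by (simp add: class_closed ze_closed)
next
  fix x y assume "x \<in> A // r" "y \<in> A // r"
  then show "x \<oplus>\<^bsub>quotient_ring\<^esub> y \<in> A // r"
    by (elim classE) (simp add: add_class class_closed pl_closed)
next
  fix x y z assume "x \<in> A // r" "y \<in> A // r" "z \<in> A // r"
  then show "x \<oplus>\<^bsub>quotient_ring\<^esub> y \<oplus>\<^bsub>quotient_ring\<^esub> z = x \<oplus>\<^bsub>quotient_ring\<^esub> (y \<oplus>\<^bsub>quotient_ring\<^esub> z)"
    by (elim classE) (simp add: add_class pl_closed class_eqI pl_assoc)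
next
  fix x assume "x \<in> A // r"
  then show "r `` {ze} \<oplus>\<^bsub>quotient_ring\<^esub> x = x"
    by (elim classE) (simp add: add_class ze_closed class_eqI pl_ze)
next
  fix x y assume "x \<in> A // r" "y \<in> A // r"
  then show "x \<oplus>\<^bsub>quotient_ring\<^esub> y = y \<oplus>\<^bsub>quotient_ring\<^esub> x"
    by (elim classE) (simp add: add_class class_eqI pl_comm)
qed

lemma quotient_comm_monoid: "comm_monoid quotient_ring"
proof (rule comm_monoidI, unfold carrier_quotient_ring one_quotient_ring)
  show "r `` {un} \<in> A // r"
    by (simp add: class_closed un_closed)
next
  fix x y assume "x \<in> A // r" "y \<in> A // r"
  then show "x \<otimes>\<^bsub>quotient_ring\<^esub> y \<in> A // r"
    by (elim classE) (simp add: mult_class class_closed ti_closed)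
next
  fix x y z assume "x \<in> A // r" "y \<in> A // r" "z \<in> A // r"
  then show "x \<otimes>\<^bsub>quotient_ring\<^esub> y \<otimes>\<^bsub>quotient_ring\<^esub> z = x \<otimes>\<^bsub>quotient_ring\<^esub> (y \<otimes>\<^bsub>quotient_ring\<^esub> z)"
    by (elim classE) (simp add: mult_class ti_closed class_eqI ti_assoc)
next
  fix x assume "x \<in> A // r"
  then show "r `` {un} \<otimes>\<^bsub>quotient_ring\<^esub> x = x"
    by (elim classE) (simp add: mult_class un_closed class_eqI ti_un)
next
  fix x y assume "x \<in> A // r" "y \<in> A // r"
  then show "x \<otimes>\<^bsub>quotient_ring\<^esub> y = y \<otimes>\<^bsub>quotient_ring\<^esub> x"
    by (elim classE) (simp add: mult_class class_eqI ti_comm)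
qed

lemma quotient_l_distr:
  assumes "x \<in> carrier quotient_ring" "y \<in> carrier quotient_ring" "z \<in> carrier quotient_ring"
  shows "(x \<oplus>\<^bsub>quotient_ring\<^esub> y) \<otimes>\<^bsub>quotient_ring\<^esub> z
    = x \<otimes>\<^bsub>quotient_ring\<^esub> z \<oplus>\<^bsub>quotient_ring\<^esub> y \<otimes>\<^bsub>quotient_ring\<^esub> z"
  using assms unfolding carrier_quotient_ring
  by (elim classE) (simp add: add_class mult_class pl_closed ti_closed class_eqI ti_pl)

lemma quotient_semiring: "semiring quotient_ring"
proof -
  interpret abelian_monoid quotient_ring by (rule quotient_abelian_monoid)
  interpret comm_monoid quotient_ring by (rule quotient_comm_monoid)
  have null: "\<zero>\<^bsub>quotient_ring\<^esub> \<otimes>\<^bsub>quotient_ring\<^esub> x = \<zero>\<^bsub>quotient_ring\<^esub>"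
    if "x \<in> carrier quotient_ring" for x
    using that unfolding carrier_quotient_ring zero_quotient_ring
    by (elim classE) (simp add: mult_class ze_closed class_eqI ti_ze)
  have r_distr: "z \<otimes>\<^bsub>quotient_ring\<^esub> (x \<oplus>\<^bsub>quotient_ring\<^esub> y)
      = z \<otimes>\<^bsub>quotient_ring\<^esub> x \<oplus>\<^bsub>quotient_ring\<^esub> z \<otimes>\<^bsub>quotient_ring\<^esub> y"
    if "x \<in> carrier quotient_ring" "y \<in> carrier quotient_ring" "z \<in> carrier quotient_ring" for x y z
    using quotient_l_distr[OF that] that by (simp add: m_comm)
  have "x \<otimes>\<^bsub>quotient_ring\<^esub> \<zero>\<^bsub>quotient_ring\<^esub> = \<zero>\<^bsub>quotient_ring\<^esub>"
    if "x \<in> carrier quotient_ring" for x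
    using null[OF that] that by (simp add: m_comm)
  then show ?thesis
    by unfold_locales (simp_all only: quotient_l_distr r_distr null)
qed

lemma quotient_cring:
  assumes "\<And>a. a \<in> A \<Longrightarrow> \<exists>b\<in>A. (pl b a, ze) \<in> r"
  shows "cring quotient_ring"
proof (rule cringI)
  show "abelian_group quotient_ring"
  proof (rule abelian_groupI)
    fix x assume "x \<in> carrier quotient_ring"
    then obtain a where a: "a \<in> A" "x = r `` {a}"
      unfolding carrier_quotient_ring by (rule classE)
    obtain b where "b \<in> A" "(pl b a, ze) \<in> r" using assms[OF a(1)] by blast
    then show "\<exists>y\<in>carrier quotient_ring. y \<oplus>\<^bsub>quotient_ring\<^esub> x = \<zero>\<^bsub>quotient_ring\<^esub>"
      using a by (intro bexI[of _ "r `` {b}"])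
        (simp_all add: add_class carrier_quotient_ring zero_quotient_ring class_closed class_eqI)
  qed (use abelian_monoidE[OF quotient_abelian_monoid] in auto)
qed (rule quotient_comm_monoid, rule quotient_l_distr)

end

section \<open>The Grothendieck ring of a commutative semiring\<close>

locale comm_semiring = semiring R + comm_monoid R for R :: "'a ring" (structure)
begin

abbreviation additive :: "'a monoid"
  where "additive \<equiv> \<lparr>carrier = carrier R, monoid.mult = (\<oplus>), one = \<zero>\<rparr>"

abbreviation diff_rel :: "(('a \<times> 'a) \<times> ('a \<times> 'a)) set"
  where "diff_rel \<equiv> groth_rel additive"

text \<open>Product of formal differences: (a - b)(c - d) = (ac + bd) - (ad + bc).\<close>

abbreviation diff_mult :: "'a \<times> 'a \<Rightarrow> 'a \<times> 'a \<Rightarrow> 'a \<times> 'a"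
  where "diff_mult \<equiv> \<lambda>(a, b) (c, d). (a \<otimes> c \<oplus> b \<otimes> d, a \<otimes> d \<oplus> b \<otimes> c)"

lemma diff_rel_iff: "((a, b), (c, d)) \<in> diff_rel \<longleftrightarrow>
    a \<in> carrier R \<and> b \<in> carrier R \<and> c \<in> carrier R \<and> d \<in> carrier R
    \<and> (\<exists>e\<in>carrier R. a \<oplus> d \<oplus> e = c \<oplus> b \<oplus> e)"
  by (simp add: groth_rel_def)

lemma diff_rel_trans:
  assumes "((a, b), (c, d)) \<in> diff_rel" "((c, d), (u, v)) \<in> diff_rel"
  shows "((a, b), (u, v)) \<in> diff_rel"
proof -
  from assms obtain e e' where
    c: "a \<in> carrier R" "b \<in> carrier R" "c \<in> carrier R" "d \<in> carrier R" "u \<in> carrier R" "v \<in> carrier R"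
      "e \<in> carrier R" "e' \<in> carrier R"
    and eq: "a \<oplus> d \<oplus> e = c \<oplus> b \<oplus> e" "c \<oplus> v \<oplus> e' = u \<oplus> d \<oplus> e'"
    by (auto simp: diff_rel_iff)
  have "a \<oplus> v \<oplus> (c \<oplus> d \<oplus> e \<oplus> e') = (a \<oplus> d \<oplus> e) \<oplus> (c \<oplus> v \<oplus> e')"
    using c by (simp add: a_ac)
  also have "\<dots> = u \<oplus> b \<oplus> (c \<oplus> d \<oplus> e \<oplus> e')"
    unfolding eq using c by (simp add: a_ac)
  finally show ?thesis
    using c by (auto simp: diff_rel_iff)
qed

lemma diff_rel_equiv: "equiv (carrier R \<times> carrier R) diff_rel"
proof (rule equivI)
  show "diff_rel \<subseteq> (carrier R \<times> carrier R) \<times> carrier R \<times> carrier R"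
    by (auto simp: diff_rel_iff)
  show "refl_on (carrier R \<times> carrier R) diff_rel"
    by (rule refl_onI) (auto simp: diff_rel_iff)
  show "sym diff_rel"
  proof (rule symI)
    fix x y assume "(x, y) \<in> diff_rel"
    then show "(y, x) \<in> diff_rel"
      by (cases x; cases y) (auto simp: diff_rel_iff intro: sym)
  qed
  show "trans diff_rel"
  proof (rule transI)
    fix x y z assume "(x, y) \<in> diff_rel" "(y, z) \<in> diff_rel"
    then show "(x, z) \<in> diff_rel"
      by (cases x; cases y; cases z) (simp add: diff_rel_trans)
  qed
qed

lemma diff_mult_cong_left:
  assumes "((a, b), (a', b')) \<in> diff_rel" "c \<in> carrier R" "d \<in> carrier R"
  shows "(diff_mult (a, b) (c, d), diff_mult (a', b') (c, d)) \<in> diff_rel"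
proof -
  from assms obtain e where
    c: "a \<in> carrier R" "b \<in> carrier R" "a' \<in> carrier R" "b' \<in> carrier R" "c \<in> carrier R" "d \<in> carrier R"
      "e \<in> carrier R"
    and eq: "a \<oplus> b' \<oplus> e = a' \<oplus> b \<oplus> e"
    by (auto simp: diff_rel_iff)
  \<comment> \<open>The equation is multiplied by \<open>c\<close> and, read backwards, by
    \<open>d\<close>. The two products of \<open>e\<close> that appear form the stabilising
    summand.\<close>
  have "a \<otimes> c \<oplus> b \<otimes> d \<oplus> (a' \<otimes> d \<oplus> b' \<otimes> c) \<oplus> (e \<otimes> c \<oplus> e \<otimes> d)
      = (a \<oplus> b' \<oplus> e) \<otimes> c \<oplus> (a' \<oplus> b \<oplus> e) \<otimes> d"
    using c by (simp add: l_distr a_ac)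
  also have "\<dots> = (a' \<oplus> b \<oplus> e) \<otimes> c \<oplus> (a \<oplus> b' \<oplus> e) \<otimes> d"
    by (simp only: eq)
  also have "\<dots> = a' \<otimes> c \<oplus> b' \<otimes> d \<oplus> (a \<otimes> d \<oplus> b \<otimes> c) \<oplus> (e \<otimes> c \<oplus> e \<otimes> d)"
    using c by (simp add: l_distr a_ac)
  finally show ?thesis
    using c by (auto simp: diff_rel_iff)
qed

lemma diff_mult_comm:
  "\<lbrakk>x \<in> carrier R \<times> carrier R; y \<in> carrier R \<times> carrier R\<rbrakk> \<Longrightarrow> diff_mult x y = diff_mult y x"
  by (auto simp: m_comm a_comm)

text \<open>One factor is changed at a time; commutativity turns a change of the right factor into a
  change of the left one.\<close>

lemma diff_mult_cong:
  assumes "(x, x') \<in> diff_rel" "(y, y') \<in> diff_rel"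
  shows "(diff_mult x y, diff_mult x' y') \<in> diff_rel"
proof -
  have c: "x \<in> carrier R \<times> carrier R" "x' \<in> carrier R \<times> carrier R"
      "y \<in> carrier R \<times> carrier R" "y' \<in> carrier R \<times> carrier R"
    using assms equiv_type[OF diff_rel_equiv] by auto
  have left: "(diff_mult u w, diff_mult v w) \<in> diff_rel"
    if "(u, v) \<in> diff_rel" "w \<in> carrier R \<times> carrier R" for u v w
    using that by (cases u; cases v; cases w) (use diff_mult_cong_left in auto)
  have "(diff_mult x y, diff_mult x' y) \<in> diff_rel"
    using assms(1) c(3) by (rule left)
  moreover have "(diff_mult x' y, diff_mult x' y') \<in> diff_rel"
    using left[OF assms(2) c(2)] c by (simp only: diff_mult_comm)
  ultimately show ?thesis
    using diff_rel_equiv by (meson equivE transE)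
qed

lemma diff_add_cong:
  assumes "(x, x') \<in> diff_rel" "(y, y') \<in> diff_rel"
  shows "((\<lambda>(a, b) (c, d). (a \<oplus> c, b \<oplus> d)) x y, (\<lambda>(a, b) (c, d). (a \<oplus> c, b \<oplus> d)) x' y') \<in> diff_rel"
proof -
  obtain a b a' b' c d c' d' where
    xy: "x = (a, b)" "x' = (a', b')" "y = (c, d)" "y' = (c', d')"
    by (metis surj_pair)
  with assms obtain e e' where
    c: "a \<in> carrier R" "b \<in> carrier R" "a' \<in> carrier R" "b' \<in> carrier R"
      "c \<in> carrier R" "d \<in> carrier R" "c' \<in> carrier R" "d' \<in> carrier R"
      "e \<in> carrier R" "e' \<in> carrier R"
    and eq: "a \<oplus> b' \<oplus> e = a' \<oplus> b \<oplus> e" "c \<oplus> d' \<oplus> e' = c' \<oplus> d \<oplus> e'"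
    by (auto simp: diff_rel_iff)
  have "a \<oplus> c \<oplus> (b' \<oplus> d') \<oplus> (e \<oplus> e') = (a \<oplus> b' \<oplus> e) \<oplus> (c \<oplus> d' \<oplus> e')"
    using c by (simp add: a_ac)
  also have "\<dots> = a' \<oplus> c' \<oplus> (b \<oplus> d) \<oplus> (e \<oplus> e')"
    unfolding eq using c by (simp add: a_ac)
  finally show ?thesis
    using c xy by (auto simp: diff_rel_iff)
qed

text \<open>Apart from the congruence properties, every law holds as an equality of pairs, so
  reflexivity of the relation is enough.\<close>

sublocale Groth: semiring_congruence "carrier R \<times> carrier R" diff_rel
  "\<lambda>(a, b) (c, d). (a \<oplus> c, b \<oplus> d)" "(\<zero>, \<zero>)" diff_mult "(\<one>, \<zero>)"
proof -
  have refl: "(x, y) \<in> diff_rel" if "x = y" "x \<in> carrier R \<times> carrier R" for x y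
    using that by (auto simp: diff_rel_iff)
  show "semiring_congruence (carrier R \<times> carrier R) diff_rel
    (\<lambda>(a, b) (c, d). (a \<oplus> c, b \<oplus> d)) (\<zero>, \<zero>) diff_mult (\<one>, \<zero>)"
    by (rule semiring_congruence.intro, rule diff_rel_equiv,
        (rule diff_add_cong diff_mult_cong; assumption
          | (auto intro!: refl simp: l_distr r_distr m_ac a_ac)[1])+)
qed

lemma additive_Groth:
  "\<lparr>carrier = carrier Groth.quotient_ring, monoid.mult = add Groth.quotient_ring,
    one = zero Groth.quotient_ring\<rparr> = groth_group additive"
  by (simp add: Groth.quotient_ring_def groth_group_def quotient_monoid_def)

lemma Groth_cring: "cring Groth.quotient_ring"
proof (rule Groth.quotient_cring)
  fix x assume "x \<in> carrier R \<times> carrier R"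
  then show "\<exists>y\<in>carrier R \<times> carrier R.
      ((\<lambda>(a, b) (c, d). (a \<oplus> c, b \<oplus> d)) y x, (\<zero>, \<zero>)) \<in> diff_rel"
    by (intro bexI[of _ "(snd x, fst x)"]) (auto simp: diff_rel_iff a_comm)
qed

text \<open>In (c - d)(p - q) = (cp + dq) - (cq + dp) both terms lie in \<open>H\<close> as soon as
  \<open>p\<close> and \<open>q\<close> do. Negation merely exchanges the two entries of a
  pair.\<close>

lemma diff_ideal:
  assumes H: "H \<subseteq> carrier R" "H \<noteq> {}"
    and add: "\<And>a b. \<lbrakk>a \<in> H; b \<in> H\<rbrakk> \<Longrightarrow> a \<oplus> b \<in> H"
    and mult: "\<And>x a. \<lbrakk>x \<in> carrier R; a \<in> H\<rbrakk> \<Longrightarrow> x \<otimes> a \<in> H"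
  shows "ideal ((\<lambda>p. diff_rel `` {p}) ` (H \<times> H)) Groth.quotient_ring" (is "ideal ?J ?G")
proof -
  interpret G: cring ?G by (rule Groth_cring)
  have sub: "?J \<subseteq> carrier ?G"
    using H by (auto simp: Groth.carrier_quotient_ring intro!: quotientI)
  have H': "a \<in> carrier R" if "a \<in> H" for a using H that by auto
  obtain h where h: "h \<in> H" using H by auto
  have left: "x \<otimes>\<^bsub>?G\<^esub> a \<in> ?J" if a: "a \<in> ?J" and x: "x \<in> carrier ?G" for a x
  proof -
    obtain p q where p: "p \<in> H" "q \<in> H" "a = diff_rel `` {(p, q)}" using a by auto
    obtain c d where c: "c \<in> carrier R" "d \<in> carrier R" "x = diff_rel `` {(c, d)}"
      using x unfolding Groth.carrier_quotient_ring by (elim Groth.classE) auto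
    show ?thesis
      unfolding p c by (subst Groth.mult_class) (use p c in \<open>auto simp: H' add mult\<close>)
  qed
  show ?thesis
  proof (rule idealI[OF G.ring_axioms])
    show "subgroup ?J (add_monoid ?G)"
    proof (rule G.add.subgroupI, goal_cases)
      case 1
      show ?case using sub .
    next
      case 2
      show ?case using h by auto
    next
      case (3 x)
      then obtain p q where p: "p \<in> H" "q \<in> H" "x = diff_rel `` {(p, q)}" by auto
      have "diff_rel `` {(q, p)} \<oplus>\<^bsub>?G\<^esub> x = \<zero>\<^bsub>?G\<^esub>"
        unfolding p Groth.zero_quotient_ring
        by (subst Groth.add_class) (use p in \<open>auto simp: H' diff_rel_iff a_comm intro!: Groth.class_eqI exI[of _ \<zero>]\<close>)
      moreover have "diff_rel `` {(q, p)} \<in> ?J" using p by auto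
      ultimately have "diff_rel `` {(q, p)} = \<ominus>\<^bsub>?G\<^esub> x"
        using sub 3 by (intro G.minus_equality[symmetric]) auto
      with \<open>diff_rel `` {(q, p)} \<in> ?J\<close> show ?case by (simp add: a_inv_def)
    next
      case (4 x y)
      then obtain p q p' q' where p: "p \<in> H" "q \<in> H" "x = diff_rel `` {(p, q)}"
        "p' \<in> H" "q' \<in> H" "y = diff_rel `` {(p', q')}" by auto
      have "x \<oplus>\<^bsub>?G\<^esub> y = diff_rel `` {(p \<oplus> p', q \<oplus> q')}"
        unfolding p by (subst Groth.add_class) (simp_all add: p H')
      moreover have "(p \<oplus> p', q \<oplus> q') \<in> H \<times> H"
        by (simp add: p add)
      ultimately show ?case
        by simp
    qed
  next
    fix a x assume "a \<in> ?J" "x \<in> carrier ?G"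
    then show "x \<otimes>\<^bsub>?G\<^esub> a \<in> ?J"
      by (rule left)
    then show "a \<otimes>\<^bsub>?G\<^esub> x \<in> ?J"
      using G.m_comm[of a x] \<open>a \<in> ?J\<close> \<open>x \<in> carrier ?G\<close> sub by (simp only: subsetD)
  qed
qed

text \<open>\<open>groth_map\<close> takes a union over all representatives. These all contribute
  the same class, because additivity carries a stabilising element \<open>e\<close> to
  \<open>h e\<close>.\<close>

lemma groth_map_class:
  assumes W: "\<And>a b. \<lbrakk>a \<in> carrier W; b \<in> carrier W\<rbrakk> \<Longrightarrow> a \<otimes>\<^bsub>W\<^esub> b \<in> carrier W"
    and h: "\<And>a. a \<in> carrier W \<Longrightarrow> h a \<in> carrier R"
    and hom: "\<And>a b. \<lbrakk>a \<in> carrier W; b \<in> carrier W\<rbrakk> \<Longrightarrow> h (a \<otimes>\<^bsub>W\<^esub> b) = h a \<oplus> h b"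
    and ab: "a \<in> carrier W" "b \<in> carrier W"
  shows "groth_map additive h (groth_rel W `` {(a, b)}) = diff_rel `` {(h a, h b)}"
proof -
  have "((h a, h b), (h c, h d)) \<in> diff_rel" if "((a, b), (c, d)) \<in> groth_rel W" for c d
  proof -
    from that obtain e where c: "c \<in> carrier W" "d \<in> carrier W" "e \<in> carrier W"
      and eq: "a \<otimes>\<^bsub>W\<^esub> d \<otimes>\<^bsub>W\<^esub> e = c \<otimes>\<^bsub>W\<^esub> b \<otimes>\<^bsub>W\<^esub> e"
      by (auto simp: groth_rel_def)
    have "h a \<oplus> h d \<oplus> h e = h c \<oplus> h b \<oplus> h e"
      using arg_cong[OF eq, of h] c ab by (simp add: hom W)
    with c ab show ?thesis
      by (auto simp: diff_rel_iff h)
  qed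
  then have "diff_rel `` {(h c, h d)} = diff_rel `` {(h a, h b)}" if "((a, b), (c, d)) \<in> groth_rel W" for c d
    using that Groth.class_eqI by metis
  moreover have "((a, b), (a, b)) \<in> groth_rel W"
    using ab by (auto simp: groth_rel_def)
  ultimately show ?thesis
    unfolding groth_map_def by blast
qed

text \<open>Brings the image of an induced homomorphism into the shape of the set in
  \<open>diff_ideal\<close>.\<close>

lemma groth_map_image:
  assumes "\<And>a b. \<lbrakk>a \<in> carrier W; b \<in> carrier W\<rbrakk> \<Longrightarrow> a \<otimes>\<^bsub>W\<^esub> b \<in> carrier W"
    and "\<And>a. a \<in> carrier W \<Longrightarrow> h a \<in> carrier R"
    and "\<And>a b. \<lbrakk>a \<in> carrier W; b \<in> carrier W\<rbrakk> \<Longrightarrow> h (a \<otimes>\<^bsub>W\<^esub> b) = h a \<oplus> h b"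
  shows "groth_map additive h ` carrier (groth_group W)
    = (\<lambda>p. diff_rel `` {p}) ` (h ` carrier W \<times> h ` carrier W)"
proof -
  have "carrier (groth_group W) = (\<lambda>p. groth_rel W `` {p}) ` (carrier W \<times> carrier W)"
    by (auto simp: groth_group_def quotient_monoid_def quotient_def)
  then have "groth_map additive h ` carrier (groth_group W)
      = (\<lambda>(a, b). groth_map additive h (groth_rel W `` {(a, b)})) ` (carrier W \<times> carrier W)"
    by (auto simp: image_image split_beta)
  also have "\<dots> = (\<lambda>(a, b). diff_rel `` {(h a, h b)}) ` (carrier W \<times> carrier W)"
    using groth_map_class[OF assms] by (intro image_cong) auto
  finally show ?thesis
    by auto
qed

lemma groth_class_closed:
  "a \<in> carrier R \<Longrightarrow> groth_class additive a \<in> carrier Groth.quotient_ring"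
  by (simp add: groth_class_def Groth.carrier_quotient_ring quotientI)

lemma groth_class_mult:
  assumes "a \<in> carrier R" "b \<in> carrier R"
  shows "groth_class additive a \<otimes>\<^bsub>Groth.quotient_ring\<^esub> groth_class additive b
    = groth_class additive (a \<otimes> b)"
  using assms by (simp add: groth_class_def Groth.mult_class)

text \<open>Additive cosets in the ring and right cosets in its additive group unfold to the same
  sets. The factor ring therefore has the factor group itself, not just an isomorphic copy, as its
  additive part.\<close>

lemma Groth_Quot:
  "Groth.quotient_ring Quot J =
    \<lparr>carrier = carrier (groth_group additive Mod J),
     monoid.mult = rcoset_mult Groth.quotient_ring J,
     one = J #>\<^bsub>groth_group additive\<^esub> groth_class additive \<one>,
     zero = \<one>\<^bsub>groth_group additive Mod J\<^esub>,
     add = monoid.mult (groth_group additive Mod J)\<rparr>"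
  by (simp add: FactRing_def FactGroup_def A_RCOSETS_def set_add_def a_r_coset_def
      additive_Groth groth_class_def Groth.one_quotient_ring)

end

section \<open>Arrows with source and target\<close>

text \<open>A morphism together with its source and target; \<open>None\<close> marks an ill-typed composite, so that
  source and target are total functions of the expression and associativity of composition needs
  no side conditions.\<close>

type_synonym ('o, 'm) arrow = "'o \<times> 'm option \<times> 'o"

abbreviation dom :: "('o, 'm) arrow \<Rightarrow> 'o" where "dom F \<equiv> fst F"
abbreviation cod :: "('o, 'm) arrow \<Rightarrow> 'o" where "cod F \<equiv> snd (snd F)"
abbreviation und :: "('o, 'm) arrow \<Rightarrow> 'm" where "und F \<equiv> the (fst (snd F))"

context klinear_rigid_braided_category
begin

definition arr :: "('o, 'm) arrow \<Rightarrow> bool"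
  where "arr F \<longleftrightarrow> dom F \<in> obj C \<and> cod F \<in> obj C \<and> fst (snd F) \<noteq> None \<and> und F \<in> mor C (dom F) (cod F)"

definition arw :: "'o \<Rightarrow> 'o \<Rightarrow> 'm \<Rightarrow> ('o, 'm) arrow"
  where "arw A B f = (A, Some f, B)"

definition comp :: "('o, 'm) arrow \<Rightarrow> ('o, 'm) arrow \<Rightarrow> ('o, 'm) arrow" (infixr \<open>\<bullet>\<close> 65)
  where "G \<bullet> F = (dom F, if arr F \<and> arr G \<and> dom G = cod F then Some (und G \<cdot> und F) else None, cod G)"

definition tens :: "('o, 'm) arrow \<Rightarrow> ('o, 'm) arrow \<Rightarrow> ('o, 'm) arrow" (infixr \<open>\<parallel>\<close> 75)
  where "F \<parallel> G = (dom F \<boxtimes> dom G, if arr F \<and> arr G then Some (und F \<star> und G) else None, cod F \<boxtimes> cod G)"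

definition plus :: "('o, 'm) arrow \<Rightarrow> ('o, 'm) arrow \<Rightarrow> ('o, 'm) arrow" (infixl \<open>\<uplus>\<close> 60)
  where "F \<uplus> G = (dom F,
    if arr F \<and> arr G \<and> dom F = dom G \<and> cod F = cod G then Some (und F \<oplus>\<^bsub>Hom C (dom F) (cod F)\<^esub> und G)
    else None, cod F)"

definition zr :: "'o \<Rightarrow> 'o \<Rightarrow> ('o, 'm) arrow"
  where "zr A B = arw A B \<zero>\<^bsub>Hom C A B\<^esub>"

definition idn :: "'o \<Rightarrow> ('o, 'm) arrow"
  where "idn A = arw A A (ide C A)"

definition br :: "'o \<Rightarrow> 'o \<Rightarrow> ('o, 'm) arrow"
  where "br A B = arw (A \<boxtimes> B) (B \<boxtimes> A) (braid C A B)"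

abbreviation I :: 'o where "I \<equiv> unit_obj C"
abbreviation dl :: "'o \<Rightarrow> 'o" where "dl \<equiv> dual_obj C"
abbreviation Z :: 'o where "Z \<equiv> zero_obj C"

definition evl :: "'o \<Rightarrow> ('o, 'm) arrow" where "evl A = arw (dl A \<boxtimes> A) I (ev C A)"
definition cvl :: "'o \<Rightarrow> ('o, 'm) arrow" where "cvl A = arw I (A \<boxtimes> dl A) (coev C A)"
definition i1 :: "'o \<Rightarrow> 'o \<Rightarrow> ('o, 'm) arrow" where "i1 A B = arw A (A \<boxplus> B) (inj1 C A B)"
definition i2 :: "'o \<Rightarrow> 'o \<Rightarrow> ('o, 'm) arrow" where "i2 A B = arw B (A \<boxplus> B) (inj2 C A B)"
definition p1 :: "'o \<Rightarrow> 'o \<Rightarrow> ('o, 'm) arrow" where "p1 A B = arw (A \<boxplus> B) A (prj1 C A B)"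
definition p2 :: "'o \<Rightarrow> 'o \<Rightarrow> ('o, 'm) arrow" where "p2 A B = arw (A \<boxplus> B) B (prj2 C A B)"

section \<open>Typing rules for arrows\<close>

lemma dom_cod [simp]:
  "dom (arw A B f) = A" "cod (arw A B f) = B"
  "dom (G \<bullet> F) = dom F" "cod (G \<bullet> F) = cod G"
  "dom (F \<parallel> G) = dom F \<boxtimes> dom G" "cod (F \<parallel> G) = cod F \<boxtimes> cod G"
  "dom (F \<uplus> G) = dom F" "cod (F \<uplus> G) = cod F"
  "dom (zr A B) = A" "cod (zr A B) = B"
  "dom (idn A) = A" "cod (idn A) = A"
  "dom (br A B) = A \<boxtimes> B" "cod (br A B) = B \<boxtimes> A"
  "dom (evl A) = dl A \<boxtimes> A" "cod (evl A) = I"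
  "dom (cvl A) = I" "cod (cvl A) = A \<boxtimes> dl A"
  "dom (i1 A B) = A" "cod (i1 A B) = A \<boxplus> B"
  "dom (i2 A B) = B" "cod (i2 A B) = A \<boxplus> B"
  "dom (p1 A B) = A \<boxplus> B" "cod (p1 A B) = A"
  "dom (p2 A B) = A \<boxplus> B" "cod (p2 A B) = B"
  by (simp_all add: arw_def comp_def tens_def plus_def zr_def idn_def br_def evl_def cvl_def
      i1_def i2_def p1_def p2_def)

lemma obj_simps [simp]:
  "A \<in> obj C \<Longrightarrow> B \<in> obj C \<Longrightarrow> A \<boxtimes> B \<in> obj C" "I \<in> obj C" "Z \<in> obj C"
  "A \<in> obj C \<Longrightarrow> dl A \<in> obj C" "A \<in> obj C \<Longrightarrow> B \<in> obj C \<Longrightarrow> A \<boxplus> B \<in> obj C"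
  "A \<in> obj C \<Longrightarrow> I \<boxtimes> A = A" "A \<in> obj C \<Longrightarrow> A \<boxtimes> I = A"
  "A \<in> obj C \<Longrightarrow> B \<in> obj C \<Longrightarrow> D \<in> obj C \<Longrightarrow> (A \<boxtimes> B) \<boxtimes> D = A \<boxtimes> (B \<boxtimes> D)"
  by (simp_all add: otimes_obj unit_obj zero_obj dual_obj dsum_obj otimes_unit_left
      otimes_unit_right otimes_assoc)

lemma arr_arw: "arr (arw A B f) \<longleftrightarrow> A \<in> obj C \<and> B \<in> obj C \<and> f \<in> mor C A B"
  by (simp add: arr_def arw_def)

lemma und_arw [simp]: "und (arw A B f) = f"
  by (simp add: arw_def)

lemma arw_und: "arr F \<Longrightarrow> arw (dom F) (cod F) (und F) = F"
  by (cases F) (auto simp: arr_def arw_def)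

lemma arw_eq_iff [simp]: "arw A B f = arw A' B' f' \<longleftrightarrow> A = A' \<and> B = B' \<and> f = f'"
  by (auto simp: arw_def)

lemma Hom_abelian_group: "A \<in> obj C \<Longrightarrow> B \<in> obj C \<Longrightarrow> abelian_group (Hom C A B)"
  using Hom_module by (simp add: module_def)

lemma add_mor: "\<lbrakk>A \<in> obj C; B \<in> obj C; f \<in> mor C A B; g \<in> mor C A B\<rbrakk> \<Longrightarrow> f \<oplus>\<^bsub>Hom C A B\<^esub> g \<in> mor C A B"
  using Hom_abelian_group[of A B] by (simp add: mor_def abelian_groupE(1))

lemma zero_mor: "\<lbrakk>A \<in> obj C; B \<in> obj C\<rbrakk> \<Longrightarrow> \<zero>\<^bsub>Hom C A B\<^esub> \<in> mor C A B"
  using Hom_abelian_group[of A B] by (simp add: mor_def abelian_groupE(2))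

lemma arr_comp [simp]: "arr (G \<bullet> F) \<longleftrightarrow> arr F \<and> arr G \<and> dom G = cod F"
  using cmp_mor[of "dom F" "cod F" "cod G" "und F" "und G"]
  by (auto simp: comp_def arr_def split: if_splits)

lemma arr_tens [simp]: "arr (F \<parallel> G) \<longleftrightarrow> arr F \<and> arr G"
  using mtimes_mor[of "dom F" "cod F" "dom G" "cod G" "und F" "und G"]
  by (auto simp: tens_def arr_def otimes_obj split: if_splits)

lemma arr_plus [simp]: "arr (F \<uplus> G) \<longleftrightarrow> arr F \<and> arr G \<and> dom F = dom G \<and> cod F = cod G"
  using add_mor[of "dom F" "cod F" "und F" "und G"]
  by (auto simp: plus_def arr_def split: if_splits)

lemma arr_basic [simp]:
  "A \<in> obj C \<Longrightarrow> arr (idn A)"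
  "A \<in> obj C \<Longrightarrow> B \<in> obj C \<Longrightarrow> arr (zr A B)"
  "A \<in> obj C \<Longrightarrow> B \<in> obj C \<Longrightarrow> arr (br A B)"
  "A \<in> obj C \<Longrightarrow> arr (evl A)"
  "A \<in> obj C \<Longrightarrow> arr (cvl A)"
  "A \<in> obj C \<Longrightarrow> B \<in> obj C \<Longrightarrow> arr (i1 A B)"
  "A \<in> obj C \<Longrightarrow> B \<in> obj C \<Longrightarrow> arr (i2 A B)"
  "A \<in> obj C \<Longrightarrow> B \<in> obj C \<Longrightarrow> arr (p1 A B)"
  "A \<in> obj C \<Longrightarrow> B \<in> obj C \<Longrightarrow> arr (p2 A B)"
  using braid_iso
  by (simp_all add: idn_def zr_def br_def evl_def cvl_def i1_def i2_def p1_def p2_def arr_arw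
      ide_mor zero_mor ev_mor coev_mor inj1_mor inj2_mor prj1_mor prj2_mor iso_mor_def)

lemma und_mor [simp]: "arr F \<Longrightarrow> A = dom F \<Longrightarrow> B = cod F \<Longrightarrow> und F \<in> mor C A B"
  by (simp add: arr_def)

lemma arr_obj [simp]: "arr F \<Longrightarrow> dom F \<in> obj C" "arr F \<Longrightarrow> cod F \<in> obj C"
  by (auto simp: arr_def)

lemma comp_arw:
  "\<lbrakk>A \<in> obj C; B \<in> obj C; D \<in> obj C; f \<in> mor C A B; g \<in> mor C B D\<rbrakk>
    \<Longrightarrow> arw B D g \<bullet> arw A B f = arw A D (g \<cdot> f)"
  by (simp add: comp_def arr_arw) (simp add: arw_def)

lemma tens_arw:
  "\<lbrakk>A \<in> obj C; B \<in> obj C; A' \<in> obj C; B' \<in> obj C; f \<in> mor C A B; f' \<in> mor C A' B'\<rbrakk>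
    \<Longrightarrow> arw A B f \<parallel> arw A' B' f' = arw (A \<boxtimes> A') (B \<boxtimes> B') (f \<star> f')"
  by (simp add: tens_def arr_arw) (simp add: arw_def)

lemma und_ops [simp]:
  "arr F \<Longrightarrow> arr G \<Longrightarrow> dom G = cod F \<Longrightarrow> und (G \<bullet> F) = und G \<cdot> und F"
  "arr F \<Longrightarrow> arr G \<Longrightarrow> und (F \<parallel> G) = und F \<star> und G"
  "arr F \<Longrightarrow> arr G \<Longrightarrow> dom F = dom G \<Longrightarrow> cod F = cod G
    \<Longrightarrow> und (F \<uplus> G) = und F \<oplus>\<^bsub>Hom C (dom F) (cod F)\<^esub> und G"
  "und (idn A) = ide C A"
  by (simp_all add: comp_def tens_def plus_def idn_def)

lemma not_arr_ops:
  "\<not> arr (G \<bullet> F) \<Longrightarrow> fst (snd (G \<bullet> F)) = None"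
  "\<not> arr (F \<parallel> G) \<Longrightarrow> fst (snd (F \<parallel> G)) = None"
  "\<not> arr (F \<uplus> G) \<Longrightarrow> fst (snd (F \<uplus> G)) = None"
  unfolding arr_comp arr_tens arr_plus by (auto simp: comp_def tens_def plus_def)

lemma arrow_eqI:
  "\<lbrakk>arr F; arr G; dom F = dom G; cod F = cod G; und F = und G\<rbrakk> \<Longrightarrow> F = G"
  by (metis arw_und)

text \<open>All ill-typed composites carry \<open>None\<close>, so two of them with equal endpoints
  coincide. Laws such as \<open>comp_assoc\<close> and \<open>comp_plus_right\<close> thereby hold
  without typing premises and can serve as plain rewrite rules.\<close>

lemma arrow_eqI':
  "\<lbrakk>arr F \<longleftrightarrow> arr G; dom F = dom G; cod F = cod G; \<not> arr F \<Longrightarrow> fst (snd F) = fst (snd G);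
    arr F \<Longrightarrow> arr G \<Longrightarrow> und F = und G\<rbrakk> \<Longrightarrow> F = G"
  by (metis arrow_eqI prod.collapse)

section \<open>Category, tensor and braiding laws for arrows\<close>

lemma comp_assoc [simp]: "(H \<bullet> G) \<bullet> F = H \<bullet> (G \<bullet> F)"
proof (rule arrow_eqI')
  show "fst (snd ((H \<bullet> G) \<bullet> F)) = fst (snd (H \<bullet> (G \<bullet> F)))" if "\<not> arr ((H \<bullet> G) \<bullet> F)"
  proof -
    have "\<not> arr (H \<bullet> (G \<bullet> F))" using that by auto
    with that show ?thesis by (metis not_arr_ops)
  qed
qed (auto intro!: cmp_assoc[of "dom F" "cod F" "cod G" "cod H"])

lemma comp_id [simp]:
  "arr F \<Longrightarrow> cod F = B \<Longrightarrow> idn B \<bullet> F = F"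
  "arr F \<Longrightarrow> dom F = B \<Longrightarrow> F \<bullet> idn B = F"
  by (rule arrow_eqI; auto intro!: cmp_ide_left[of "dom F" "cod F"] cmp_ide_right[of "dom F" "cod F"])+

text \<open>Restricted to arrows, in contrast to composition, since strict associativity of
  \<open>\<boxtimes>\<close> is available on members of \<open>obj C\<close> only.\<close>

lemma tens_assoc [simp]: "arr F \<Longrightarrow> arr G \<Longrightarrow> arr H \<Longrightarrow> (F \<parallel> G) \<parallel> H = F \<parallel> (G \<parallel> H)"
  by (rule arrow_eqI)
    (auto intro!: mtimes_assoc[of "dom F" "dom G" "dom H" "cod F" "cod G" "cod H"])

lemma tens_unit [simp]: "arr F \<Longrightarrow> idn I \<parallel> F = F" "arr F \<Longrightarrow> F \<parallel> idn I = F"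
  by (rule arrow_eqI; auto intro!: mtimes_unit_left[of "dom F" "cod F"]
      mtimes_unit_right[of "dom F" "cod F"])+

lemma id_tens: "A \<in> obj C \<Longrightarrow> B \<in> obj C \<Longrightarrow> idn (A \<boxtimes> B) = idn A \<parallel> idn B"
  by (simp add: idn_def tens_arw ide_mor mtimes_ide)

lemma interchange:
  assumes "dom G = cod F" "dom G' = cod F'"
  shows "(G \<parallel> G') \<bullet> (F \<parallel> F') = (G \<bullet> F) \<parallel> (G' \<bullet> F')"
proof (rule arrow_eqI')
  show "fst (snd ((G \<parallel> G') \<bullet> (F \<parallel> F'))) = fst (snd ((G \<bullet> F) \<parallel> (G' \<bullet> F')))"
    if "\<not> arr ((G \<parallel> G') \<bullet> (F \<parallel> F'))"
  proof -
    have "\<not> arr ((G \<bullet> F) \<parallel> (G' \<bullet> F'))" using that assms by auto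
    with that show ?thesis by (metis not_arr_ops)
  qed
qed (use assms in \<open>auto intro!: mtimes_cmp[symmetric, of "dom F" "cod F" "cod G" "dom F'" "cod F'" "cod G'"]\<close>)

lemma br_natural: "arr F \<Longrightarrow> arr G \<Longrightarrow> br (cod F) (cod G) \<bullet> (F \<parallel> G) = (G \<parallel> F) \<bullet> br (dom F) (dom G)"
  by (rule arrow_eqI) (auto simp: br_def[THEN arg_cong[of _ _ und]] intro!: braid_natural)

lemma hexagon_right: "\<lbrakk>A \<in> obj C; B \<in> obj C; D \<in> obj C\<rbrakk>
    \<Longrightarrow> br A (B \<boxtimes> D) = (idn B \<parallel> br A D) \<bullet> (br A B \<parallel> idn D)"
  by (rule arrow_eqI) (auto simp: br_def[THEN arg_cong[of _ _ und]] intro!: hexagon1)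

lemma hexagon_left: "\<lbrakk>A \<in> obj C; B \<in> obj C; D \<in> obj C\<rbrakk>
    \<Longrightarrow> br (A \<boxtimes> B) D = (br A D \<parallel> idn B) \<bullet> (idn A \<parallel> br B D)"
  by (rule arrow_eqI) (auto simp: br_def[THEN arg_cong[of _ _ und]] intro!: hexagon2)

lemma triangles:
  assumes "A \<in> obj C"
  shows "(idn A \<parallel> evl A) \<bullet> (cvl A \<parallel> idn A) = idn A"
    and "(evl A \<parallel> idn (dl A)) \<bullet> (idn (dl A) \<parallel> cvl A) = idn (dl A)"
  by (rule arrow_eqI; use assms in
      \<open>simp add: evl_def[THEN arg_cong[of _ _ und]] cvl_def[THEN arg_cong[of _ _ und]] triangle1 triangle2\<close>)+

section \<open>Addition of arrows and biproducts\<close>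

lemma plus_comm: "dom F = dom G \<Longrightarrow> cod F = cod G \<Longrightarrow> F \<uplus> G = G \<uplus> F"
proof (rule arrow_eqI')
  assume "dom F = dom G" "cod F = cod G"
  then show "fst (snd (F \<uplus> G)) = fst (snd (G \<uplus> F))" if "\<not> arr (F \<uplus> G)"
    using that not_arr_ops(3)[of F G] not_arr_ops(3)[of G F] by auto
  assume "arr (F \<uplus> G)" "arr (G \<uplus> F)"
  then show "und (F \<uplus> G) = und (G \<uplus> F)"
    using abelian_groupE(4)[OF Hom_abelian_group[of "dom F" "cod F"], of "und F" "und G"]
    by (simp add: und_mor[unfolded mor_def])
qed auto

lemma plus_assoc: "(F \<uplus> G) \<uplus> H = F \<uplus> (G \<uplus> H)"
proof (rule arrow_eqI')
  show "fst (snd ((F \<uplus> G) \<uplus> H)) = fst (snd (F \<uplus> (G \<uplus> H)))" if "\<not> arr ((F \<uplus> G) \<uplus> H)"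
  proof -
    have "\<not> arr (F \<uplus> (G \<uplus> H))" using that by auto
    with that show ?thesis by (metis not_arr_ops)
  qed
  assume "arr ((F \<uplus> G) \<uplus> H)" "arr (F \<uplus> (G \<uplus> H))"
  then show "und ((F \<uplus> G) \<uplus> H) = und (F \<uplus> (G \<uplus> H))"
    using abelian_groupE(3)[OF Hom_abelian_group[of "dom F" "cod F"], of "und F" "und G" "und H"]
    by (simp add: und_mor[unfolded mor_def])
qed auto

lemma plus_zero [simp]:
  assumes "arr F" "dom F = A" "cod F = B"
  shows "F \<uplus> zr A B = F" "zr A B \<uplus> F = F"
proof -
  show "zr A B \<uplus> F = F"
    using assms abelian_groupE(5)[OF Hom_abelian_group[of A B], of "und F"]
    by (intro arrow_eqI) (auto simp: zr_def[THEN arg_cong[of _ _ und]] und_mor[unfolded mor_def])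
  then show "F \<uplus> zr A B = F"
    using assms plus_comm[of F "zr A B"] by simp
qed

text \<open>An idempotent of a group is neutral. Applied to a composite with a zero arrow, this
  derives preservation of zero from distributivity.\<close>

lemma plus_idem:
  assumes "arr F" "F \<uplus> F = F"
  shows "F = zr (dom F) (cod F)"
proof -
  interpret H: abelian_group "Hom C (dom F) (cod F)"
    using assms(1) by (intro Hom_abelian_group) simp_all
  have "und F \<in> carrier (Hom C (dom F) (cod F))"
    using und_mor[OF assms(1) refl refl] by (simp add: mor_def)
  moreover from this have "und F \<oplus>\<^bsub>Hom C (dom F) (cod F)\<^esub> und F = und F"
    using und_ops(3)[OF assms(1) assms(1) refl refl] by (simp add: assms(2))
  ultimately have "und F = \<zero>\<^bsub>Hom C (dom F) (cod F)\<^esub>"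
    by (simp add: H.add.l_cancel_one)
  then show ?thesis
    using arw_und[OF assms(1)] by (simp add: zr_def)
qed

lemma comp_plus_right: "H \<bullet> (F \<uplus> G) = (H \<bullet> F) \<uplus> (H \<bullet> G)"
proof (rule arrow_eqI')
  show "fst (snd (H \<bullet> (F \<uplus> G))) = fst (snd ((H \<bullet> F) \<uplus> (H \<bullet> G)))" if "\<not> arr (H \<bullet> (F \<uplus> G))"
  proof -
    have "\<not> arr ((H \<bullet> F) \<uplus> (H \<bullet> G))" using that by auto
    with that show ?thesis by (metis not_arr_ops)
  qed
qed (auto intro!: cmp_add_right)

lemma comp_plus_left: "(F \<uplus> G) \<bullet> H = (F \<bullet> H) \<uplus> (G \<bullet> H)"
proof (rule arrow_eqI')
  show "fst (snd ((F \<uplus> G) \<bullet> H)) = fst (snd ((F \<bullet> H) \<uplus> (G \<bullet> H)))" if "\<not> arr ((F \<uplus> G) \<bullet> H)"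
  proof -
    have "\<not> arr ((F \<bullet> H) \<uplus> (G \<bullet> H))" using that by auto
    with that show ?thesis by (metis not_arr_ops)
  qed
qed (auto intro!: cmp_add_left)

lemma comp_zero [simp]:
  "\<lbrakk>arr G; dom G = B; A \<in> obj C\<rbrakk> \<Longrightarrow> G \<bullet> zr A B = zr A (cod G)"
  "\<lbrakk>arr G; cod G = A; B \<in> obj C\<rbrakk> \<Longrightarrow> zr A B \<bullet> G = zr (dom G) B"
  using plus_idem[of "G \<bullet> zr A B"] plus_idem[of "zr A B \<bullet> G"]
    comp_plus_right[of G "zr A B" "zr A B"] comp_plus_left[of "zr A B" "zr A B" G]
  by auto

lemma und_basic:
  "und (zr A B) = \<zero>\<^bsub>Hom C A B\<^esub>"
  "und (i1 A B) = inj1 C A B" "und (i2 A B) = inj2 C A B"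
  "und (p1 A B) = prj1 C A B" "und (p2 A B) = prj2 C A B"
  by (simp_all add: zr_def i1_def i2_def p1_def p2_def)

lemma biproduct:
  assumes "A \<in> obj C" "B \<in> obj C"
  shows "p1 A B \<bullet> i1 A B = idn A" "p2 A B \<bullet> i2 A B = idn B"
    "p1 A B \<bullet> i2 A B = zr B A" "p2 A B \<bullet> i1 A B = zr A B"
    "i1 A B \<bullet> p1 A B \<uplus> i2 A B \<bullet> p2 A B = idn (A \<boxplus> B)"
  by (rule arrow_eqI; use assms in \<open>simp add: und_basic prj1_inj1 prj1_inj2 prj2_inj1 prj2_inj2
      dsum_decomp\<close>)+

lemma idn_zero_obj: "idn Z = zr Z Z"
  by (simp add: idn_def zr_def zero_obj_ide)

end

section \<open>Additivity of the tensor product\<close>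

locale klinear_rigid_symmetric_category = klinear_rigid_braided_category k C
  for k :: "('k, 'r) ring_scheme" and C :: "('k, 'o, 'm) rb_cat" (structure) +
  assumes symmetric: "symmetric_braiding C"
begin

text \<open>\<open>comp_assoc\<close> nests composites to the right, so an equation for
  \<open>G \<bullet> F\<close> does not match inside a longer chain. This version carries the tail
  \<open>H\<close> along.\<close>

lemma comp_reduce: "G \<bullet> F = X \<Longrightarrow> G \<bullet> (F \<bullet> H) = X \<bullet> H"
  by (metis comp_assoc)

lemma br_br: "A \<in> obj C \<Longrightarrow> B \<in> obj C \<Longrightarrow> br B A \<bullet> br A B = idn A \<parallel> idn B"
  using symmetric
  by (simp add: symmetric_braiding_def id_tens[symmetric])
    (rule arrow_eqI; simp add: br_def[THEN arg_cong[of _ _ und]])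

lemma br_br': "A \<in> obj C \<Longrightarrow> B \<in> obj C \<Longrightarrow> arr F \<Longrightarrow> cod F = A \<boxtimes> B \<Longrightarrow> br B A \<bullet> (br A B \<bullet> F) = F"
  by (simp add: comp_assoc[symmetric] br_br del: comp_assoc) (simp add: id_tens[symmetric])

text \<open>The hexagon for \<open>I \<boxtimes> I\<close> makes the braiding with the unit
  idempotent, and an invertible idempotent is an identity.\<close>

lemma br_unit [simp]:
  assumes "A \<in> obj C"
  shows "br I A = idn A" "br A I = idn A"
proof -
  have "br I A = br I A \<bullet> br I A"
    using hexagon_left[of I I A] assms by simp
  then have "br A I \<bullet> br I A = br A I \<bullet> (br I A \<bullet> br I A)"
    by simp
  with assms show *: "br I A = idn A"
    by (simp add: br_br br_br')
  show "br A I = idn A"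
    using br_br[of I A] assms by (simp add: *)
qed

text \<open>Transposing \<open>u : A \<boxtimes> N \<rightarrow> T\<close> to an arrow from
  \<open>A\<close> to \<open>T \<boxtimes> dl N\<close> loses nothing. Evaluating the transpose
  against \<open>N\<close> gives \<open>u\<close> back: \<open>u\<close> slides past
  \<open>evl N\<close> by interchange, and a triangle identity remains.\<close>

lemma curry_inj:
  assumes N: "N \<in> obj C" and A: "A \<in> obj C" and T: "T \<in> obj C"
    and u: "arr u" "dom u = A \<boxtimes> N" "cod u = T" and v: "arr v" "dom v = A \<boxtimes> N" "cod v = T"
    and eq: "(u \<parallel> idn (dl N)) \<bullet> (idn A \<parallel> cvl N) = (v \<parallel> idn (dl N)) \<bullet> (idn A \<parallel> cvl N)"
  shows "u = v"
proof -
  have *: "w = (idn T \<parallel> evl N) \<bullet> (((w \<parallel> idn (dl N)) \<bullet> (idn A \<parallel> cvl N)) \<parallel> idn N)"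
    if w: "arr w" "dom w = A \<boxtimes> N" "cod w = T" for w
  proof -
    have "(idn T \<parallel> evl N) \<bullet> (((w \<parallel> idn (dl N)) \<bullet> (idn A \<parallel> cvl N)) \<parallel> idn N)
        = (idn T \<parallel> evl N) \<bullet> (w \<parallel> idn (dl N \<boxtimes> N)) \<bullet> (idn A \<parallel> cvl N \<parallel> idn N)"
      using interchange[of "w \<parallel> idn (dl N)" "idn A \<parallel> cvl N" "idn N" "idn N"] N A T w
      by (simp add: id_tens)
    also have "\<dots> = (w \<parallel> idn I) \<bullet> ((idn (A \<boxtimes> N) \<parallel> evl N) \<bullet> (idn A \<parallel> cvl N \<parallel> idn N))"
    proof -
      have "(idn T \<parallel> evl N) \<bullet> (w \<parallel> idn (dl N \<boxtimes> N)) = (w \<parallel> idn I) \<bullet> (idn (A \<boxtimes> N) \<parallel> evl N)"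
        using N A T w by (simp only: interchange dom_cod comp_id arr_basic obj_simps)
      then show ?thesis
        by (metis comp_assoc)
    qed
    also have "(idn (A \<boxtimes> N) \<parallel> evl N) \<bullet> (idn A \<parallel> cvl N \<parallel> idn N)
        = idn A \<parallel> ((idn N \<parallel> evl N) \<bullet> (cvl N \<parallel> idn N))"
      using N A by (simp add: id_tens interchange)
    also have "\<dots> = idn (A \<boxtimes> N)"
      using N A by (simp add: triangles id_tens)
    finally show ?thesis
      using N A T w by simp
  qed
  show ?thesis
    using *[OF u] *[OF v] eq by simp
qed

text \<open>Naturality of transposition in the first tensor factor.\<close>

lemma curry_comp:
  assumes "N \<in> obj C" "arr u" "arr f" "dom u = cod f \<boxtimes> N"
  shows "((u \<bullet> (f \<parallel> idn N)) \<parallel> idn (dl N)) \<bullet> (idn (dom f) \<parallel> cvl N)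
    = ((u \<parallel> idn (dl N)) \<bullet> (idn (cod f) \<parallel> cvl N)) \<bullet> f"
proof -
  have "((u \<bullet> (f \<parallel> idn N)) \<parallel> idn (dl N)) \<bullet> (idn (dom f) \<parallel> cvl N)
    = (u \<parallel> idn (dl N)) \<bullet> ((f \<parallel> idn N \<parallel> idn (dl N)) \<bullet> (idn (dom f) \<parallel> cvl N))"
    using assms interchange[of u "f \<parallel> idn N" "idn (dl N)" "idn (dl N)", symmetric] by simp
  also have "(f \<parallel> idn N \<parallel> idn (dl N)) \<bullet> (idn (dom f) \<parallel> cvl N) = f \<parallel> cvl N"
    using assms by (simp add: id_tens[symmetric] interchange)
  also have "f \<parallel> cvl N = (idn (cod f) \<parallel> cvl N) \<bullet> (f \<parallel> idn I)"
    using assms by (simp only: interchange dom_cod) (simp del: tens_unit)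
  finally show ?thesis
    using assms by simp
qed

lemma dsum_jointly_epic:
  assumes "A \<in> obj C" "B \<in> obj C" "arr u" "arr v" "dom u = A \<boxplus> B" "dom v = A \<boxplus> B"
    "u \<bullet> i1 A B = v \<bullet> i1 A B" "u \<bullet> i2 A B = v \<bullet> i2 A B"
  shows "u = v"
proof -
  have "w = (w \<bullet> i1 A B) \<bullet> p1 A B \<uplus> (w \<bullet> i2 A B) \<bullet> p2 A B" if "arr w" "dom w = A \<boxplus> B" for w
    using comp_plus_right[of w "i1 A B \<bullet> p1 A B" "i2 A B \<bullet> p2 A B"] that assms
    by (simp add: biproduct)
  from this[of u] this[of v] show ?thesis
    using assms by (simp del: comp_assoc)
qed

text \<open>The functor \<open>_ \<parallel> N\<close> has a right adjoint, so it turns the injections of a direct sum into a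
  jointly epic pair; this forces it to be additive.\<close>

lemma tens_dsum_jointly_epic:
  assumes "A \<in> obj C" "B \<in> obj C" "N \<in> obj C" "arr u" "arr v" "dom u = (A \<boxplus> B) \<boxtimes> N" "dom v = (A \<boxplus> B) \<boxtimes> N"
    "cod u = cod v"
    "u \<bullet> (i1 A B \<parallel> idn N) = v \<bullet> (i1 A B \<parallel> idn N)" "u \<bullet> (i2 A B \<parallel> idn N) = v \<bullet> (i2 A B \<parallel> idn N)"
  shows "u = v"
proof (rule curry_inj[of N "A \<boxplus> B" "cod v"])
  show "(u \<parallel> idn (dl N)) \<bullet> (idn (A \<boxplus> B) \<parallel> cvl N) = (v \<parallel> idn (dl N)) \<bullet> (idn (A \<boxplus> B) \<parallel> cvl N)"
  proof (rule dsum_jointly_epic[of A B])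
    show "((u \<parallel> idn (dl N)) \<bullet> (idn (A \<boxplus> B) \<parallel> cvl N)) \<bullet> i1 A B
        = ((v \<parallel> idn (dl N)) \<bullet> (idn (A \<boxplus> B) \<parallel> cvl N)) \<bullet> i1 A B"
      using curry_comp[of N u "i1 A B"] curry_comp[of N v "i1 A B"] assms(1-8)
      by (simp only: assms(9) dom_cod arr_basic)
    show "((u \<parallel> idn (dl N)) \<bullet> (idn (A \<boxplus> B) \<parallel> cvl N)) \<bullet> i2 A B
        = ((v \<parallel> idn (dl N)) \<bullet> (idn (A \<boxplus> B) \<parallel> cvl N)) \<bullet> i2 A B"
      using curry_comp[of N u "i2 A B"] curry_comp[of N v "i2 A B"] assms(1-8)
      by (simp only: assms(10) dom_cod arr_basic)
  qed (use assms(1-8) in simp_all)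
qed (use assms in simp_all)

text \<open>Tensoring with \<open>N\<close> preserves initial objects: the identity of
  \<open>Z \<boxtimes> N\<close> transposes to an arrow out of \<open>Z\<close>, which must be zero.
  Every zero arrow factors through \<open>Z\<close>.\<close>

lemma tens_zero_left_id:
  assumes "A \<in> obj C" "B \<in> obj C" "N \<in> obj C"
  shows "zr A B \<parallel> idn N = zr (A \<boxtimes> N) (B \<boxtimes> N)"
proof -
  have init: "F = zr Z (cod F)" if "arr F" "dom F = Z" for F
    using that comp_id(2)[of F Z] by (simp add: idn_zero_obj)
  have Z: "idn Z \<parallel> idn N = zr (Z \<boxtimes> N) (Z \<boxtimes> N)"
  proof (rule curry_inj[of N Z "Z \<boxtimes> N"])
    let ?F = "\<lambda>u. (u \<parallel> idn (dl N)) \<bullet> (idn Z \<parallel> cvl N)"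
    have "?F (idn Z \<parallel> idn N) = zr Z (cod (?F (idn Z \<parallel> idn N)))"
      "?F (zr (Z \<boxtimes> N) (Z \<boxtimes> N)) = zr Z (cod (?F (zr (Z \<boxtimes> N) (Z \<boxtimes> N))))"
      using assms by (intro init; simp)+
    then show "?F (idn Z \<parallel> idn N) = ?F (zr (Z \<boxtimes> N) (Z \<boxtimes> N))"
      by (simp only: dom_cod)
  qed (use assms in simp_all)
  have "zr A B \<parallel> idn N = (zr Z B \<parallel> idn N) \<bullet> ((idn Z \<parallel> idn N) \<bullet> (zr A Z \<parallel> idn N))"
    using assms by (simp add: interchange)
  also have "\<dots> = zr (A \<boxtimes> N) (B \<boxtimes> N)"
    unfolding Z using assms by simp
  finally show ?thesis .
qed

text \<open>\<open>F \<uplus> G\<close> is the arrow with components \<open>F\<close> and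
  \<open>G\<close> into \<open>?B \<boxplus> ?B\<close>, followed by the codiagonal
  \<open>p1 ?B ?B \<uplus> p2 ?B ?B\<close>. For the codiagonal the claim is tested on the two
  injections, where both sides become the identity once the cross terms vanish by
  \<open>tens_zero_left_id\<close>.\<close>

lemma tens_plus_id:
  assumes FG: "arr F" "arr G" "dom F = dom G" "cod F = cod G" and N: "N \<in> obj C"
  shows "(F \<uplus> G) \<parallel> idn N = F \<parallel> idn N \<uplus> G \<parallel> idn N"
proof -
  let ?B = "cod G"
  let ?f = "i1 ?B ?B \<bullet> F \<uplus> i2 ?B ?B \<bullet> G"
  have B: "?B \<in> obj C" using FG by simp
  have p: "(p1 ?B ?B \<uplus> p2 ?B ?B) \<parallel> idn N = p1 ?B ?B \<parallel> idn N \<uplus> p2 ?B ?B \<parallel> idn N"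
    using B N by (rule_tac tens_dsum_jointly_epic[of ?B ?B N])
      (simp_all add: comp_plus_left interchange biproduct tens_zero_left_id)
  have F: "p1 ?B ?B \<bullet> ?f = F" "p2 ?B ?B \<bullet> ?f = G"
    using FG B by (simp_all add: comp_plus_right comp_assoc[symmetric] biproduct del: comp_assoc)
  have "(F \<uplus> G) \<parallel> idn N = ((p1 ?B ?B \<uplus> p2 ?B ?B) \<parallel> idn N) \<bullet> (?f \<parallel> idn N)"
    using FG B N F by (simp add: interchange comp_plus_left)
  also have "\<dots> = F \<parallel> idn N \<uplus> G \<parallel> idn N"
    unfolding p using FG B N F by (simp add: interchange comp_plus_left)
  finally show ?thesis .
qed

lemma tens_plus_left:
  assumes "arr F" "arr G" "dom F = dom G" "cod F = cod G" "arr H"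
  shows "(F \<uplus> G) \<parallel> H = F \<parallel> H \<uplus> G \<parallel> H"
proof -
  have split: "X \<parallel> H = (X \<parallel> idn (cod H)) \<bullet> (idn (dom X) \<parallel> H)" if "arr X" for X
    using that assms by (simp add: interchange)
  show ?thesis
    using assms by (simp add: split[of "F \<uplus> G"] split[of F] split[of G] tens_plus_id comp_plus_left)
qed

text \<open>Conjugation by the symmetry exchanges the tensor factors, so statements about the right
  factor reduce to those about the left one.\<close>

lemma tens_swap: "arr F \<Longrightarrow> arr G \<Longrightarrow> F \<parallel> G = br (cod G) (cod F) \<bullet> (G \<parallel> F) \<bullet> br (dom F) (dom G)"
  using br_natural[of F G] by (metis arr_obj arr_tens br_br' dom_cod(6))

lemma tens_plus_right:
  assumes "arr F" "arr G" "dom F = dom G" "cod F = cod G" "arr H"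
  shows "H \<parallel> (F \<uplus> G) = H \<parallel> F \<uplus> H \<parallel> G"
  using assms by (simp add: tens_swap[of H "F \<uplus> G"] tens_swap[of H F] tens_swap[of H G]
      tens_plus_left comp_plus_left comp_plus_right)

lemma tens_zero [simp]:
  assumes "A \<in> obj C" "B \<in> obj C" "arr H"
  shows "zr A B \<parallel> H = zr (A \<boxtimes> dom H) (B \<boxtimes> cod H)" "H \<parallel> zr A B = zr (dom H \<boxtimes> A) (cod H \<boxtimes> B)"
proof -
  have "zr A B \<parallel> H = (zr A B \<parallel> idn (cod H)) \<bullet> (idn A \<parallel> H)"
    using assms by (simp add: interchange)
  then show *: "zr A B \<parallel> H = zr (A \<boxtimes> dom H) (B \<boxtimes> cod H)"
    using assms by (simp add: tens_zero_left_id)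
  show "H \<parallel> zr A B = zr (dom H \<boxtimes> A) (cod H \<boxtimes> B)"
    using assms by (simp add: tens_swap[of H "zr A B"] *)
qed

section \<open>Dualities\<close>

lemma tens_decomp:
  "arr F \<Longrightarrow> arr G \<Longrightarrow> (F \<parallel> idn (cod G)) \<bullet> (idn (dom F) \<parallel> G) = F \<parallel> G"
  "arr F \<Longrightarrow> arr G \<Longrightarrow> (idn (cod F) \<parallel> G) \<bullet> (F \<parallel> idn (dom G)) = F \<parallel> G"
  by (simp_all only: interchange dom_cod comp_id)

lemma tens_comp_right:
  "A \<in> obj C \<Longrightarrow> dom G = cod F \<Longrightarrow> idn A \<parallel> (G \<bullet> F) = (idn A \<parallel> G) \<bullet> (idn A \<parallel> F)"
  "A \<in> obj C \<Longrightarrow> dom G = cod F \<Longrightarrow> (G \<bullet> F) \<parallel> idn A = (G \<parallel> idn A) \<bullet> (F \<parallel> idn A)"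
  by (simp_all add: interchange)

text \<open>Says that \<open>A\<close> is a left dual of \<open>B\<close>, with evaluation
  \<open>\<beta>\<close> and coevaluation \<open>d\<close>, and without reference to the chosen dual
  \<open>dl B\<close>.\<close>

definition pairing :: "'o \<Rightarrow> 'o \<Rightarrow> ('o, 'm) arrow \<Rightarrow> ('o, 'm) arrow \<Rightarrow> bool"
  where "pairing A B \<beta> d \<longleftrightarrow> A \<in> obj C \<and> B \<in> obj C
    \<and> arr \<beta> \<and> dom \<beta> = A \<boxtimes> B \<and> cod \<beta> = I \<and> arr d \<and> dom d = I \<and> cod d = B \<boxtimes> A
    \<and> (\<beta> \<parallel> idn A) \<bullet> (idn A \<parallel> d) = idn A \<and> (idn B \<parallel> \<beta>) \<bullet> (d \<parallel> idn B) = idn B"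

lemma pairingD:
  assumes "pairing A B \<beta> d"
  shows "A \<in> obj C" "B \<in> obj C" "arr \<beta>" "dom \<beta> = A \<boxtimes> B" "cod \<beta> = I" "arr d" "dom d = I" "cod d = B \<boxtimes> A"
    "(\<beta> \<parallel> idn A) \<bullet> (idn A \<parallel> d) = idn A" "(idn B \<parallel> \<beta>) \<bullet> (d \<parallel> idn B) = idn B"
  using assms by (simp_all add: pairing_def)

lemma pairing_ev: "A \<in> obj C \<Longrightarrow> pairing (dl A) A (evl A) (cvl A)"
  by (simp add: pairing_def triangles)

text \<open>The inner arrow is the adjoint map of \<open>\<beta>\<close> with respect to an
  arbitrary dual \<open>A'\<close> of \<open>B\<close>. By interchange \<open>\<beta>'\<close>
  slides past \<open>\<beta>\<close>, and a triangle identity straightens what is left. The form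
  \<open>\<beta>\<close> itself may be degenerate.\<close>

lemma pairing_adjoint:
  assumes [simp]: "A \<in> obj C" "arr \<beta>" "dom \<beta> = A \<boxtimes> B" "cod \<beta> = I" and P': "pairing A' B \<beta>' d'"
  shows "\<beta>' \<bullet> (((\<beta> \<parallel> idn A') \<bullet> (idn A \<parallel> d')) \<parallel> idn B) = \<beta>"
proof -
  let ?\<phi> = "(\<beta> \<parallel> idn A') \<bullet> (idn A \<parallel> d')"
  note [simp] = pairingD[OF P']
  have "\<beta>' \<bullet> (?\<phi> \<parallel> idn B) = (\<beta>' \<bullet> (\<beta> \<parallel> idn A' \<parallel> idn B)) \<bullet> (idn A \<parallel> d' \<parallel> idn B)"
    by (simp add: tens_comp_right)
  also have "\<beta>' \<bullet> (\<beta> \<parallel> idn A' \<parallel> idn B) = \<beta> \<bullet> (idn A \<parallel> idn B \<parallel> \<beta>')"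
    using tens_decomp[of \<beta> \<beta>'] by (simp add: id_tens)
  also have "(\<beta> \<bullet> (idn A \<parallel> idn B \<parallel> \<beta>')) \<bullet> (idn A \<parallel> d' \<parallel> idn B)
      = \<beta> \<bullet> (idn A \<parallel> ((idn B \<parallel> \<beta>') \<bullet> (d' \<parallel> idn B)))"
    by (simp add: interchange)
  also have "\<dots> = \<beta>"
    by (simp add: id_tens[symmetric])
  finally show ?thesis .
qed

text \<open>Uniqueness of duals. The comparison \<open>\<phi>\<close> pulls \<open>\<beta>'\<close>
  back to \<open>\<beta>\<close>, so the composite becomes the triangle identity of
  \<open>\<beta>\<close> and \<open>d\<close>. Exchanging the roles of the two pairings gives the
  other composite.\<close>

lemma pairing_compare:
  assumes P: "pairing A B \<beta> d" and P': "pairing A' B \<beta>' d'"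
  shows "((\<beta>' \<parallel> idn A) \<bullet> (idn A' \<parallel> d)) \<bullet> ((\<beta> \<parallel> idn A') \<bullet> (idn A \<parallel> d')) = idn A"
proof -
  note [simp] = pairingD[OF P] pairingD[OF P']
  define \<phi> where "\<phi> = (\<beta> \<parallel> idn A') \<bullet> (idn A \<parallel> d')"
  have [simp]: "arr \<phi>" "dom \<phi> = A" "cod \<phi> = A'"
    by (simp_all add: \<phi>_def)
  have *: "\<beta>' \<bullet> (\<phi> \<parallel> idn B) = \<beta>"
    unfolding \<phi>_def by (rule pairing_adjoint[OF _ _ _ _ P']) simp_all
  have "((\<beta>' \<parallel> idn A) \<bullet> (idn A' \<parallel> d)) \<bullet> \<phi> = (\<beta>' \<parallel> idn A) \<bullet> ((\<phi> \<parallel> idn B \<parallel> idn A) \<bullet> (idn A \<parallel> d))"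
    using tens_decomp[of \<phi> d] by (simp add: id_tens)
  also have "\<dots> = ((\<beta>' \<bullet> (\<phi> \<parallel> idn B)) \<parallel> idn A) \<bullet> (idn A \<parallel> d)"
    by (simp add: tens_comp_right)
  finally show ?thesis
    by (simp add: * \<phi>_def[symmetric])
qed

text \<open>Computes the zigzag of a form pulled back along \<open>p\<close>, \<open>q\<close> with
  a copairing pushed forward along \<open>i\<close>, \<open>j\<close>. The two interact only through
  \<open>q \<bullet> j\<close>: if this is an identity a triangle remains, and if it is zero the
  term disappears.\<close>

lemma zigzag_left:
  assumes "A \<in> obj C" "B \<in> obj C" "A' \<in> obj C" "B' \<in> obj C"
    and b: "arr b" "dom b = A \<boxtimes> B" "cod b = I" and d: "arr d" "dom d = I" "cod d = B' \<boxtimes> A'"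
    and "arr p" "cod p = A" and "arr q" "cod q = B" "arr i" "dom i = A'" "arr j" "dom j = B'" "cod j = dom q"
  shows "((b \<bullet> (p \<parallel> q)) \<parallel> idn (cod i)) \<bullet> (idn (dom p) \<parallel> ((j \<parallel> i) \<bullet> d))
    = i \<bullet> (b \<parallel> idn A') \<bullet> (idn A \<parallel> (q \<bullet> j) \<parallel> idn A') \<bullet> (idn A \<parallel> d) \<bullet> p"
proof -
  have "((b \<bullet> (p \<parallel> q)) \<parallel> idn (cod i)) \<bullet> (idn (dom p) \<parallel> ((j \<parallel> i) \<bullet> d))
      = (b \<parallel> idn (cod i)) \<bullet> ((p \<parallel> q \<parallel> idn (cod i)) \<bullet> (idn (dom p) \<parallel> j \<parallel> i)) \<bullet> (idn (dom p) \<parallel> d)"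
    using assms by (simp add: tens_comp_right)
  also have "(p \<parallel> q \<parallel> idn (cod i)) \<bullet> (idn (dom p) \<parallel> j \<parallel> i) = p \<parallel> (q \<bullet> j) \<parallel> i"
    using assms by (simp add: interchange)
  also have "\<dots> = (idn A \<parallel> idn B \<parallel> i) \<bullet> (idn A \<parallel> (q \<bullet> j) \<parallel> idn A') \<bullet> (p \<parallel> idn B' \<parallel> idn A')"
    using assms by (simp add: interchange)
  also have "(b \<parallel> idn (cod i)) \<bullet> (\<dots> \<bullet> (idn (dom p) \<parallel> d))
      = ((b \<parallel> idn (cod i)) \<bullet> (idn A \<parallel> idn B \<parallel> i)) \<bullet> (idn A \<parallel> (q \<bullet> j) \<parallel> idn A')
        \<bullet> ((p \<parallel> idn B' \<parallel> idn A') \<bullet> (idn (dom p) \<parallel> d))"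
    by simp
  also have "(p \<parallel> idn B' \<parallel> idn A') \<bullet> (idn (dom p) \<parallel> d) = (idn A \<parallel> d) \<bullet> p"
    using assms tens_decomp[of p d] by (simp add: id_tens)
  also have "(b \<parallel> idn (cod i)) \<bullet> (idn A \<parallel> idn B \<parallel> i) = i \<bullet> (b \<parallel> idn A')"
    using assms tens_decomp[of b i] by (simp add: id_tens)
  finally show ?thesis
    by simp
qed

text \<open>Counterpart for the second triangle identity, where the interaction is through
  \<open>p \<bullet> i\<close>.\<close>

lemma zigzag_right:
  assumes "A \<in> obj C" "B \<in> obj C" "A' \<in> obj C" "B' \<in> obj C"
    and b: "arr b" "dom b = A \<boxtimes> B" "cod b = I" and d: "arr d" "dom d = I" "cod d = B' \<boxtimes> A'"
    and "arr p" "cod p = A" and "arr q" "cod q = B" "arr i" "dom i = A'" "arr j" "dom j = B'" "cod i = dom p"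
  shows "(idn (cod j) \<parallel> (b \<bullet> (p \<parallel> q))) \<bullet> (((j \<parallel> i) \<bullet> d) \<parallel> idn (dom q))
    = j \<bullet> (idn B' \<parallel> b) \<bullet> (idn B' \<parallel> (p \<bullet> i) \<parallel> idn B) \<bullet> (d \<parallel> idn B) \<bullet> q"
proof -
  have "(idn (cod j) \<parallel> (b \<bullet> (p \<parallel> q))) \<bullet> (((j \<parallel> i) \<bullet> d) \<parallel> idn (dom q))
      = (idn (cod j) \<parallel> b) \<bullet> ((idn (cod j) \<parallel> p \<parallel> q) \<bullet> (j \<parallel> i \<parallel> idn (dom q))) \<bullet> (d \<parallel> idn (dom q))"
    using assms by (simp add: tens_comp_right)
  also have "(idn (cod j) \<parallel> p \<parallel> q) \<bullet> (j \<parallel> i \<parallel> idn (dom q)) = j \<parallel> (p \<bullet> i) \<parallel> q"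
    using assms by (simp add: interchange)
  also have "\<dots> = (j \<parallel> idn A \<parallel> idn B) \<bullet> (idn B' \<parallel> (p \<bullet> i) \<parallel> idn B) \<bullet> (idn B' \<parallel> idn A' \<parallel> q)"
    using assms by (simp add: interchange)
  also have "(idn (cod j) \<parallel> b) \<bullet> (\<dots> \<bullet> (d \<parallel> idn (dom q)))
      = ((idn (cod j) \<parallel> b) \<bullet> (j \<parallel> idn A \<parallel> idn B)) \<bullet> (idn B' \<parallel> (p \<bullet> i) \<parallel> idn B)
        \<bullet> ((idn B' \<parallel> idn A' \<parallel> q) \<bullet> (d \<parallel> idn (dom q)))"
    by simp
  also have "(idn B' \<parallel> idn A' \<parallel> q) \<bullet> (d \<parallel> idn (dom q)) = (d \<parallel> idn B) \<bullet> q"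
    using assms tens_decomp[of d q] by (simp add: id_tens)
  also have "(idn (cod j) \<parallel> b) \<bullet> (j \<parallel> idn A \<parallel> idn B) = j \<bullet> (idn B' \<parallel> b)"
    using assms tens_decomp[of j b] by (simp add: id_tens)
  finally show ?thesis
    by simp
qed

lemma pairing_transport:
  assumes P: "pairing A B \<beta> d"
    and u: "arr u" "dom u = A'" "cod u = A" "arr u'" "dom u' = A" "cod u' = A'" "u' \<bullet> u = idn A'" "u \<bullet> u' = idn A"
    and v: "arr v" "dom v = B'" "cod v = B" "arr v'" "dom v' = B" "cod v' = B'" "v' \<bullet> v = idn B'" "v \<bullet> v' = idn B"
  shows "pairing A' B' (\<beta> \<bullet> (u \<parallel> v)) ((v' \<parallel> u') \<bullet> d)"
proof -
  note [simp] = pairingD[OF P] u v pairingD(9,10)[OF P, THEN comp_reduce]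
  have o: "A' \<in> obj C" "B' \<in> obj C"
    using arr_obj[OF u(1)] arr_obj[OF v(1)] by simp_all
  have "((\<beta> \<bullet> (u \<parallel> v)) \<parallel> idn A') \<bullet> (idn A' \<parallel> ((v' \<parallel> u') \<bullet> d)) = idn A'"
    using zigzag_left[of A B A B \<beta> d u v u' v'] by (simp add: id_tens[symmetric] o del: comp_assoc)
  moreover have "(idn B' \<parallel> (\<beta> \<bullet> (u \<parallel> v))) \<bullet> (((v' \<parallel> u') \<bullet> d) \<parallel> idn B') = idn B'"
    using zigzag_right[of A B A B \<beta> d u v u' v'] by (simp add: id_tens[symmetric] o del: comp_assoc)
  ultimately show ?thesis
    by (simp add: pairing_def o)
qed

text \<open>A biproduct diagram on an arbitrary object \<open>X\<close>. Tensor products with a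
  fixed object and regrouped sums decompose in this way without having the form
  \<open>A \<boxplus> B\<close>.\<close>

definition bip :: "'o \<Rightarrow> 'o \<Rightarrow> 'o \<Rightarrow> ('o, 'm) arrow \<Rightarrow> ('o, 'm) arrow \<Rightarrow> ('o, 'm) arrow \<Rightarrow> ('o, 'm) arrow \<Rightarrow> bool"
  where "bip X A B i j p q \<longleftrightarrow> X \<in> obj C \<and> A \<in> obj C \<and> B \<in> obj C
    \<and> arr i \<and> dom i = A \<and> cod i = X \<and> arr j \<and> dom j = B \<and> cod j = X
    \<and> arr p \<and> dom p = X \<and> cod p = A \<and> arr q \<and> dom q = X \<and> cod q = B
    \<and> p \<bullet> i = idn A \<and> q \<bullet> j = idn B \<and> p \<bullet> j = zr B A \<and> q \<bullet> i = zr A B \<and> i \<bullet> p \<uplus> j \<bullet> q = idn X"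

lemma bipD:
  assumes "bip X A B i j p q"
  shows "X \<in> obj C" "A \<in> obj C" "B \<in> obj C" "arr i" "dom i = A" "cod i = X" "arr j" "dom j = B" "cod j = X"
    "arr p" "dom p = X" "cod p = A" "arr q" "dom q = X" "cod q = B"
    "p \<bullet> i = idn A" "q \<bullet> j = idn B" "p \<bullet> j = zr B A" "q \<bullet> i = zr A B" "i \<bullet> p \<uplus> j \<bullet> q = idn X"
  using assms by (simp_all add: bip_def)

lemma bip_dsum: "A \<in> obj C \<Longrightarrow> B \<in> obj C \<Longrightarrow> bip (A \<boxplus> B) A B (i1 A B) (i2 A B) (p1 A B) (p2 A B)"
  by (simp add: bip_def biproduct)

lemma bip_swap: "bip X A B i j p q \<Longrightarrow> bip X B A j i q p"
  by (simp add: bip_def plus_comm[of "j \<bullet> q"])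

text \<open>Each triangle expands into four zigzags. The mixed ones contain
  \<open>q \<bullet> j'\<close>, \<open>q' \<bullet> j\<close>, \<open>p \<bullet> i'\<close> or
  \<open>p' \<bullet> i\<close> and vanish; the other two add up to the decomposition of the
  identity.\<close>

lemma pairing_sum:
  assumes X: "bip X A A' i i' p p'" and Y: "bip Y B B' j j' q q'"
    and P: "pairing A B \<beta> d" and P': "pairing A' B' \<beta>' d'"
  shows "pairing X Y (\<beta> \<bullet> (p \<parallel> q) \<uplus> \<beta>' \<bullet> (p' \<parallel> q')) ((j \<parallel> i) \<bullet> d \<uplus> (j' \<parallel> i') \<bullet> d')"
proof -
  note [simp] = pairingD[OF P] pairingD[OF P'] bipD[OF X] bipD[OF Y]
    pairingD(9,10)[OF P, THEN comp_reduce] pairingD(9,10)[OF P', THEN comp_reduce]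
  note fold = id_tens[symmetric]
  have "((\<beta> \<bullet> (p \<parallel> q) \<uplus> \<beta>' \<bullet> (p' \<parallel> q')) \<parallel> idn X) \<bullet> (idn X \<parallel> ((j \<parallel> i) \<bullet> d \<uplus> (j' \<parallel> i') \<bullet> d')) = i \<bullet> p \<uplus> i' \<bullet> p'"
    using zigzag_left[of A B A B \<beta> d p q i j] zigzag_left[of A' B' A' B' \<beta>' d' p' q' i' j']
      zigzag_left[of A B A' B' \<beta> d' p q i' j'] zigzag_left[of A' B' A B \<beta>' d p' q' i j]
    by (simp add: tens_plus_left tens_plus_right comp_plus_left comp_plus_right fold del: comp_assoc)
  moreover have "(idn Y \<parallel> (\<beta> \<bullet> (p \<parallel> q) \<uplus> \<beta>' \<bullet> (p' \<parallel> q'))) \<bullet> (((j \<parallel> i) \<bullet> d \<uplus> (j' \<parallel> i') \<bullet> d') \<parallel> idn Y) = j \<bullet> q \<uplus> j' \<bullet> q'"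
    using zigzag_right[of A B A B \<beta> d p q i j] zigzag_right[of A' B' A' B' \<beta>' d' p' q' i' j']
      zigzag_right[of A B A' B' \<beta> d' p q i' j'] zigzag_right[of A' B' A B \<beta>' d p' q' i j]
    by (simp add: tens_plus_left tens_plus_right comp_plus_left comp_plus_right fold del: comp_assoc)
  ultimately show ?thesis
    by (simp add: pairing_def)
qed

text \<open>A strand \<open>M\<close> lying between the two inputs of \<open>b\<close> may leave on
  either side. This is naturality of the symmetry at \<open>b\<close>, together with the triviality
  of the braiding with \<open>I\<close>.\<close>

lemma br_exchange:
  assumes "A \<in> obj C" "B \<in> obj C" "M \<in> obj C" "arr b" "dom b = A \<boxtimes> B" "cod b = I"
  shows "(idn M \<parallel> b) \<bullet> (br A M \<parallel> idn B) = (b \<parallel> idn M) \<bullet> (idn A \<parallel> br M B)"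
proof -
  have "(b \<parallel> idn M) \<bullet> (idn A \<parallel> br M B)
      = (br I M \<bullet> (b \<parallel> idn M)) \<bullet> (idn A \<parallel> br M B)"
    using assms by simp
  also have "br I M \<bullet> (b \<parallel> idn M) = (idn M \<parallel> b) \<bullet> (br A M \<parallel> idn B) \<bullet> (idn A \<parallel> br B M)"
    using br_natural[of b "idn M"] assms by (simp add: hexagon_left)
  also have "\<dots> \<bullet> (idn A \<parallel> br M B) = (idn M \<parallel> b) \<bullet> (br A M \<parallel> idn B)"
    using assms by (simp add: interchange br_br) (simp add: id_tens[symmetric])
  finally show ?thesis
    by simp
qed

text \<open>The second object is \<open>B' \<boxtimes> B\<close>, in reversed order, so that one
  duality sits inside the other and no braiding is involved.\<close>

lemma pairing_nested:
  assumes P: "pairing A B \<beta> d" and P': "pairing A' B' \<beta>' d'"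
  shows "pairing (A \<boxtimes> A') (B' \<boxtimes> B) (\<beta> \<bullet> (idn A \<parallel> \<beta>' \<parallel> idn B)) ((idn B' \<parallel> d \<parallel> idn A') \<bullet> d')"
proof -
  note [simp] = pairingD[OF P] pairingD[OF P']
  have "((\<beta> \<bullet> (idn A \<parallel> \<beta>' \<parallel> idn B)) \<parallel> idn (A \<boxtimes> A')) \<bullet> (idn (A \<boxtimes> A') \<parallel> ((idn B' \<parallel> d \<parallel> idn A') \<bullet> d'))
      = (\<beta> \<parallel> idn A \<parallel> idn A')
        \<bullet> ((idn A \<parallel> \<beta>' \<parallel> idn B \<parallel> idn A \<parallel> idn A') \<bullet> (idn A \<parallel> idn A' \<parallel> idn B' \<parallel> d \<parallel> idn A'))
        \<bullet> (idn A \<parallel> idn A' \<parallel> d')"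
    by (simp add: tens_comp_right) (simp add: id_tens tens_comp_right)
  \<comment> \<open>\<open>\<beta>'\<close> and \<open>d\<close> act on disjoint strands. Carrying
    them out in the opposite order separates the zigzag into one for \<open>\<beta>\<close> and one
    for \<open>\<beta>'\<close>.\<close>
  also have "(idn A \<parallel> \<beta>' \<parallel> idn B \<parallel> idn A \<parallel> idn A') \<bullet> (idn A \<parallel> idn A' \<parallel> idn B' \<parallel> d \<parallel> idn A')
      = idn A \<parallel> (\<beta>' \<parallel> d) \<parallel> idn A'"
    using tens_decomp(1)[of \<beta>' d] interchange[of "\<beta>' \<parallel> idn (B \<boxtimes> A)" "idn (A' \<boxtimes> B') \<parallel> d" "idn A'" "idn A'"]
    by (simp add: interchange[of "idn A" "idn A"] id_tens)
  also have "\<dots> = (idn A \<parallel> d \<parallel> idn A') \<bullet> (idn A \<parallel> \<beta>' \<parallel> idn A')"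
    using tens_decomp(2)[of \<beta>' d] by (simp add: interchange)
  also have "(\<beta> \<parallel> idn A \<parallel> idn A') \<bullet> (\<dots> \<bullet> (idn A \<parallel> idn A' \<parallel> d'))
      = ((\<beta> \<parallel> idn A \<parallel> idn A') \<bullet> (idn A \<parallel> d \<parallel> idn A')) \<bullet> ((idn A \<parallel> \<beta>' \<parallel> idn A') \<bullet> (idn A \<parallel> idn A' \<parallel> d'))"
    by simp
  also have "(\<beta> \<parallel> idn A \<parallel> idn A') \<bullet> (idn A \<parallel> d \<parallel> idn A') = idn A \<parallel> idn A'"
    using interchange[of "\<beta> \<parallel> idn A" "idn A \<parallel> d" "idn A'" "idn A'"] by simp
  also have "(idn A \<parallel> \<beta>' \<parallel> idn A') \<bullet> (idn A \<parallel> idn A' \<parallel> d') = idn A \<parallel> idn A'"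
    by (simp add: interchange)
  finally have 1: "((\<beta> \<bullet> (idn A \<parallel> \<beta>' \<parallel> idn B)) \<parallel> idn (A \<boxtimes> A')) \<bullet> (idn (A \<boxtimes> A') \<parallel> ((idn B' \<parallel> d \<parallel> idn A') \<bullet> d'))
      = idn (A \<boxtimes> A')"
    by (simp add: id_tens[symmetric])
  have "(idn (B' \<boxtimes> B) \<parallel> (\<beta> \<bullet> (idn A \<parallel> \<beta>' \<parallel> idn B))) \<bullet> (((idn B' \<parallel> d \<parallel> idn A') \<bullet> d') \<parallel> idn (B' \<boxtimes> B))
      = (idn B' \<parallel> idn B \<parallel> \<beta>)
        \<bullet> ((idn B' \<parallel> idn B \<parallel> idn A \<parallel> \<beta>' \<parallel> idn B) \<bullet> (idn B' \<parallel> d \<parallel> idn A' \<parallel> idn B' \<parallel> idn B))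
        \<bullet> (d' \<parallel> idn B' \<parallel> idn B)"
    by (simp add: tens_comp_right) (simp add: id_tens tens_comp_right)
  also have "(idn B' \<parallel> idn B \<parallel> idn A \<parallel> \<beta>' \<parallel> idn B) \<bullet> (idn B' \<parallel> d \<parallel> idn A' \<parallel> idn B' \<parallel> idn B)
      = idn B' \<parallel> (d \<parallel> \<beta>') \<parallel> idn B"
    using tens_decomp(2)[of d \<beta>'] interchange[of "idn (B \<boxtimes> A) \<parallel> \<beta>'" "d \<parallel> idn (A' \<boxtimes> B')" "idn B" "idn B"]
    by (simp add: interchange[of "idn B'" "idn B'"] id_tens)
  also have "\<dots> = (idn B' \<parallel> d \<parallel> idn B) \<bullet> (idn B' \<parallel> \<beta>' \<parallel> idn B)"
    using tens_decomp(1)[of d \<beta>'] by (simp add: interchange)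
  also have "(idn B' \<parallel> idn B \<parallel> \<beta>) \<bullet> (\<dots> \<bullet> (d' \<parallel> idn B' \<parallel> idn B))
      = ((idn B' \<parallel> idn B \<parallel> \<beta>) \<bullet> (idn B' \<parallel> d \<parallel> idn B)) \<bullet> ((idn B' \<parallel> \<beta>' \<parallel> idn B) \<bullet> (d' \<parallel> idn B' \<parallel> idn B))"
    by simp
  also have "(idn B' \<parallel> \<beta>' \<parallel> idn B) \<bullet> (d' \<parallel> idn B' \<parallel> idn B) = idn B' \<parallel> idn B"
    using interchange[of "idn B' \<parallel> \<beta>'" "d' \<parallel> idn B'" "idn B" "idn B"] by simp
  also have "(idn B' \<parallel> idn B \<parallel> \<beta>) \<bullet> (idn B' \<parallel> d \<parallel> idn B) = idn B' \<parallel> idn B"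
    by (simp add: interchange)
  finally have "(idn (B' \<boxtimes> B) \<parallel> (\<beta> \<bullet> (idn A \<parallel> \<beta>' \<parallel> idn B))) \<bullet> (((idn B' \<parallel> d \<parallel> idn A') \<bullet> d') \<parallel> idn (B' \<boxtimes> B))
      = idn (B' \<boxtimes> B)"
    by (simp add: id_tens[symmetric])
  with 1 show ?thesis
    by (simp add: pairing_def)
qed

text \<open>The product of forms from \<open>tensor_form\<close>, generalised to forms on two
  different objects; the evaluation \<open>evl M\<close> multiplied by a form is of this
  kind.\<close>

definition tpair :: "'o \<Rightarrow> 'o \<Rightarrow> 'o \<Rightarrow> 'o \<Rightarrow> ('o, 'm) arrow \<Rightarrow> ('o, 'm) arrow \<Rightarrow> ('o, 'm) arrow"
  where "tpair A B A' B' \<beta> \<beta>' = (\<beta> \<parallel> \<beta>') \<bullet> (idn A \<parallel> br A' B \<parallel> idn B')"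

text \<open>By \<open>br_exchange\<close> the strand \<open>B\<close> can pass
  \<open>\<beta>'\<close> on its other side. Up to the isomorphism \<open>br B B'\<close> the
  product is thus the nested pairing, which yields its copairing.\<close>

lemma tpair_nested:
  assumes "A \<in> obj C" "B \<in> obj C" "A' \<in> obj C" "B' \<in> obj C" "arr \<beta>" "dom \<beta> = A \<boxtimes> B" "cod \<beta> = I"
    "arr \<beta>'" "dom \<beta>' = A' \<boxtimes> B'" "cod \<beta>' = I"
  shows "tpair A B A' B' \<beta> \<beta>' = (\<beta> \<bullet> (idn A \<parallel> \<beta>' \<parallel> idn B)) \<bullet> (idn (A \<boxtimes> A') \<parallel> br B B')"
proof -
  have "tpair A B A' B' \<beta> \<beta>' = \<beta> \<bullet> ((idn A \<parallel> idn B \<parallel> \<beta>') \<bullet> (idn A \<parallel> br A' B \<parallel> idn B'))"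
    using assms tens_decomp(1)[of \<beta> \<beta>', symmetric] by (simp add: tpair_def id_tens)
  also have "(idn A \<parallel> idn B \<parallel> \<beta>') \<bullet> (idn A \<parallel> br A' B \<parallel> idn B') = idn A \<parallel> ((idn B \<parallel> \<beta>') \<bullet> (br A' B \<parallel> idn B'))"
    using assms by (simp add: interchange)
  also have "(idn B \<parallel> \<beta>') \<bullet> (br A' B \<parallel> idn B') = (\<beta>' \<parallel> idn B) \<bullet> (idn A' \<parallel> br B B')"
    using assms by (simp add: br_exchange)
  also have "idn A \<parallel> \<dots> = (idn A \<parallel> \<beta>' \<parallel> idn B) \<bullet> (idn A \<parallel> idn A' \<parallel> br B B')"
    using assms by (simp add: tens_comp_right)
  finally show ?thesis
    using assms by (simp add: id_tens)
qed

lemma pairing_tpair: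
  assumes P: "pairing A B \<beta> d" and P': "pairing A' B' \<beta>' d'"
  shows "\<exists>d''. pairing (A \<boxtimes> A') (B \<boxtimes> B') (tpair A B A' B' \<beta> \<beta>') d''"
proof -
  note [simp] = pairingD[OF P] pairingD[OF P']
  show ?thesis
    using pairing_transport[OF pairing_nested[OF P P'], of "idn (A \<boxtimes> A')" "A \<boxtimes> A'" "idn (A \<boxtimes> A')"
        "br B B'" "B \<boxtimes> B'" "br B' B"]
    by (intro exI) (simp add: tpair_nested br_br id_tens[symmetric])
qed

text \<open>The hexagons split the symmetry of the two products into four crossings, and the last of
  them is undone by the crossing inside \<open>tpair\<close>. This gives the symmetry of a product
  of symmetric forms and the mirrored block of a hyperbolic form times a form.\<close>

lemma tpair_br:
  assumes "A \<in> obj C" "B \<in> obj C" "A' \<in> obj C" "B' \<in> obj C" "arr \<beta>" "dom \<beta> = A \<boxtimes> B" "cod \<beta> = I"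
    "arr \<beta>'" "dom \<beta>' = A' \<boxtimes> B'" "cod \<beta>' = I"
  shows "tpair A B A' B' \<beta> \<beta>' \<bullet> br (B \<boxtimes> B') (A \<boxtimes> A') = tpair B A B' A' (\<beta> \<bullet> br B A) (\<beta>' \<bullet> br B' A')"
proof -
  have "br (B \<boxtimes> B') (A \<boxtimes> A') = (idn A \<parallel> br (B \<boxtimes> B') A') \<bullet> (br (B \<boxtimes> B') A \<parallel> idn A')"
    using assms by (simp add: hexagon_right)
  also have "\<dots> = (idn A \<parallel> br B A' \<parallel> idn B')
      \<bullet> ((idn A \<parallel> idn B \<parallel> br B' A') \<bullet> (br B A \<parallel> idn B' \<parallel> idn A')) \<bullet> (idn B \<parallel> br B' A \<parallel> idn A')"
    using assms by (simp add: hexagon_left tens_comp_right)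
  also have "(idn A \<parallel> idn B \<parallel> br B' A') \<bullet> (br B A \<parallel> idn B' \<parallel> idn A') = br B A \<parallel> br B' A'"
    using assms tens_decomp(2)[of "br B A" "br B' A'"] by (simp add: id_tens)
  finally have br: "br (B \<boxtimes> B') (A \<boxtimes> A') = (idn A \<parallel> br B A' \<parallel> idn B')
      \<bullet> (br B A \<parallel> br B' A') \<bullet> (idn B \<parallel> br B' A \<parallel> idn A')" .
  have "(idn A \<parallel> br A' B \<parallel> idn B') \<bullet> (idn A \<parallel> br B A' \<parallel> idn B') = idn (A \<boxtimes> B \<boxtimes> A' \<boxtimes> B')"
    using assms by (simp add: interchange br_br id_tens)
  then show ?thesis
    using assms comp_reduce[of "idn A \<parallel> br A' B \<parallel> idn B'" "idn A \<parallel> br B A' \<parallel> idn B'"]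
    by (simp add: tpair_def br interchange[symmetric])
qed

lemma tpair_natural:
  assumes "arr f" "arr g" "arr f'" "arr g'"
    "arr \<beta>" "dom \<beta> = cod f \<boxtimes> cod g" "cod \<beta> = I" "arr \<beta>'" "dom \<beta>' = cod f' \<boxtimes> cod g'" "cod \<beta>' = I"
  shows "tpair (cod f) (cod g) (cod f') (cod g') \<beta> \<beta>' \<bullet> ((f \<parallel> f') \<parallel> (g \<parallel> g'))
    = tpair (dom f) (dom g) (dom f') (dom g') (\<beta> \<bullet> (f \<parallel> g)) (\<beta>' \<bullet> (f' \<parallel> g'))"
proof -
  have "(idn (cod f) \<parallel> br (cod f') (cod g) \<parallel> idn (cod g')) \<bullet> (f \<parallel> (f' \<parallel> g) \<parallel> g')
      = f \<parallel> ((g \<parallel> f') \<bullet> br (dom f') (dom g)) \<parallel> g'"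
    using assms br_natural[of f' g] by (simp add: interchange del: tens_assoc)
  also have "\<dots> = ((f \<parallel> g) \<parallel> (f' \<parallel> g')) \<bullet> (idn (dom f) \<parallel> br (dom f') (dom g) \<parallel> idn (dom g'))"
    using assms interchange[of f "idn (dom f)" "(g \<parallel> f') \<parallel> g'" "br (dom f') (dom g) \<parallel> idn (dom g')"]
      interchange[of "g \<parallel> f'" "br (dom f') (dom g)" g' "idn (dom g')"] by simp
  finally show ?thesis
    using assms interchange[of \<beta> "f \<parallel> g" \<beta>' "f' \<parallel> g'", symmetric] by (simp add: tpair_def)
qed

text \<open>In a symmetric category a left dual is also a right dual.\<close>

lemma pairing_swap:
  assumes P: "pairing A B \<beta> d"
  shows "pairing B A (\<beta> \<bullet> br B A) (br B A \<bullet> d)"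
proof -
  note [simp] = pairingD[OF P]
  \<comment> \<open>Inserting crossings of the two copies of \<open>B\<close> is harmless by
    naturality. It places \<open>idn A \<parallel> br B B\<close> next to \<open>\<beta>\<close>,
    the configuration that \<open>br_exchange\<close> resolves.\<close>
  have nat: "br (B \<boxtimes> B) A = (idn A \<parallel> br B B) \<bullet> br (B \<boxtimes> B) A \<bullet> (br B B \<parallel> idn A)"
    using br_natural[of "br B B" "idn A"] by (simp add: interchange br_br comp_assoc[symmetric] del: comp_assoc)
      (simp add: id_tens[symmetric] br_br comp_assoc[symmetric] interchange del: comp_assoc)
  have nat': "br B (A \<boxtimes> A) = (br A A \<parallel> idn B) \<bullet> br B (A \<boxtimes> A) \<bullet> (idn B \<parallel> br A A)"
    using br_natural[of "idn B" "br A A"] by (simp add: id_tens[symmetric] br_br comp_assoc[symmetric] interchange del: comp_assoc)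
  have "((\<beta> \<bullet> br B A) \<parallel> idn B) \<bullet> (idn B \<parallel> (br B A \<bullet> d))
      = (\<beta> \<parallel> idn B) \<bullet> br (B \<boxtimes> B) A \<bullet> (idn B \<parallel> d)"
    by (simp add: hexagon_left tens_comp_right)
  also have "\<dots> = (\<beta> \<parallel> idn B) \<bullet> (idn A \<parallel> br B B) \<bullet> br (B \<boxtimes> B) A \<bullet> (br B B \<parallel> idn A) \<bullet> (idn B \<parallel> d)"
    by (subst nat) simp
  also have "\<dots> = (idn B \<parallel> \<beta>) \<bullet> ((br A B \<parallel> idn B) \<bullet> (br B A \<parallel> idn B)) \<bullet> ((idn B \<parallel> br B A) \<bullet> (br B B \<parallel> idn A)) \<bullet> (idn B \<parallel> d)"
    using br_exchange[of A B B \<beta>, THEN comp_reduce] by (simp add: hexagon_left)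
  also have "(br A B \<parallel> idn B) \<bullet> (br B A \<parallel> idn B) = idn (B \<boxtimes> A \<boxtimes> B)"
    by (simp add: interchange br_br id_tens)
  also have "(idn B \<parallel> br B A) \<bullet> (br B B \<parallel> idn A) = br B (B \<boxtimes> A)"
    by (simp add: hexagon_right)
  also have "(idn B \<parallel> \<beta>) \<bullet> (idn (B \<boxtimes> A \<boxtimes> B) \<bullet> (br B (B \<boxtimes> A) \<bullet> (idn B \<parallel> d))) = idn B"
    using br_natural[of "idn B" d] by simp
  finally have 1: "((\<beta> \<bullet> br B A) \<parallel> idn B) \<bullet> (idn B \<parallel> (br B A \<bullet> d)) = idn B" .
  have "(idn A \<parallel> (\<beta> \<bullet> br B A)) \<bullet> ((br B A \<bullet> d) \<parallel> idn A)
      = (idn A \<parallel> \<beta>) \<bullet> br B (A \<boxtimes> A) \<bullet> (d \<parallel> idn A)"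
    by (simp add: hexagon_right tens_comp_right)
  also have "\<dots> = (idn A \<parallel> \<beta>) \<bullet> (br A A \<parallel> idn B) \<bullet> br B (A \<boxtimes> A) \<bullet> (idn B \<parallel> br A A) \<bullet> (d \<parallel> idn A)"
    by (subst nat') simp
  also have "\<dots> = (\<beta> \<parallel> idn A) \<bullet> ((idn A \<parallel> br A B) \<bullet> (idn A \<parallel> br B A)) \<bullet> ((br B A \<parallel> idn A) \<bullet> (idn B \<parallel> br A A)) \<bullet> (d \<parallel> idn A)"
    using br_exchange[of A B A \<beta>, THEN comp_reduce] by (simp add: hexagon_right)
  also have "(idn A \<parallel> br A B) \<bullet> (idn A \<parallel> br B A) = idn (A \<boxtimes> B \<boxtimes> A)"
    by (simp add: interchange br_br id_tens)
  also have "(br B A \<parallel> idn A) \<bullet> (idn B \<parallel> br A A) = br (B \<boxtimes> A) A"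
    by (simp add: hexagon_left)
  also have "(\<beta> \<parallel> idn A) \<bullet> (idn (A \<boxtimes> B \<boxtimes> A) \<bullet> (br (B \<boxtimes> A) A \<bullet> (d \<parallel> idn A))) = idn A"
    using br_natural[of d "idn A"] by simp
  finally have 2: "(idn A \<parallel> (\<beta> \<bullet> br B A)) \<bullet> ((br B A \<bullet> d) \<parallel> idn A) = idn A" .
  show ?thesis
    unfolding pairing_def using 1 2 by simp
qed

section \<open>Isometries of quadratic objects\<close>

lemmas plus_distribs = comp_plus_left comp_plus_right tens_plus_left tens_plus_right

section \<open>Biproduct diagrams\<close>

lemma bip_reduce:
  assumes "bip X A B i j p q"
  shows "arr f \<Longrightarrow> cod f = A \<Longrightarrow> p \<bullet> (i \<bullet> f) = f" "arr f \<Longrightarrow> cod f = B \<Longrightarrow> q \<bullet> (j \<bullet> f) = f"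
    "arr f \<Longrightarrow> cod f = B \<Longrightarrow> p \<bullet> (j \<bullet> f) = zr (dom f) A" "arr f \<Longrightarrow> cod f = A \<Longrightarrow> q \<bullet> (i \<bullet> f) = zr (dom f) B"
  using bipD[OF assms] comp_reduce[of p i] comp_reduce[of q j] comp_reduce[of p j] comp_reduce[of q i]
  by simp_all

text \<open>Compatibility with the projections is kept in the conclusion because forms on sums are
  written through projections; it turns the isomorphism into an isometry.\<close>

lemma bip_unique:
  assumes X: "bip X A B i j p q" and X': "bip X' A B i' j' p' q'"
  obtains f g where "arr f" "dom f = X" "cod f = X'" "arr g" "dom g = X'" "cod g = X"
    "g \<bullet> f = idn X" "f \<bullet> g = idn X'" "p' \<bullet> f = p" "q' \<bullet> f = q"
proof -
  note [simp] = bipD[OF X] bipD[OF X'] bip_reduce[OF X'] bip_reduce[OF X]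
  show thesis
    by (rule that[of "i' \<bullet> p \<uplus> j' \<bullet> q" "i \<bullet> p' \<uplus> j \<bullet> q'"]) (simp_all add: plus_distribs)
qed

lemma bip_iso:
  assumes X: "bip X A B i j p q"
    and u: "arr u" "dom u = A" "cod u = A'" "arr u'" "dom u' = A'" "cod u' = A" "u' \<bullet> u = idn A" "u \<bullet> u' = idn A'"
    and v: "arr v" "dom v = B" "cod v = B'" "arr v'" "dom v' = B'" "cod v' = B" "v' \<bullet> v = idn B" "v \<bullet> v' = idn B'"
  shows "bip X A' B' (i \<bullet> u') (j \<bullet> v') (u \<bullet> p) (v \<bullet> q)"
proof -
  note [simp] = bipD[OF X] bip_reduce[OF X] u v u(7)[THEN comp_reduce] v(7)[THEN comp_reduce]
  have "A' \<in> obj C" "B' \<in> obj C"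
    using arr_obj(2)[OF u(1)] arr_obj(2)[OF v(1)] by simp_all
  then show ?thesis
    by (simp add: bip_def)
qed

lemma bip_tens:
  assumes X: "bip X A B i j p q" and K: "K \<in> obj C"
  shows "bip (X \<boxtimes> K) (A \<boxtimes> K) (B \<boxtimes> K) (i \<parallel> idn K) (j \<parallel> idn K) (p \<parallel> idn K) (q \<parallel> idn K)"
proof -
  note [simp] = bipD[OF X] K
  show ?thesis
    by (simp add: bip_def interchange tens_plus_left[symmetric] id_tens)
qed

text \<open>Regroups (A + B) + W as A + (B + W). The identity of \<open>X\<close> is decomposed by
  refining \<open>i \<bullet> p\<close> through the decomposition of \<open>S\<close>.\<close>

lemma bip_assoc:
  assumes X: "bip X S W i j p q" and S: "bip S A B i' j' p' q'"
  shows "bip X A (B \<boxplus> W) (i \<bullet> i') (i \<bullet> j' \<bullet> p1 B W \<uplus> j \<bullet> p2 B W) (p' \<bullet> p) (i1 B W \<bullet> q' \<bullet> p \<uplus> i2 B W \<bullet> q)"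
proof -
  have BW: "bip (B \<boxplus> W) B W (i1 B W) (i2 B W) (p1 B W) (p2 B W)"
    using bipD[OF X] bipD[OF S] by (intro bip_dsum)
  note [simp] = bipD[OF X] bipD[OF S] bipD[OF BW] bip_reduce[OF X] bip_reduce[OF S] bip_reduce[OF BW]
  have "i \<bullet> p = i \<bullet> (i' \<bullet> p' \<uplus> j' \<bullet> q') \<bullet> p"
    by simp
  also have "\<dots> = i \<bullet> i' \<bullet> p' \<bullet> p \<uplus> i \<bullet> j' \<bullet> q' \<bullet> p"
    by (simp add: plus_distribs del: bipD(20)[OF S])
  finally have "i \<bullet> i' \<bullet> p' \<bullet> p \<uplus> (i \<bullet> j' \<bullet> q' \<bullet> p \<uplus> j \<bullet> q) = idn X"
    using bipD(20)[OF X] by (simp only: plus_assoc)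
  then show ?thesis
    by (simp add: bip_def plus_distribs)
qed

text \<open>Regroups (A + B) + (A' + B') as (A + A') + (B + B'), the rearrangement required for a
  sum of two hyperbolic objects.\<close>

lemma bip_exchange:
  assumes X: "bip X S T i j p q" and S: "bip S A B iS jS pS qS" and T: "bip T A' B' iT jT pT qT"
  shows "bip X (A \<boxplus> A') (B \<boxplus> B')
    (i \<bullet> iS \<bullet> p1 A A' \<uplus> j \<bullet> iT \<bullet> p2 A A') (i \<bullet> jS \<bullet> p1 B B' \<uplus> j \<bullet> jT \<bullet> p2 B B')
    (i1 A A' \<bullet> pS \<bullet> p \<uplus> i2 A A' \<bullet> pT \<bullet> q) (i1 B B' \<bullet> qS \<bullet> p \<uplus> i2 B B' \<bullet> qT \<bullet> q)"
proof -
  have AA: "bip (A \<boxplus> A') A A' (i1 A A') (i2 A A') (p1 A A') (p2 A A')"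
    and BB: "bip (B \<boxplus> B') B B' (i1 B B') (i2 B B') (p1 B B') (p2 B B')"
    using bipD[OF S] bipD[OF T] by (simp_all add: bip_dsum)
  note [simp] = bipD[OF X] bipD[OF S] bipD[OF T] bipD[OF AA] bipD[OF BB]
    bip_reduce[OF X] bip_reduce[OF S] bip_reduce[OF T] bip_reduce[OF AA] bip_reduce[OF BB]
  have "i \<bullet> p = i \<bullet> (iS \<bullet> pS \<uplus> jS \<bullet> qS) \<bullet> p" "j \<bullet> q = j \<bullet> (iT \<bullet> pT \<uplus> jT \<bullet> qT) \<bullet> q"
    by simp_all
  then have "i \<bullet> p = i \<bullet> iS \<bullet> pS \<bullet> p \<uplus> i \<bullet> jS \<bullet> qS \<bullet> p" "j \<bullet> q = j \<bullet> iT \<bullet> pT \<bullet> q \<uplus> j \<bullet> jT \<bullet> qT \<bullet> q"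
    by (simp_all add: plus_distribs del: bipD(20)[OF S] bipD(20)[OF T])
  then have "(i \<bullet> iS \<bullet> pS \<bullet> p \<uplus> i \<bullet> jS \<bullet> qS \<bullet> p) \<uplus> (j \<bullet> iT \<bullet> pT \<bullet> q \<uplus> j \<bullet> jT \<bullet> qT \<bullet> q) = idn X"
    using bipD(20)[OF X] by simp
  then have "(i \<bullet> iS \<bullet> pS \<bullet> p \<uplus> j \<bullet> iT \<bullet> pT \<bullet> q) \<uplus> (i \<bullet> jS \<bullet> qS \<bullet> p \<uplus> j \<bullet> jT \<bullet> qT \<bullet> q) = idn X"
    using plus_comm[of "i \<bullet> jS \<bullet> qS \<bullet> p" "j \<bullet> iT \<bullet> pT \<bullet> q"]
    by (simp add: plus_assoc) (simp add: plus_assoc[symmetric])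
  then show ?thesis
    by (simp add: bip_def plus_distribs)
qed

section \<open>Typed quadratic objects, and recognition of orthogonal sums and hyperbolic
  objects\<close>

definition qform :: "'o \<times> ('o, 'm) arrow \<Rightarrow> bool"
  where "qform x \<longleftrightarrow> snd x \<bullet> br (fst x) (fst x) = snd x \<and> (\<exists>d. pairing (fst x) (fst x) (snd x) d)"

definition isom :: "'o \<times> ('o, 'm) arrow \<Rightarrow> 'o \<times> ('o, 'm) arrow \<Rightarrow> bool"
  where "isom x y \<longleftrightarrow> (\<exists>f g. arr f \<and> dom f = fst x \<and> cod f = fst y \<and> arr g \<and> dom g = fst y \<and> cod g = fst x
    \<and> g \<bullet> f = idn (fst x) \<and> f \<bullet> g = idn (fst y) \<and> snd y \<bullet> (f \<parallel> f) = snd x)"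

definition qsum :: "'o \<times> ('o, 'm) arrow \<Rightarrow> 'o \<times> ('o, 'm) arrow \<Rightarrow> 'o \<times> ('o, 'm) arrow"
  where "qsum x y = (fst x \<boxplus> fst y, snd x \<bullet> (p1 (fst x) (fst y) \<parallel> p1 (fst x) (fst y))
    \<uplus> snd y \<bullet> (p2 (fst x) (fst y) \<parallel> p2 (fst x) (fst y)))"

definition qten :: "'o \<times> ('o, 'm) arrow \<Rightarrow> 'o \<times> ('o, 'm) arrow \<Rightarrow> 'o \<times> ('o, 'm) arrow"
  where "qten x y = (fst x \<boxtimes> fst y, tpair (fst x) (fst x) (fst y) (fst y) (snd x) (snd y))"

definition hyp :: "'o \<Rightarrow> 'o \<times> ('o, 'm) arrow"
  where "hyp M = (M \<boxplus> dl M, evl M \<bullet> (p2 M (dl M) \<parallel> p1 M (dl M))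
    \<uplus> evl M \<bullet> br M (dl M) \<bullet> (p1 M (dl M) \<parallel> p2 M (dl M)))"

lemma qformD:
  assumes "qform x"
  shows "fst x \<in> obj C" "arr (snd x)" "dom (snd x) = fst x \<boxtimes> fst x" "cod (snd x) = I"
    "snd x \<bullet> br (fst x) (fst x) = snd x"
  using assms by (auto simp: qform_def dest: pairingD)

lemma isomI:
  assumes "arr f" "dom f = X" "cod f = Y" "arr g" "dom g = Y" "cod g = X" "g \<bullet> f = idn X" "f \<bullet> g = idn Y"
    "c \<bullet> (f \<parallel> f) = b"
  shows "isom (X, b) (Y, c)"
  unfolding isom_def using assms by (intro exI[of _ f] exI[of _ g]) simp

lemma isom_refl: "qform x \<Longrightarrow> isom x x"
  using qformD[of x] by (cases x) (auto intro!: isomI[of "idn (fst x)" _ _ "idn (fst x)"] simp: id_tens[symmetric])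

lemma isom_sym:
  assumes "isom x y" "qform y"
  shows "isom y x"
proof -
  from assms(1) obtain f g where fg: "arr f" "dom f = fst x" "cod f = fst y" "arr g" "dom g = fst y" "cod g = fst x"
    "g \<bullet> f = idn (fst x)" "f \<bullet> g = idn (fst y)" "snd y \<bullet> (f \<parallel> f) = snd x"
    by (auto simp: isom_def)
  have "snd x \<bullet> (g \<parallel> g) = snd y"
    using fg qformD[OF assms(2)] by (simp add: fg(9)[symmetric] interchange del: fg(9)) (simp add: id_tens[symmetric])
  with fg show ?thesis
    unfolding isom_def by blast
qed

lemma isom_trans:
  assumes "isom x y" "isom y z"
  shows "isom x z"
proof -
  from assms(1) obtain f g where fg: "arr f" "dom f = fst x" "cod f = fst y" "arr g" "dom g = fst y" "cod g = fst x"
    "g \<bullet> f = idn (fst x)" "f \<bullet> g = idn (fst y)" "snd y \<bullet> (f \<parallel> f) = snd x"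
    by (auto simp: isom_def)
  from assms(2) obtain h k where hk: "arr h" "dom h = fst y" "cod h = fst z" "arr k" "dom k = fst z" "cod k = fst y"
    "k \<bullet> h = idn (fst y)" "h \<bullet> k = idn (fst z)" "snd z \<bullet> (h \<parallel> h) = snd y"
    by (auto simp: isom_def)
  show ?thesis
    using isomI[of "h \<bullet> f" "fst x" "fst z" "g \<bullet> k" "snd z" "snd x"] fg hk
      comp_reduce[OF hk(7)] comp_reduce[OF fg(8)] comp_reduce[OF hk(9)]
    by (simp add: interchange[symmetric])
qed

text \<open>Source of the isometries between orthogonal sums: congruence, commutativity,
  associativity, the zero law and distributivity each come from a suitable biproduct diagram on the
  same object.\<close>

lemma isom_qsumI:
  assumes X: "bip X A B i j p q" and a: "arr a" "dom a = A \<boxtimes> A" "cod a = I" and b: "arr b" "dom b = B \<boxtimes> B" "cod b = I"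
  shows "isom (X, a \<bullet> (p \<parallel> p) \<uplus> b \<bullet> (q \<parallel> q)) (qsum (A, a) (B, b))"
proof -
  have S: "bip (A \<boxplus> B) A B (i1 A B) (i2 A B) (p1 A B) (p2 A B)"
    using bipD[OF X] by (intro bip_dsum)
  from bip_unique[OF X S] obtain f g where f: "arr f" "dom f = X" "cod f = A \<boxplus> B"
    "arr g" "dom g = A \<boxplus> B" "cod g = X" "g \<bullet> f = idn X" "f \<bullet> g = idn (A \<boxplus> B)"
    "p1 A B \<bullet> f = p" "p2 A B \<bullet> f = q" .
  show ?thesis
    unfolding qsum_def fst_conv snd_conv
    by (rule isomI[OF f(1-8)]) (simp add: comp_plus_left interchange f)
qed

text \<open>The transposes \<open>?\<phi>\<close> and \<open>?\<psi>\<close> are mutually inverse by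
  \<open>pairing_compare\<close>, so \<open>dl A\<close> can replace \<open>B\<close> in the
  diagram, with projection \<open>?\<phi> \<bullet> q\<close>. By \<open>pairing_adjoint\<close> the
  evaluation then restricts to \<open>\<beta>\<close>.\<close>

lemma isom_hypI:
  assumes X: "bip X A B i j p q" and P: "pairing B A \<beta> d"
  shows "isom (X, \<beta> \<bullet> (q \<parallel> p) \<uplus> \<beta> \<bullet> br A B \<bullet> (p \<parallel> q)) (hyp A)"
proof -
  have A: "A \<in> obj C" using bipD[OF X] by simp
  let ?\<phi> = "(\<beta> \<parallel> idn (dl A)) \<bullet> (idn B \<parallel> cvl A)" and ?\<psi> = "(evl A \<parallel> idn B) \<bullet> (idn (dl A) \<parallel> d)"
  note [simp] = A pairingD[OF P] bipD[OF X]
  note \<phi> = pairing_compare[OF P pairing_ev[OF A]] and \<psi> = pairing_compare[OF pairing_ev[OF A] P]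
  have ev: "evl A \<bullet> (?\<phi> \<parallel> idn A) = \<beta>"
    by (rule pairing_adjoint[OF _ _ _ _ pairing_ev[OF A]]) simp_all
  have S: "bip (A \<boxplus> dl A) A (dl A) (i1 A (dl A)) (i2 A (dl A)) (p1 A (dl A)) (p2 A (dl A))"
    by (simp add: bip_dsum)
  have ty: "arr ?\<phi>" "dom ?\<phi> = B" "cod ?\<phi> = dl A" "arr ?\<psi>" "dom ?\<psi> = dl A" "cod ?\<psi> = B"
    by simp_all
  have X': "bip X A (dl A) (i \<bullet> idn A) (j \<bullet> ?\<psi>) (idn A \<bullet> p) (?\<phi> \<bullet> q)"
    using ty \<phi> \<psi> by (intro bip_iso[OF X]) simp_all
  define f where "f = ?\<phi>"
  have f: "arr f" "dom f = B" "cod f = dl A" "evl A \<bullet> (f \<parallel> idn A) = \<beta>"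
    using ty(1-3) ev by (simp_all only: f_def)
  have X'': "bip X A (dl A) i (j \<bullet> ?\<psi>) p (f \<bullet> q)"
    using X' by (simp add: f_def)
  from bip_unique[OF X'' S] obtain h g where F: "arr h" "dom h = X" "cod h = A \<boxplus> dl A"
    "arr g" "dom g = A \<boxplus> dl A" "cod g = X" "g \<bullet> h = idn X" "h \<bullet> g = idn (A \<boxplus> dl A)"
    "p1 A (dl A) \<bullet> h = p" "p2 A (dl A) \<bullet> h = f \<bullet> q" .
  have 1: "evl A \<bullet> ((f \<bullet> q) \<parallel> p) = \<beta> \<bullet> (q \<parallel> p)"
    using f(1-3) by (simp add: f(4)[symmetric] interchange)
  \<comment> \<open>The mirrored block is the first one composed with the symmetry of
    \<open>X\<close>, so it follows from the first by naturality.\<close>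
  have "evl A \<bullet> br A (dl A) \<bullet> (p \<parallel> (f \<bullet> q)) = (evl A \<bullet> ((f \<bullet> q) \<parallel> p)) \<bullet> br X X"
    using f(1-3) br_natural[of p "f \<bullet> q"] by simp
  also have "\<dots> = \<beta> \<bullet> br A B \<bullet> (p \<parallel> q)"
    unfolding 1 using br_natural[of p q] by simp
  finally have 2: "evl A \<bullet> br A (dl A) \<bullet> (p \<parallel> (f \<bullet> q)) = \<beta> \<bullet> br A B \<bullet> (p \<parallel> q)" .
  show ?thesis
    unfolding hyp_def
    by (rule isomI[OF F(1-8)]) (simp add: comp_plus_left interchange F 1 2)
qed

lemma qformI:
  "\<lbrakk>pairing M M b d; b \<bullet> br M M = b\<rbrakk> \<Longrightarrow> qform (M, b)"
  unfolding qform_def fst_conv snd_conv by blast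

lemma qformE:
  assumes "qform x"
  obtains M b d where "x = (M, b)" "pairing M M b d" "b \<bullet> br M M = b"
  using assms by (cases x) (auto simp: qform_def)

lemma qform_qsum:
  assumes "qform x" "qform y"
  shows "qform (qsum x y)"
proof -
  from assms obtain M b d N c e where x: "x = (M, b)" "pairing M M b d" "b \<bullet> br M M = b"
    and y: "y = (N, c)" "pairing N N c e" "c \<bullet> br N N = c"
    by (elim qformE)
  note [simp] = pairingD[OF x(2)] pairingD[OF y(2)] comp_reduce[OF x(3)] comp_reduce[OF y(3)]
  have S: "bip (M \<boxplus> N) M N (i1 M N) (i2 M N) (p1 M N) (p2 M N)"
    by (simp add: bip_dsum)
  show ?thesis
    unfolding qsum_def x(1) y(1) fst_conv snd_conv
    using br_natural[of "p1 M N" "p1 M N", symmetric] br_natural[of "p2 M N" "p2 M N", symmetric]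
    by (intro qformI[OF pairing_sum[OF S S x(2) y(2)]]) (simp add: comp_plus_left)
qed

lemma qform_qten:
  assumes "qform x" "qform y"
  shows "qform (qten x y)"
proof -
  from assms obtain M b d N c e where x: "x = (M, b)" "pairing M M b d" "b \<bullet> br M M = b"
    and y: "y = (N, c)" "pairing N N c e" "c \<bullet> br N N = c"
    by (elim qformE)
  note [simp] = pairingD[OF x(2)] pairingD[OF y(2)]
  from pairing_tpair[OF x(2) y(2)] show ?thesis
    unfolding qten_def x(1) y(1) fst_conv snd_conv
    by (elim exE, intro qformI) (simp_all add: tpair_br x(3) y(3))
qed

lemma qform_unit: "qform (I, idn I)"
  by (rule qformI[of _ _ "idn I"]) (simp_all add: pairing_def)

lemma qform_zero: "qform (Z, zr (Z \<boxtimes> Z) I)"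
  by (rule qformI[of _ _ "zr I (Z \<boxtimes> Z)"]) (simp_all add: pairing_def idn_zero_obj)

text \<open>The form is a \<open>pairing_sum\<close> of \<open>evl M\<close> and its swap, where the
  same object is decomposed as \<open>dl M\<close>, \<open>M\<close> in the left argument and as
  \<open>M\<close>, \<open>dl M\<close> in the right one. The symmetry interchanges the two
  summands.\<close>

lemma qform_hyp:
  assumes "M \<in> obj C"
  shows "qform (hyp M)"
proof -
  let ?D = "dl M"
  have S: "bip (M \<boxplus> ?D) M ?D (i1 M ?D) (i2 M ?D) (p1 M ?D) (p2 M ?D)"
    using assms by (simp add: bip_dsum)
  have n: "(p2 M ?D \<parallel> p1 M ?D) \<bullet> br (M \<boxplus> ?D) (M \<boxplus> ?D) = br M ?D \<bullet> (p1 M ?D \<parallel> p2 M ?D)"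
    "(p1 M ?D \<parallel> p2 M ?D) \<bullet> br (M \<boxplus> ?D) (M \<boxplus> ?D) = br ?D M \<bullet> (p2 M ?D \<parallel> p1 M ?D)"
    using br_natural[of "p1 M ?D" "p2 M ?D"] br_natural[of "p2 M ?D" "p1 M ?D"] assms by simp_all
  show ?thesis
    unfolding hyp_def
    using assms
    by (intro qformI[OF pairing_sum[OF bip_swap[OF S] S pairing_ev pairing_swap[OF pairing_ev], simplified comp_assoc]])
      (simp_all add: comp_plus_left n br_br' plus_comm)
qed

section \<open>Semiring laws up to isometry\<close>

lemma qsum_cong:
  assumes "isom x x'" "isom y y'" "qform x'" "qform y'"
  shows "isom (qsum x y) (qsum x' y')"
proof -
  obtain M b N c M' b' N' c' where xy: "x = (M, b)" "y = (N, c)" "x' = (M', b')" "y' = (N', c')"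
    by (metis surj_pair)
  from assms(1) obtain f g where f: "arr f" "dom f = M" "cod f = M'" "arr g" "dom g = M'" "cod g = M"
    "g \<bullet> f = idn M" "f \<bullet> g = idn M'" "b' \<bullet> (f \<parallel> f) = b"
    unfolding xy isom_def fst_conv snd_conv by blast
  from assms(2) obtain h k where h: "arr h" "dom h = N" "cod h = N'" "arr k" "dom k = N'" "cod k = N"
    "k \<bullet> h = idn N" "h \<bullet> k = idn N'" "c' \<bullet> (h \<parallel> h) = c"
    unfolding xy isom_def fst_conv snd_conv by blast
  note q = qformD[OF assms(3), unfolded xy, simplified] qformD[OF assms(4), unfolded xy, simplified]
  have [simp]: "M \<in> obj C" "N \<in> obj C"
    using arr_obj(1)[OF f(1)] arr_obj(1)[OF h(1)] f(2) h(2) by simp_all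
  have "isom (M \<boxplus> N, b' \<bullet> ((f \<bullet> p1 M N) \<parallel> (f \<bullet> p1 M N)) \<uplus> c' \<bullet> ((h \<bullet> p2 M N) \<parallel> (h \<bullet> p2 M N))) (qsum x' y')"
    unfolding xy by (rule isom_qsumI[OF bip_iso[OF bip_dsum f(1-8) h(1-8)]]) (use q in simp_all)
  also have "(M \<boxplus> N, b' \<bullet> ((f \<bullet> p1 M N) \<parallel> (f \<bullet> p1 M N)) \<uplus> c' \<bullet> ((h \<bullet> p2 M N) \<parallel> (h \<bullet> p2 M N))) = qsum x y"
    using f(1-6) h(1-6) by (simp add: qsum_def xy interchange[symmetric] comp_reduce[OF f(9)] comp_reduce[OF h(9)])
  finally show ?thesis .
qed

lemma qsum_comm:
  assumes "qform x" "qform y"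
  shows "isom (qsum x y) (qsum y x)"
proof -
  obtain M b N c where xy: "x = (M, b)" "y = (N, c)" by (metis surj_pair)
  note q = qformD[OF assms(1), unfolded xy, simplified] qformD[OF assms(2), unfolded xy, simplified]
  have "isom (M \<boxplus> N, c \<bullet> (p2 M N \<parallel> p2 M N) \<uplus> b \<bullet> (p1 M N \<parallel> p1 M N)) (qsum y x)"
    unfolding xy by (rule isom_qsumI[OF bip_swap[OF bip_dsum]]) (use q in simp_all)
  then show ?thesis
    using plus_comm[of "c \<bullet> (p2 M N \<parallel> p2 M N)" "b \<bullet> (p1 M N \<parallel> p1 M N)"] q by (simp add: qsum_def xy)
qed

lemma qsum_assoc:
  assumes "qform x" "qform y" "qform z"
  shows "isom (qsum (qsum x y) z) (qsum x (qsum y z))"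
proof -
  obtain M b N c L d where xy: "x = (M, b)" "y = (N, c)" "z = (L, d)" by (metis surj_pair)
  note q[simp] = qformD[OF assms(1), unfolded xy, simplified] qformD[OF assms(2), unfolded xy, simplified]
    qformD[OF assms(3), unfolded xy, simplified]
  let ?S = "M \<boxplus> N" and ?T = "N \<boxplus> L"
  let ?p = "p1 M N \<bullet> p1 ?S L" and ?q = "i1 N L \<bullet> p2 M N \<bullet> p1 ?S L \<uplus> i2 N L \<bullet> p2 ?S L"
  let ?c = "c \<bullet> (p1 N L \<parallel> p1 N L) \<uplus> d \<bullet> (p2 N L \<parallel> p2 N L)"
  have X: "bip (?S \<boxplus> L) ?S L (i1 ?S L) (i2 ?S L) (p1 ?S L) (p2 ?S L)"
    and S: "bip ?S M N (i1 M N) (i2 M N) (p1 M N) (p2 M N)"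
    and T: "bip ?T N L (i1 N L) (i2 N L) (p1 N L) (p2 N L)"
    by (simp_all add: bip_dsum)
  have pq: "p1 N L \<bullet> ?q = p2 M N \<bullet> p1 ?S L" "p2 N L \<bullet> ?q = p2 ?S L"
    by (simp_all add: comp_plus_right bip_reduce[OF T])
  have "isom (?S \<boxplus> L, b \<bullet> (?p \<parallel> ?p) \<uplus> ?c \<bullet> (?q \<parallel> ?q)) (qsum (M, b) (?T, ?c))"
    by (rule isom_qsumI[OF bip_assoc[OF X S]]) simp_all
  moreover have "b \<bullet> (?p \<parallel> ?p) \<uplus> ?c \<bullet> (?q \<parallel> ?q) = snd (qsum (qsum x y) z)"
    by (simp add: xy qsum_def comp_plus_left plus_assoc interchange pq)
  ultimately show ?thesis
    by (simp add: xy qsum_def)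
qed

lemma qsum_zero:
  assumes "qform x"
  shows "isom (qsum (Z, zr (Z \<boxtimes> Z) I) x) x"
proof (rule isom_sym)
  obtain M b where x: "x = (M, b)" by (metis surj_pair)
  note q[simp] = qformD[OF assms, unfolded x, simplified]
  \<comment> \<open>\<open>M\<close> is itself a biproduct of \<open>Z\<close> and \<open>M\<close>,
    which produces the isometry from \<open>x\<close> to the sum; the claim is its inverse.\<close>
  have "bip M Z M (zr Z M) (idn M) (zr M Z) (idn M)"
    by (simp add: bip_def idn_zero_obj)
  from isom_qsumI[OF this, of "zr (Z \<boxtimes> Z) I" b] show "isom x (qsum (Z, zr (Z \<boxtimes> Z) I) x)"
    by (simp add: x id_tens[symmetric])
  show "qform (qsum (Z, zr (Z \<boxtimes> Z) I) x)"
    by (rule qform_qsum[OF qform_zero assms])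
qed

lemma qten_cong:
  assumes "isom x x'" "isom y y'" "qform x'" "qform y'"
  shows "isom (qten x y) (qten x' y')"
proof -
  obtain M b N c M' b' N' c' where xy: "x = (M, b)" "y = (N, c)" "x' = (M', b')" "y' = (N', c')"
    by (metis surj_pair)
  from assms(1) obtain f g where f: "arr f" "dom f = M" "cod f = M'" "arr g" "dom g = M'" "cod g = M"
    "g \<bullet> f = idn M" "f \<bullet> g = idn M'" "b' \<bullet> (f \<parallel> f) = b"
    unfolding xy isom_def fst_conv snd_conv by blast
  from assms(2) obtain h k where h: "arr h" "dom h = N" "cod h = N'" "arr k" "dom k = N'" "cod k = N"
    "k \<bullet> h = idn N" "h \<bullet> k = idn N'" "c' \<bullet> (h \<parallel> h) = c"
    unfolding xy isom_def fst_conv snd_conv by blast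
  note q = qformD[OF assms(3), unfolded xy, simplified] qformD[OF assms(4), unfolded xy, simplified]
  have "M \<in> obj C" "N \<in> obj C"
    using arr_obj(1)[OF f(1)] arr_obj(1)[OF h(1)] f(2) h(2) by simp_all
  moreover have "tpair M' M' N' N' b' c' \<bullet> ((f \<parallel> h) \<parallel> (f \<parallel> h)) = tpair M M N N b c"
    using tpair_natural[of f f h h b' c'] f h q by simp
  ultimately show ?thesis
    unfolding qten_def xy fst_conv snd_conv
    by (intro isomI[of "f \<parallel> h" _ _ "g \<parallel> k"]) (use f(1-8) h(1-8) q in \<open>simp_all add: interchange id_tens\<close>)
qed

text \<open>By strictness both products live on the same object, and the forms are equal. The
  hexagons reduce each to \<open>a \<parallel> b \<parallel> d\<close> after the crossing
  \<open>?u\<close> of \<open>D\<close> with \<open>A\<close>, followed by \<open>br B A\<close> and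
  \<open>br D B\<close>; these two act on disjoint strands and commute.\<close>

lemma qten_assoc:
  assumes "qform x" "qform y" "qform z"
  shows "qten (qten x y) z = qten x (qten y z)"
proof -
  obtain A a B b D d where xy: "x = (A, a)" "y = (B, b)" "z = (D, d)" by (metis surj_pair)
  note q[simp] = qformD[OF assms(1), unfolded xy, simplified] qformD[OF assms(2), unfolded xy, simplified]
    qformD[OF assms(3), unfolded xy, simplified]
  let ?u = "idn A \<parallel> idn B \<parallel> br D A \<parallel> idn B \<parallel> idn D"
  have "tpair (A \<boxtimes> B) (A \<boxtimes> B) D D (tpair A A B B a b) d
      = ((a \<parallel> b) \<parallel> d) \<bullet> ((idn A \<parallel> br B A \<parallel> idn B) \<parallel> idn (D \<boxtimes> D)) \<bullet> (idn (A \<boxtimes> B) \<parallel> (br D (A \<boxtimes> B) \<parallel> idn D))"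
    using interchange[of "a \<parallel> b" "idn A \<parallel> br B A \<parallel> idn B" d "idn (D \<boxtimes> D)", symmetric]
    by (simp add: tpair_def)
  also have "idn (A \<boxtimes> B) \<parallel> (br D (A \<boxtimes> B) \<parallel> idn D) = (idn A \<parallel> idn B \<parallel> idn A \<parallel> br D B \<parallel> idn D) \<bullet> ?u"
    by (simp add: hexagon_right tens_comp_right id_tens)
  also have "((idn A \<parallel> br B A \<parallel> idn B) \<parallel> idn (D \<boxtimes> D)) \<bullet> ((idn A \<parallel> idn B \<parallel> idn A \<parallel> br D B \<parallel> idn D) \<bullet> ?u)
      = (idn A \<parallel> ((br B A \<parallel> idn (B \<boxtimes> D)) \<bullet> (idn (B \<boxtimes> A) \<parallel> br D B)) \<parallel> idn D) \<bullet> ?u"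
    by (simp add: tens_comp_right) (simp add: id_tens)
  also have "(br B A \<parallel> idn (B \<boxtimes> D)) \<bullet> (idn (B \<boxtimes> A) \<parallel> br D B) = (idn (A \<boxtimes> B) \<parallel> br D B) \<bullet> (br B A \<parallel> idn (D \<boxtimes> B))"
    by (simp add: interchange)
  finally have 1: "tpair (A \<boxtimes> B) (A \<boxtimes> B) D D (tpair A A B B a b) d
    = (a \<parallel> b \<parallel> d) \<bullet> (idn A \<parallel> ((idn (A \<boxtimes> B) \<parallel> br D B) \<bullet> (br B A \<parallel> idn (D \<boxtimes> B))) \<parallel> idn D) \<bullet> ?u"
    by simp
  have "tpair A A (B \<boxtimes> D) (B \<boxtimes> D) a (tpair B B D D b d)
      = (a \<parallel> (b \<parallel> d)) \<bullet> (idn (A \<boxtimes> A) \<parallel> (idn B \<parallel> br D B \<parallel> idn D)) \<bullet> (idn A \<parallel> (br (B \<boxtimes> D) A \<parallel> idn (B \<boxtimes> D)))"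
    using interchange[of a "idn (A \<boxtimes> A)" "b \<parallel> d" "idn B \<parallel> br D B \<parallel> idn D", symmetric]
    by (simp add: tpair_def)
  also have "idn A \<parallel> (br (B \<boxtimes> D) A \<parallel> idn (B \<boxtimes> D)) = (idn A \<parallel> br B A \<parallel> idn (D \<boxtimes> B) \<parallel> idn D) \<bullet> ?u"
    by (simp add: hexagon_left tens_comp_right) (simp add: id_tens)
  also have "(idn (A \<boxtimes> A) \<parallel> (idn B \<parallel> br D B \<parallel> idn D)) \<bullet> ((idn A \<parallel> br B A \<parallel> idn (D \<boxtimes> B) \<parallel> idn D) \<bullet> ?u)
      = (idn A \<parallel> ((idn (A \<boxtimes> B) \<parallel> br D B) \<bullet> (br B A \<parallel> idn (D \<boxtimes> B))) \<parallel> idn D) \<bullet> ?u"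
    by (simp add: tens_comp_right) (simp add: id_tens)
  finally show ?thesis
    by (simp add: qten_def xy 1)
qed

text \<open>The isometry is \<open>br M N\<close>. Naturality at \<open>b\<close> and
  \<open>c\<close> brings in the symmetry of \<open>M \<boxtimes> M\<close> with
  \<open>N \<boxtimes> N\<close>, whose first crossing cancels against the one in
  \<open>tpair\<close>.\<close>

lemma qten_comm:
  assumes "qform x" "qform y"
  shows "isom (qten x y) (qten y x)"
proof -
  obtain M b N c where xy: "x = (M, b)" "y = (N, c)" by (metis surj_pair)
  note q[simp] = qformD[OF assms(1), unfolded xy, simplified] qformD[OF assms(2), unfolded xy, simplified]
  have br: "br (M \<boxtimes> M) (N \<boxtimes> N)
    = (idn N \<parallel> br M N \<parallel> idn M) \<bullet> ((idn (N \<boxtimes> M) \<parallel> br M N) \<bullet> (br M N \<parallel> idn (M \<boxtimes> N))) \<bullet> (idn M \<parallel> br M N \<parallel> idn N)"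
    by (simp add: hexagon_left hexagon_right tens_comp_right) (simp add: id_tens)
  have inv: "(idn M \<parallel> br M N \<parallel> idn N) \<bullet> (idn M \<parallel> br N M \<parallel> idn N) = idn (M \<boxtimes> N \<boxtimes> M \<boxtimes> N)"
    by (simp add: interchange br_br id_tens)
  have "tpair M M N N b c = (c \<parallel> b) \<bullet> br (M \<boxtimes> M) (N \<boxtimes> N) \<bullet> (idn M \<parallel> br N M \<parallel> idn N)"
    using comp_reduce[of "c \<parallel> b" "br (M \<boxtimes> M) (N \<boxtimes> N)" "b \<parallel> c"] br_natural[of b c]
    by (simp add: tpair_def)
  also have "\<dots> = (c \<parallel> b) \<bullet> (idn N \<parallel> br M N \<parallel> idn M) \<bullet> ((idn (N \<boxtimes> M) \<parallel> br M N) \<bullet> (br M N \<parallel> idn (M \<boxtimes> N)))"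
    by (simp add: br inv)
  also have "(idn (N \<boxtimes> M) \<parallel> br M N) \<bullet> (br M N \<parallel> idn (M \<boxtimes> N)) = br M N \<parallel> br M N"
    by (simp add: interchange)
  finally have "tpair N N M M c b \<bullet> (br M N \<parallel> br M N) = tpair M M N N b c"
    by (simp add: tpair_def)
  then show ?thesis
    unfolding qten_def xy fst_conv snd_conv
    by (intro isomI[of "br M N" _ _ "br N M"]) (simp_all add: br_br id_tens)
qed

lemma qten_unit: "qform x \<Longrightarrow> qten (I, idn I) x = x"
  using qformD[of x] by (cases x) (simp add: qten_def tpair_def id_tens[symmetric])

lemma qten_zero:
  assumes "qform x"
  shows "isom (qten (Z, zr (Z \<boxtimes> Z) I) x) (Z, zr (Z \<boxtimes> Z) I)"
proof -
  obtain M b where x: "x = (M, b)" by (metis surj_pair)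
  note q[simp] = qformD[OF assms, unfolded x, simplified]
  show ?thesis
    unfolding qten_def x fst_conv snd_conv
    by (rule isomI[of "zr (Z \<boxtimes> M) Z" _ _ "zr Z (Z \<boxtimes> M)"]) (simp_all add: tpair_def id_tens idn_zero_obj)
qed

lemma tpair_plus_left:
  assumes "A \<in> obj C" "B \<in> obj C" "A' \<in> obj C" "B' \<in> obj C" "arr a" "arr b" "dom a = A \<boxtimes> B" "dom b = A \<boxtimes> B"
    "cod a = I" "cod b = I" "arr d" "dom d = A' \<boxtimes> B'" "cod d = I"
  shows "tpair A B A' B' (a \<uplus> b) d = tpair A B A' B' a d \<uplus> tpair A B A' B' b d"
  using assms by (simp add: tpair_def tens_plus_left comp_plus_left)

lemma qten_qsum:
  assumes "qform x" "qform y" "qform z"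
  shows "isom (qten (qsum x y) z) (qsum (qten x z) (qten y z))"
proof -
  obtain M b N c K d where xy: "x = (M, b)" "y = (N, c)" "z = (K, d)" by (metis surj_pair)
  note q[simp] = qformD[OF assms(1), unfolded xy, simplified] qformD[OF assms(2), unfolded xy, simplified]
    qformD[OF assms(3), unfolded xy, simplified]
  let ?X = "M \<boxplus> N"
  let ?b = "tpair M M K K b d" and ?c = "tpair N N K K c d"
  let ?p = "p1 M N \<parallel> idn K" and ?q = "p2 M N \<parallel> idn K"
  have X: "bip (?X \<boxtimes> K) (M \<boxtimes> K) (N \<boxtimes> K) (i1 M N \<parallel> idn K) (i2 M N \<parallel> idn K) ?p ?q"
    by (simp add: bip_tens bip_dsum)
  have "isom (?X \<boxtimes> K, ?b \<bullet> (?p \<parallel> ?p) \<uplus> ?c \<bullet> (?q \<parallel> ?q)) (qsum (M \<boxtimes> K, ?b) (N \<boxtimes> K, ?c))"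
    by (rule isom_qsumI[OF X]) (simp_all add: tpair_def)
  moreover have "snd (qten (qsum x y) z) = ?b \<bullet> (?p \<parallel> ?p) \<uplus> ?c \<bullet> (?q \<parallel> ?q)"
    using tpair_natural[of "p1 M N" "p1 M N" "idn K" "idn K" b d]
      tpair_natural[of "p2 M N" "p2 M N" "idn K" "idn K" c d]
    by (simp add: qten_def qsum_def xy tpair_plus_left id_tens[of K K, symmetric])
  ultimately show ?thesis
    by (simp add: qten_def qsum_def xy)
qed

text \<open>The product splits into \<open>M \<boxtimes> K\<close> and
  \<open>dl M \<boxtimes> K\<close>, and the block between them is the product of
  \<open>evl M\<close> with \<open>d\<close>, a duality by \<open>pairing_tpair\<close>. The
  recognition criterion then applies, and the dual of \<open>M \<boxtimes> K\<close> is never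
  computed.\<close>

lemma hyp_qten:
  assumes "M \<in> obj C" "qform z"
  shows "isom (qten (hyp M) z) (hyp (M \<boxtimes> fst z))"
proof -
  from assms(2) obtain K d e where z: "z = (K, d)" "pairing K K d e" "d \<bullet> br K K = d"
    by (elim qformE)
  note [simp] = assms(1) pairingD[OF z(2)]
  let ?D = "dl M" and ?X = "M \<boxplus> dl M"
  let ?b = "tpair ?D M K K (evl M) d"
  let ?p = "p1 M ?D \<parallel> idn K" and ?q = "p2 M ?D \<parallel> idn K"
  have X: "bip (?X \<boxtimes> K) (M \<boxtimes> K) (?D \<boxtimes> K) (i1 M ?D \<parallel> idn K) (i2 M ?D \<parallel> idn K) ?p ?q"
    by (simp add: bip_tens bip_dsum)
  obtain e' where P: "pairing (?D \<boxtimes> K) (M \<boxtimes> K) ?b e'"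
    using pairing_tpair[OF pairing_ev[OF assms(1)] z(2)] by blast
  \<comment> \<open>The symmetry of \<open>d\<close> enters here: mirroring the block mirrors both
    factors, and \<open>d\<close> is unchanged.\<close>
  have sw: "?b \<bullet> br (M \<boxtimes> K) (?D \<boxtimes> K) = tpair M ?D K K (evl M \<bullet> br M ?D) d"
    using tpair_br[of ?D M K K "evl M" d] by (simp add: z(3))
  have "snd (qten (hyp M) z) = ?b \<bullet> (?q \<parallel> ?p) \<uplus> (?b \<bullet> br (M \<boxtimes> K) (?D \<boxtimes> K)) \<bullet> (?p \<parallel> ?q)"
    unfolding sw using tpair_natural[of "p2 M ?D" "p1 M ?D" "idn K" "idn K" "evl M" d]
      tpair_natural[of "p1 M ?D" "p2 M ?D" "idn K" "idn K" "evl M \<bullet> br M ?D" d]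
    by (simp add: qten_def hyp_def z(1) tpair_plus_left id_tens[of K K, symmetric])
  moreover have "isom (?X \<boxtimes> K, ?b \<bullet> (?q \<parallel> ?p) \<uplus> ?b \<bullet> br (M \<boxtimes> K) (?D \<boxtimes> K) \<bullet> (?p \<parallel> ?q)) (hyp (M \<boxtimes> K))"
    by (rule isom_hypI[OF X P])
  ultimately show ?thesis
    by (simp add: qten_def hyp_def z(1))
qed

text \<open>After exchanging the middle summands, \<open>M\<close> and \<open>N\<close> lie on one
  side and their duals on the other. The block between the sides is the direct sum of the two
  evaluations, hence a duality.\<close>

lemma hyp_dsum:
  assumes "M \<in> obj C" "N \<in> obj C"
  shows "isom (qsum (hyp M) (hyp N)) (hyp (M \<boxplus> N))"
proof -
  note [simp] = assms
  let ?D = "dl M" and ?E = "dl N"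
  let ?S = "M \<boxplus> ?D" and ?T = "N \<boxplus> ?E"
  have S: "bip ?S M ?D (i1 M ?D) (i2 M ?D) (p1 M ?D) (p2 M ?D)"
    and T: "bip ?T N ?E (i1 N ?E) (i2 N ?E) (p1 N ?E) (p2 N ?E)"
    and X: "bip (?S \<boxplus> ?T) ?S ?T (i1 ?S ?T) (i2 ?S ?T) (p1 ?S ?T) (p2 ?S ?T)"
    and A: "bip (M \<boxplus> N) M N (i1 M N) (i2 M N) (p1 M N) (p2 M N)"
    and B: "bip (?D \<boxplus> ?E) ?D ?E (i1 ?D ?E) (i2 ?D ?E) (p1 ?D ?E) (p2 ?D ?E)"
    by (simp_all add: bip_dsum)
  let ?p = "i1 M N \<bullet> p1 M ?D \<bullet> p1 ?S ?T \<uplus> i2 M N \<bullet> p1 N ?E \<bullet> p2 ?S ?T"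
  let ?q = "i1 ?D ?E \<bullet> p2 M ?D \<bullet> p1 ?S ?T \<uplus> i2 ?D ?E \<bullet> p2 N ?E \<bullet> p2 ?S ?T"
  let ?b = "evl M \<bullet> (p1 ?D ?E \<parallel> p1 M N) \<uplus> evl N \<bullet> (p2 ?D ?E \<parallel> p2 M N)"
  have pq: "p1 M N \<bullet> ?p = p1 M ?D \<bullet> p1 ?S ?T" "p2 M N \<bullet> ?p = p1 N ?E \<bullet> p2 ?S ?T"
    "p1 ?D ?E \<bullet> ?q = p2 M ?D \<bullet> p1 ?S ?T" "p2 ?D ?E \<bullet> ?q = p2 N ?E \<bullet> p2 ?S ?T"
    by (simp_all add: comp_plus_right bip_reduce[OF A] bip_reduce[OF B])
  let ?M1 = "evl M \<bullet> ((p2 M ?D \<bullet> p1 ?S ?T) \<parallel> (p1 M ?D \<bullet> p1 ?S ?T))"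
    and ?M2 = "evl M \<bullet> br M ?D \<bullet> ((p1 M ?D \<bullet> p1 ?S ?T) \<parallel> (p2 M ?D \<bullet> p1 ?S ?T))"
    and ?N1 = "evl N \<bullet> ((p2 N ?E \<bullet> p2 ?S ?T) \<parallel> (p1 N ?E \<bullet> p2 ?S ?T))"
    and ?N2 = "evl N \<bullet> br N ?E \<bullet> ((p1 N ?E \<bullet> p2 ?S ?T) \<parallel> (p2 N ?E \<bullet> p2 ?S ?T))"
  have q: "?b \<bullet> (?q \<parallel> ?p) = ?M1 \<uplus> ?N1"
    by (simp only: comp_plus_left comp_assoc interchange dom_cod pq)
  have "?b \<bullet> br (M \<boxplus> N) (?D \<boxplus> ?E) = evl M \<bullet> br M ?D \<bullet> (p1 M N \<parallel> p1 ?D ?E) \<uplus> evl N \<bullet> br N ?E \<bullet> (p2 M N \<parallel> p2 ?D ?E)"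
    using br_natural[of "p1 M N" "p1 ?D ?E", symmetric] br_natural[of "p2 M N" "p2 ?D ?E", symmetric]
    by (simp add: comp_plus_left)
  then have "(?b \<bullet> br (M \<boxplus> N) (?D \<boxplus> ?E)) \<bullet> (?p \<parallel> ?q) = ?M2 \<uplus> ?N2"
    by (simp only: comp_plus_left comp_assoc interchange dom_cod pq)
  moreover have "snd (qsum (hyp M) (hyp N)) = (?M1 \<uplus> ?M2) \<uplus> (?N1 \<uplus> ?N2)"
    by (simp add: qsum_def hyp_def comp_plus_left interchange)
  \<comment> \<open>The orthogonal sum groups the four terms by object, the recognition criterion by
    the two sides.\<close>
  moreover have "(?M1 \<uplus> ?M2) \<uplus> (?N1 \<uplus> ?N2) = (?M1 \<uplus> ?N1) \<uplus> (?M2 \<uplus> ?N2)"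
    using plus_comm[of ?M2 ?N1] plus_assoc[of ?M2 ?N1 ?N2] plus_assoc[of ?N1 ?M2 ?N2] by (simp add: plus_assoc)
  moreover have "isom (?S \<boxplus> ?T, ?b \<bullet> (?q \<parallel> ?p) \<uplus> ?b \<bullet> br (M \<boxplus> N) (?D \<boxplus> ?E) \<bullet> (?p \<parallel> ?q)) (hyp (M \<boxplus> N))"
    by (rule isom_hypI[OF bip_exchange[OF X S T] pairing_sum[OF B A pairing_ev pairing_ev]]) simp_all
  ultimately show ?thesis
    unfolding q by (simp add: qsum_def hyp_def)
qed

text \<open>The object \<open>M \<boxplus> dl M\<close> is kept and its first summand is renamed
  along \<open>u\<close>. Since \<open>evl M \<bullet> (idn (dl M) \<parallel> u')\<close> exhibits
  \<open>dl M\<close> as a dual of \<open>N\<close>, the result is recognised as the hyperbolic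
  object of \<open>N\<close>.\<close>

lemma hyp_cong:
  assumes u: "arr u" "dom u = M" "cod u = N" "arr u'" "dom u' = N" "cod u' = M" "u' \<bullet> u = idn M" "u \<bullet> u' = idn N"
  shows "isom (hyp M) (hyp N)"
proof -
  have [simp]: "M \<in> obj C" "N \<in> obj C"
    using arr_obj[OF u(1)] u by simp_all
  let ?D = "dl M"
  have X: "bip (M \<boxplus> ?D) N ?D (i1 M ?D \<bullet> u') (i2 M ?D \<bullet> idn ?D) (u \<bullet> p1 M ?D) (idn ?D \<bullet> p2 M ?D)"
    by (rule bip_iso[OF bip_dsum u]) simp_all
  have P: "pairing ?D N (evl M \<bullet> (idn ?D \<parallel> u')) ((u \<parallel> idn ?D) \<bullet> cvl M)"
    by (rule pairing_transport[OF pairing_ev]) (use u in simp_all)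
  have "evl M \<bullet> br M ?D \<bullet> (p1 M ?D \<parallel> p2 M ?D)
      = (evl M \<bullet> (idn ?D \<parallel> u')) \<bullet> br N ?D \<bullet> ((u \<bullet> p1 M ?D) \<parallel> (idn ?D \<bullet> p2 M ?D))"
    using u br_natural[of u' "idn ?D", symmetric, THEN comp_reduce]
      comp_reduce[OF u(7), of "p1 M ?D"] by (simp add: interchange)
  moreover have "evl M \<bullet> (p2 M ?D \<parallel> p1 M ?D) = (evl M \<bullet> (idn ?D \<parallel> u')) \<bullet> ((idn ?D \<bullet> p2 M ?D) \<parallel> (u \<bullet> p1 M ?D))"
    using u comp_reduce[OF u(7), of "p1 M ?D"] by (simp add: interchange)
  ultimately show ?thesis
    using isom_hypI[OF X P] by (simp add: hyp_def)
qed

section \<open>The Witt ring\<close>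

definition typed_form :: "'o \<times> 'm \<Rightarrow> 'o \<times> ('o, 'm) arrow"
  where "typed_form x = (fst x, arw (fst x \<boxtimes> fst x) I (snd x))"

lemma fst_typed_form: "fst (typed_form x) = fst x"
  by (simp add: typed_form_def)

lemma iso_mor_iff:
  assumes "M \<in> obj C" "N \<in> obj C"
  shows "iso_mor C M N f \<longleftrightarrow> arr (arw M N f)
    \<and> (\<exists>g. arr g \<and> dom g = N \<and> cod g = M \<and> g \<bullet> arw M N f = idn M \<and> arw M N f \<bullet> g = idn N)"
proof -
  have "iso_mor C M N f \<longleftrightarrow> f \<in> mor C M N
      \<and> (\<exists>g. g \<in> mor C N M \<and> arw N M g \<bullet> arw M N f = idn M \<and> arw M N f \<bullet> arw N M g = idn N)"
    using assms by (auto simp: iso_mor_def comp_arw idn_def)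
  also have "\<dots> \<longleftrightarrow> f \<in> mor C M N
      \<and> (\<exists>g. arr g \<and> dom g = N \<and> cod g = M \<and> g \<bullet> arw M N f = idn M \<and> arw M N f \<bullet> g = idn N)"
    using assms by (metis arr_arw arw_und dom_cod(1,2) und_mor)
  finally show ?thesis
    using assms by (simp add: arr_arw)
qed

text \<open>An inverse of the adjoint map transports the chosen duality of \<open>M\<close> to a
  copairing for the form. Conversely, a copairing makes the adjoint map the comparison of two duals
  of \<open>M\<close>, which is invertible by \<open>pairing_compare\<close>.\<close>

lemma quad_obj_iff: "x \<in> quad_obj C \<longleftrightarrow> qform (typed_form x)"
proof -
  obtain M b where x: "x = (M, b)" by (metis surj_pair)
  let ?b = "arw (M \<boxtimes> M) I b"
  let ?h = "(?b \<parallel> idn (dl M)) \<bullet> (idn M \<parallel> cvl M)"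
  have adj: "?h = arw M (dl M) (adjoint_map C M b)" if "M \<in> obj C" "b \<in> mor C (M \<boxtimes> M) I"
  proof -
    have "arr ?h" "und ?h = adjoint_map C M b"
      using that by (simp_all add: adjoint_map_def arr_arw cvl_def[THEN arg_cong[of _ _ und]])
    with arw_und[of ?h] that show ?thesis by simp
  qed
  have sym: "?b \<bullet> br M M = ?b \<longleftrightarrow> b \<cdot> braid C M M = b" if "M \<in> obj C" "b \<in> mor C (M \<boxtimes> M) I"
    using that arr_basic(3)[of M M] by (simp add: br_def comp_arw arr_arw)
  have pair: "iso_mor C M (dl M) (adjoint_map C M b) \<longleftrightarrow> (\<exists>d. pairing M M ?b d)"
    if M: "M \<in> obj C" and b: "b \<in> mor C (M \<boxtimes> M) I"
  proof -
    have [simp]: "arr ?b" "arr ?h" using M b by (simp_all add: arr_arw)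
    show ?thesis
    proof
      assume "iso_mor C M (dl M) (adjoint_map C M b)"
      then obtain g where g: "arr g" "dom g = dl M" "cod g = M" "g \<bullet> ?h = idn M" "?h \<bullet> g = idn (dl M)"
        using M b by (auto simp only: iso_mor_iff dual_obj adj)
      have "pairing M M (evl M \<bullet> (?h \<parallel> idn M)) ((idn M \<parallel> g) \<bullet> cvl M)"
        by (rule pairing_transport[OF pairing_ev[OF M]]) (use M g in \<open>simp_all del: comp_assoc\<close>)
      moreover have "evl M \<bullet> (?h \<parallel> idn M) = ?b"
        by (rule pairing_adjoint[OF _ _ _ _ pairing_ev[OF M]]) (simp_all add: M)
      ultimately show "\<exists>d. pairing M M ?b d"
        by (simp only:) blast
    next
      assume "\<exists>d. pairing M M ?b d"
      then obtain d where P: "pairing M M ?b d" by blast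
      have "\<exists>g. arr g \<and> dom g = dl M \<and> cod g = M \<and> g \<bullet> ?h = idn M \<and> ?h \<bullet> g = idn (dl M)"
        using M pairingD[OF P] pairing_compare[OF P pairing_ev[OF M]] pairing_compare[OF pairing_ev[OF M] P]
        by (intro exI[of _ "(evl M \<parallel> idn M) \<bullet> (idn (dl M) \<parallel> d)"]) (simp del: comp_assoc)
      moreover have "arr ?h" using M by simp
      ultimately show "iso_mor C M (dl M) (adjoint_map C M b)"
        using M b by (simp only: iso_mor_iff dual_obj adj)
    qed
  qed
  have "qform (typed_form x) \<Longrightarrow> M \<in> obj C \<and> b \<in> mor C (M \<boxtimes> M) I"
    using qformD(1,2)[of "typed_form x"] by (simp add: x typed_form_def arr_arw)
  then show ?thesis
    using sym pair
    by (auto simp: x typed_form_def quad_obj_def bilinear_forms_def symmetric_form_def nonsingular_form_def qform_def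
        simp del: split_paired_Ex)
qed

lemma isometric_iff: "(x, y) \<in> isometric C \<longleftrightarrow> qform (typed_form x) \<and> qform (typed_form y) \<and> isom (typed_form x) (typed_form y)"
proof -
  obtain M b N c where x: "x = (M, b)" "y = (N, c)" by (metis surj_pair)
  have "(\<exists>f. isometry C x y f) \<longleftrightarrow> isom (typed_form x) (typed_form y)" if "qform (typed_form x)" "qform (typed_form y)"
  proof -
    have [simp]: "M \<in> obj C" "N \<in> obj C" "b \<in> mor C (M \<boxtimes> M) I" "c \<in> mor C (N \<boxtimes> N) I"
      using qformD(1,2)[OF that(1)] qformD(1,2)[OF that(2)] by (simp_all add: x typed_form_def arr_arw)
    have form: "c \<cdot> (f \<star> f) = b \<longleftrightarrow> arw (N \<boxtimes> N) I c \<bullet> (arw M N f \<parallel> arw M N f) = arw (M \<boxtimes> M) I b"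
      if "f \<in> mor C M N" for f
      using that mtimes_mor[of M N M N f f] by (simp add: tens_arw comp_arw)
    have "(\<exists>f. isometry C x y f) \<longleftrightarrow> (\<exists>f. f \<in> mor C M N
        \<and> (\<exists>g. arr g \<and> dom g = N \<and> cod g = M \<and> g \<bullet> arw M N f = idn M \<and> arw M N f \<bullet> g = idn N)
        \<and> arw (N \<boxtimes> N) I c \<bullet> (arw M N f \<parallel> arw M N f) = arw (M \<boxtimes> M) I b)"
      using form by (auto simp: isometry_def x iso_mor_iff arr_arw simp del: split_paired_Ex)
    also have "\<dots> \<longleftrightarrow> (\<exists>f. arr f \<and> dom f = M \<and> cod f = N
        \<and> (\<exists>g. arr g \<and> dom g = N \<and> cod g = M \<and> g \<bullet> f = idn M \<and> f \<bullet> g = idn N)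
        \<and> arw (N \<boxtimes> N) I c \<bullet> (f \<parallel> f) = arw (M \<boxtimes> M) I b)" (is "?L = ?R")
    proof
      assume ?L
      then obtain f where "f \<in> mor C M N"
        "\<exists>g. arr g \<and> dom g = N \<and> cod g = M \<and> g \<bullet> arw M N f = idn M \<and> arw M N f \<bullet> g = idn N"
        "arw (N \<boxtimes> N) I c \<bullet> (arw M N f \<parallel> arw M N f) = arw (M \<boxtimes> M) I b" by blast
      then show ?R
        by (intro exI[of _ "arw M N f"]) (simp add: arr_arw del: split_paired_Ex)
    next
      assume ?R
      then obtain f where f: "arr f" "dom f = M" "cod f = N"
        "\<exists>g. arr g \<and> dom g = N \<and> cod g = M \<and> g \<bullet> f = idn M \<and> f \<bullet> g = idn N"
        "arw (N \<boxtimes> N) I c \<bullet> (f \<parallel> f) = arw (M \<boxtimes> M) I b" by blast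
      then show ?L
        using arw_und[OF f(1)] by (intro exI[of _ "und f"]) (simp del: split_paired_Ex)
    qed
    also have "\<dots> \<longleftrightarrow> isom (typed_form x) (typed_form y)"
      by (simp add: isom_def x typed_form_def del: split_paired_Ex) blast
    finally show ?thesis .
  qed
  then show ?thesis
    by (auto simp: isometric_def quad_obj_iff simp del: split_paired_Ex)
qed

lemma typed_form_orth_sum:
  assumes "x \<in> quad_obj C" "y \<in> quad_obj C"
  shows "typed_form (orth_sum C x y) = qsum (typed_form x) (typed_form y)"
proof -
  obtain M b N c where x: "x = (M, b)" "y = (N, c)" by (metis surj_pair)
  have "arw ((M \<boxplus> N) \<boxtimes> (M \<boxplus> N)) I (sum_form C M b N c)
      = arw (M \<boxtimes> M) I b \<bullet> (p1 M N \<parallel> p1 M N) \<uplus> arw (N \<boxtimes> N) I c \<bullet> (p2 M N \<parallel> p2 M N)" (is "_ = ?r")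
  proof -
    have o: "M \<in> obj C" "N \<in> obj C" "b \<in> mor C (M \<boxtimes> M) I" "c \<in> mor C (N \<boxtimes> N) I"
      using assms by (auto simp: x quad_obj_def bilinear_forms_def)
    then have r: "arr ?r" by (simp add: arr_arw)
    have "und ?r = sum_form C M b N c"
      using o by (simp add: arr_arw sum_form_def und_basic)
    with arw_und[OF r] show ?thesis by simp
  qed
  then show ?thesis
    by (simp add: typed_form_def orth_sum_def qsum_def x)
qed

lemma typed_form_quad_tensor:
  assumes "x \<in> quad_obj C" "y \<in> quad_obj C"
  shows "typed_form (quad_tensor C x y) = qten (typed_form x) (typed_form y)"
proof -
  obtain M b N c where x: "x = (M, b)" "y = (N, c)" by (metis surj_pair)
  have o: "M \<in> obj C" "N \<in> obj C" "b \<in> mor C (M \<boxtimes> M) I" "c \<in> mor C (N \<boxtimes> N) I"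
    using assms by (auto simp: x quad_obj_def bilinear_forms_def)
  let ?r = "tpair M M N N (arw (M \<boxtimes> M) I b) (arw (N \<boxtimes> N) I c)"
  have r: "arr ?r" using o by (simp add: arr_arw tpair_def)
  have "und ?r = tensor_form C M b N c"
    using o by (simp add: arr_arw tensor_form_def tpair_def br_def[THEN arg_cong[of _ _ und]])
  with arw_und[OF r] show ?thesis
    using o by (simp add: typed_form_def quad_tensor_def qten_def x tpair_def)
qed

lemma typed_form_hyperbolic:
  assumes "M \<in> obj C"
  shows "typed_form (hyperbolic C M) = hyp M"
proof -
  have r: "arr (snd (hyp M))" using assms by (simp add: hyp_def)
  have "und (snd (hyp M)) = hyperbolic_form C M"
    using assms by (simp add: hyp_def hyperbolic_form_def Let_def und_basic br_def[THEN arg_cong[of _ _ und]]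
        evl_def[THEN arg_cong[of _ _ und]])
  with arw_und[OF r] show ?thesis
    using assms by (simp add: typed_form_def hyperbolic_def hyp_def)
qed

lemma typed_form_zero: "typed_form (zero_quad C) = (Z, zr (Z \<boxtimes> Z) I)"
  by (simp add: typed_form_def zero_quad_def zr_def)

lemma typed_form_unit: "typed_form (quad_unit C) = (I, idn I)"
  by (simp add: typed_form_def quad_unit_def idn_def)

lemmas typed_form_simps = typed_form_orth_sum typed_form_quad_tensor typed_form_zero typed_form_unit quad_obj_iff

text \<open>Associativity and the unit law of the product are equalities of typed forms and enter
  through \<open>isom_refl\<close>; the other laws rest on genuine isometries.\<close>

sublocale Q: semiring_congruence "quad_obj C" "isometric C" "orth_sum C" "zero_quad C" "quad_tensor C" "quad_unit C"
proof
  show "equiv (quad_obj C) (isometric C)"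
  proof (rule equivI)
    show "isometric C \<subseteq> quad_obj C \<times> quad_obj C"
      by (auto simp: isometric_def)
    show "refl_on (quad_obj C) (isometric C)"
      by (rule refl_onI) (simp_all add: isometric_iff quad_obj_iff isom_refl)
    show "sym (isometric C)"
      by (rule symI) (simp add: isometric_iff isom_sym)
    show "trans (isometric C)"
      by (rule transI) (auto simp: isometric_iff intro: isom_trans)
  qed
qed (simp_all add: isometric_iff typed_form_simps qform_qsum qform_qten qform_zero qform_unit qsum_cong qten_cong
    qsum_assoc qsum_comm qsum_zero qten_assoc qten_comm qten_unit qten_zero qten_qsum isom_refl)

lemma Q_comm_semiring: "comm_semiring Q.quotient_ring"
  using Q.quotient_semiring Q.quotient_comm_monoid by (rule comm_semiring.intro)

lemma quad_monoid_eq: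
  "quad_monoid C = \<lparr>carrier = carrier Q.quotient_ring, monoid.mult = add Q.quotient_ring, one = zero Q.quotient_ring\<rparr>"
  by (simp add: quad_monoid_def Q.quotient_ring_def quotient_monoid_def)

text \<open>The double braiding is the identity. Consequently the hyperbolic construction is
  available on \<open>M \<boxtimes> K\<close> for every \<open>K\<close>, as the ideal property
  demands.\<close>

lemma weakly_symmetric_eq: "weakly_symmetric C = obj C"
proof -
  have "ev C M = ev C M \<cdot> braid C M (dl M) \<cdot> braid C (dl M) M" if "M \<in> obj C" for M
    using symmetric that cmp_ide_right[OF _ _ ev_mor[OF that]] by (simp add: symmetric_braiding_def)
  then show ?thesis
    by (auto simp: weakly_symmetric_def)
qed

section \<open>Isomorphism classes of objects and the hyperbolic map\<close>

lemma isomorphic_iff: "(M, N) \<in> isomorphic_wsym C \<longleftrightarrow>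
    (\<exists>u u'. M \<in> obj C \<and> N \<in> obj C \<and> arr u \<and> dom u = M \<and> cod u = N \<and> arr u' \<and> dom u' = N \<and> cod u' = M
      \<and> u' \<bullet> u = idn M \<and> u \<bullet> u' = idn N)"
proof
  assume "(M, N) \<in> isomorphic_wsym C"
  then obtain f where f: "M \<in> obj C" "N \<in> obj C" "iso_mor C M N f"
    by (auto simp: isomorphic_wsym_def weakly_symmetric_eq)
  then obtain g where "arr (arw M N f)" "arr g" "dom g = N" "cod g = M"
    "g \<bullet> arw M N f = idn M" "arw M N f \<bullet> g = idn N"
    by (simp only: iso_mor_iff) blast
  with f show "\<exists>u u'. M \<in> obj C \<and> N \<in> obj C \<and> arr u \<and> dom u = M \<and> cod u = N \<and> arr u' \<and> dom u' = N \<and> cod u' = M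
      \<and> u' \<bullet> u = idn M \<and> u \<bullet> u' = idn N"
    by (intro exI[of _ "arw M N f"] exI[of _ g]) simp
next
  assume "\<exists>u u'. M \<in> obj C \<and> N \<in> obj C \<and> arr u \<and> dom u = M \<and> cod u = N \<and> arr u' \<and> dom u' = N \<and> cod u' = M
      \<and> u' \<bullet> u = idn M \<and> u \<bullet> u' = idn N"
  then obtain u u' where u: "M \<in> obj C" "N \<in> obj C" "arr u" "dom u = M" "cod u = N"
    "arr u'" "dom u' = N" "cod u' = M" "u' \<bullet> u = idn M" "u \<bullet> u' = idn N" by blast
  then have "arw M N (und u) = u"
    using arw_und[of u] by simp
  with u have "iso_mor C M N (und u)"
    unfolding iso_mor_iff[OF u(1,2)] by (intro conjI exI[of _ u']) simp_all
  with u show "(M, N) \<in> isomorphic_wsym C"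
    by (auto simp: isomorphic_wsym_def weakly_symmetric_eq)
qed

lemma isomorphic_equiv: "equiv (obj C) (isomorphic_wsym C)"
proof (rule equivI)
  show "isomorphic_wsym C \<subseteq> obj C \<times> obj C"
    by (auto simp: isomorphic_wsym_def weakly_symmetric_eq)
  show "refl_on (obj C) (isomorphic_wsym C)"
  proof (rule refl_onI)
    fix M assume "M \<in> obj C"
    then show "(M, M) \<in> isomorphic_wsym C"
      unfolding isomorphic_iff by (intro exI[of _ "idn M"]) simp
  qed
  show "sym (isomorphic_wsym C)"
    by (rule symI) (unfold isomorphic_iff, blast)
  show "trans (isomorphic_wsym C)"
  proof (rule transI)
    fix L M N assume "(L, M) \<in> isomorphic_wsym C" "(M, N) \<in> isomorphic_wsym C"
    then obtain u u' v v' where u: "arr u" "dom u = L" "cod u = M" "arr u'" "dom u' = M" "cod u' = L"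
        "u' \<bullet> u = idn L" "u \<bullet> u' = idn M" "L \<in> obj C"
      and v: "arr v" "dom v = M" "cod v = N" "arr v'" "dom v' = N" "cod v' = M"
        "v' \<bullet> v = idn M" "v \<bullet> v' = idn N" "N \<in> obj C"
      unfolding isomorphic_iff by blast
    show "(L, N) \<in> isomorphic_wsym C"
      unfolding isomorphic_iff
      by (intro exI[of _ "v \<bullet> u"] exI[of _ "u' \<bullet> v'"])
        (use u v comp_reduce[OF u(8)] comp_reduce[OF v(7)] in simp)
  qed
qed

lemma isomorphic_dsum:
  assumes "(M, M') \<in> isomorphic_wsym C" "(N, N') \<in> isomorphic_wsym C"
  shows "(M \<boxplus> N, M' \<boxplus> N') \<in> isomorphic_wsym C"
proof -
  from assms obtain u u' v v' where o: "M \<in> obj C" "M' \<in> obj C" "N \<in> obj C" "N' \<in> obj C"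
    and u: "arr u" "dom u = M" "cod u = M'" "arr u'" "dom u' = M'" "cod u' = M" "u' \<bullet> u = idn M" "u \<bullet> u' = idn M'"
    and v: "arr v" "dom v = N" "cod v = N'" "arr v'" "dom v' = N'" "cod v' = N" "v' \<bullet> v = idn N" "v \<bullet> v' = idn N'"
    unfolding isomorphic_iff by blast
  from bip_unique[OF bip_iso[OF bip_dsum[OF o(1,3)] u v] bip_dsum[OF o(2,4)]] obtain f g where
    "arr f" "dom f = M \<boxplus> N" "cod f = M' \<boxplus> N'" "arr g" "dom g = M' \<boxplus> N'" "cod g = M \<boxplus> N"
    "g \<bullet> f = idn (M \<boxplus> N)" "f \<bullet> g = idn (M' \<boxplus> N')" .
  with o show ?thesis
    unfolding isomorphic_iff by (intro exI[of _ f] exI[of _ g]) simp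
qed

lemma carrier_wsym: "carrier (wsym_monoid C) = (\<lambda>M. isomorphic_wsym C `` {M}) ` obj C"
  by (auto simp: wsym_monoid_def quotient_monoid_def quotient_def weakly_symmetric_eq)

lemma wsym_mult: "M \<in> obj C \<Longrightarrow> N \<in> obj C \<Longrightarrow>
    isomorphic_wsym C `` {M} \<otimes>\<^bsub>wsym_monoid C\<^esub> isomorphic_wsym C `` {N} = isomorphic_wsym C `` {M \<boxplus> N}"
  unfolding wsym_monoid_def weakly_symmetric_eq
  by (rule quotient_monoid_mult[OF isomorphic_equiv isomorphic_dsum])

lemma hyperbolic_class_eq:
  assumes "M \<in> obj C"
  shows "hyperbolic_class C (isomorphic_wsym C `` {M}) = isometric C `` {hyperbolic C M}"
proof -
  have "isometric C `` {hyperbolic C N} = isometric C `` {hyperbolic C M}" if "(M, N) \<in> isomorphic_wsym C" for N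
  proof (rule Q.class_eqI[symmetric])
    show "(hyperbolic C M, hyperbolic C N) \<in> isometric C"
      using that unfolding isomorphic_iff
      by (elim exE conjE) (simp add: isometric_iff typed_form_hyperbolic qform_hyp hyp_cong)
  qed
  moreover have "(M, M) \<in> isomorphic_wsym C"
    using isomorphic_equiv assms by (meson equivE refl_onD)
  ultimately show ?thesis
    unfolding hyperbolic_class_def by blast
qed

lemma hyperbolic_quad: "M \<in> obj C \<Longrightarrow> hyperbolic C M \<in> quad_obj C"
  by (simp add: quad_obj_iff typed_form_hyperbolic qform_hyp)

interpretation S: comm_semiring Q.quotient_ring
  by (rule Q_comm_semiring)

text \<open>\<open>hyp_dsum\<close> makes the hyperbolic map additive on classes, so its image
  consists of the differences of hyperbolic classes.\<close>

lemma hyperbolic_image_eq: "hyperbolic_image C =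
    (\<lambda>p. groth_rel (quad_monoid C) `` {p}) ` (hyperbolic_class C ` carrier (wsym_monoid C) \<times> hyperbolic_class C ` carrier (wsym_monoid C))"
  unfolding hyperbolic_image_def quad_monoid_eq
proof (rule S.groth_map_image)
  fix a b assume "a \<in> carrier (wsym_monoid C)" "b \<in> carrier (wsym_monoid C)"
  then obtain M N where a: "M \<in> obj C" "N \<in> obj C" "a = isomorphic_wsym C `` {M}" "b = isomorphic_wsym C `` {N}"
    by (auto simp: carrier_wsym)
  then show "a \<otimes>\<^bsub>wsym_monoid C\<^esub> b \<in> carrier (wsym_monoid C)"
    by (simp add: wsym_mult carrier_wsym)
  have "(hyperbolic C (M \<boxplus> N), orth_sum C (hyperbolic C M) (hyperbolic C N)) \<in> isometric C"
    using a by (simp add: isometric_iff typed_form_simps typed_form_hyperbolic hyperbolic_quad qform_hyp qform_qsum isom_sym hyp_dsum)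
  then show "hyperbolic_class C (a \<otimes>\<^bsub>wsym_monoid C\<^esub> b)
      = hyperbolic_class C a \<oplus>\<^bsub>Q.quotient_ring\<^esub> hyperbolic_class C b"
    using a by (simp add: wsym_mult hyperbolic_class_eq Q.add_class hyperbolic_quad Q.class_eqI)
next
  fix a assume "a \<in> carrier (wsym_monoid C)"
  then show "hyperbolic_class C a \<in> carrier Q.quotient_ring"
    by (auto simp: carrier_wsym hyperbolic_class_eq Q.carrier_quotient_ring hyperbolic_quad intro!: quotientI)
qed

lemma hyperbolic_ideal: "ideal (hyperbolic_image C) S.Groth.quotient_ring"
  unfolding hyperbolic_image_eq quad_monoid_eq
proof (rule S.diff_ideal)
  let ?H = "hyperbolic_class C ` carrier (wsym_monoid C)"
  have H: "?H = (\<lambda>M. isometric C `` {hyperbolic C M}) ` obj C"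
    by (auto simp: carrier_wsym hyperbolic_class_eq image_image)
  show "?H \<subseteq> carrier Q.quotient_ring"
    by (auto simp: H Q.carrier_quotient_ring hyperbolic_quad intro!: quotientI)
  show "?H \<noteq> {}"
    unfolding H using unit_obj by blast
  fix x a assume a: "a \<in> ?H"
  then obtain M where M: "M \<in> obj C" "a = isometric C `` {hyperbolic C M}"
    by (auto simp: H)
  show "x \<oplus>\<^bsub>Q.quotient_ring\<^esub> a \<in> ?H" if "x \<in> ?H"
  proof -
    from that obtain N where N: "N \<in> obj C" "x = isometric C `` {hyperbolic C N}"
      by (auto simp: H)
    have "(orth_sum C (hyperbolic C N) (hyperbolic C M), hyperbolic C (N \<boxplus> M)) \<in> isometric C"
      using M N by (simp add: isometric_iff typed_form_simps typed_form_hyperbolic hyperbolic_quad qform_hyp qform_qsum hyp_dsum)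
    then show ?thesis
      using M N by (auto simp: H Q.add_class hyperbolic_quad Q.class_eqI)
  qed
  show "x \<otimes>\<^bsub>Q.quotient_ring\<^esub> a \<in> ?H" if "x \<in> carrier Q.quotient_ring"
  proof -
    from that obtain z where z: "z \<in> quad_obj C" "x = isometric C `` {z}"
      unfolding Q.carrier_quotient_ring by (rule Q.classE)
    have "fst z \<in> obj C"
      using z(1) by (auto simp: quad_obj_def)
    \<comment> \<open>The hyperbolic factor stands on the right here. Commutativity moves it to the
      left, where \<open>hyp_qten\<close> identifies the product.\<close>
    moreover have "(quad_tensor C z (hyperbolic C M), hyperbolic C (M \<boxtimes> fst z)) \<in> isometric C"
      using M z \<open>fst z \<in> obj C\<close> isom_trans[OF qten_comm[of "typed_form z" "hyp M"] hyp_qten[of M "typed_form z"]]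
      by (simp add: isometric_iff typed_form_simps typed_form_hyperbolic hyperbolic_quad qform_hyp qform_qten fst_typed_form)
    ultimately show ?thesis
      using M z by (auto simp: H Q.mult_class hyperbolic_quad Q.class_eqI)
  qed
qed

text \<open>The multiplication is \<open>rcoset_mult\<close>, that of the Grothendieck ring modulo
  the ideal of hyperbolic differences; by \<open>Groth_Quot\<close> the additive part of this factor
  ring is the Witt group as defined.\<close>

lemma witt_ring:
  "\<exists>mul. cring \<lparr>carrier = carrier (witt_group C), monoid.mult = mul, one = witt_class C (quad_unit C),
        zero = \<one>\<^bsub>witt_group C\<^esub>, add = monoid.mult (witt_group C)\<rparr>
    \<and> (\<forall>x\<in>quad_obj C. \<forall>y\<in>quad_obj C. mul (witt_class C x) (witt_class C y) = witt_class C (quad_tensor C x y))"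
proof -
  let ?G = "S.Groth.quotient_ring" and ?J = "hyperbolic_image C"
  interpret J: ideal ?J ?G by (rule hyperbolic_ideal)
  \<comment> \<open>The group-theoretic coset of the definition is read as an additive coset of the
    ideal, so that the product rule for ideal cosets applies.\<close>
  have coset: "witt_class C x = ?J +>\<^bsub>?G\<^esub> groth_class (quad_monoid C) (isometric C `` {x})" for x
    unfolding witt_class_def quad_monoid_eq
    by (simp only: a_r_coset_def monoid_record_simps S.additive_Groth[symmetric]) (simp add: r_coset_def)
  have closed: "groth_class (quad_monoid C) (isometric C `` {x}) \<in> carrier ?G" if "x \<in> quad_obj C" for x
    unfolding quad_monoid_eq using that
    by (intro S.groth_class_closed) (simp add: Q.carrier_quotient_ring quotientI)
  have "cring (?G Quot ?J)"
    by (rule J.quotient_is_cring[OF S.Groth_cring])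
  then have "cring \<lparr>carrier = carrier (witt_group C), monoid.mult = rcoset_mult ?G ?J, one = witt_class C (quad_unit C),
        zero = \<one>\<^bsub>witt_group C\<^esub>, add = monoid.mult (witt_group C)\<rparr>"
    unfolding S.Groth_Quot unfolding quad_monoid_eq[symmetric] witt_group_def witt_class_def Q.one_quotient_ring .
  moreover have "rcoset_mult ?G ?J (witt_class C x) (witt_class C y) = witt_class C (quad_tensor C x y)"
    if "x \<in> quad_obj C" "y \<in> quad_obj C" for x y
  proof -
    have "isometric C `` {x} \<in> carrier Q.quotient_ring" "isometric C `` {y} \<in> carrier Q.quotient_ring"
      using that by (simp_all add: Q.carrier_quotient_ring quotientI)
    then have "groth_class (quad_monoid C) (isometric C `` {x}) \<otimes>\<^bsub>?G\<^esub> groth_class (quad_monoid C) (isometric C `` {y})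
        = groth_class (quad_monoid C) (isometric C `` {x} \<otimes>\<^bsub>Q.quotient_ring\<^esub> isometric C `` {y})"
      unfolding quad_monoid_eq by (rule S.groth_class_mult)
    then show ?thesis
      unfolding coset using that by (simp add: J.rcoset_mult_add closed Q.mult_class)
  qed
  ultimately show ?thesis
    by blast
qed

end

theorem proposition2p10:
  fixes k :: "('k, 'r) ring_scheme" and C :: "('k, 'o, 'm) rb_cat"
  assumes "klinear_rigid_braided_category k C"
    and "\<one>\<^bsub>k\<^esub> \<oplus>\<^bsub>k\<^esub> \<one>\<^bsub>k\<^esub> \<in> Units k"
    and "symmetric_braiding C"
  shows "(\<forall>x\<in>quad_obj C. \<forall>y\<in>quad_obj C. quad_tensor C x y \<in> quad_obj C)
    \<and> quad_unit C \<in> quad_obj C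
    \<and> (\<exists>mul. cring \<lparr>carrier = carrier (witt_group C), monoid.mult = mul,
                    one = witt_class C (quad_unit C),
                    zero = \<one>\<^bsub>witt_group C\<^esub>, add = monoid.mult (witt_group C)\<rparr>
        \<and> (\<forall>x\<in>quad_obj C. \<forall>y\<in>quad_obj C.
              mul (witt_class C x) (witt_class C y) = witt_class C (quad_tensor C x y)))"
proof -
  interpret klinear_rigid_symmetric_category k C
    using assms(1,3)
    by (simp add: klinear_rigid_symmetric_category_def klinear_rigid_symmetric_category_axioms_def)
  show ?thesis
    using witt_ring Q.ti_closed Q.un_closed by blast
qed

end
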